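(* Let $M=(M_1\times_f M_2)\times_h M_3$ be a sequential warped product equipped with the metric $g=(g_1\oplus f^2g_2)\oplus h^2g_3$ and let $(M,g,X,\lambda,\rho)$ be a Ricci-Bourguignon soliton. Assume that $\mathrm{Hess} f=\sigma g$ and $\overline{\mathrm{Hess}}\,h=\psi g$ for smooth functions $\sigma,\psi$. Then $(M_i,g_i)$ is an Einstein manifold for each $1\le i\le 3$ if one of the following conditions holds: (i) $X=X_1$ with $X_1\in\mathfrak{X}(M_1)$, and $X_1$ is Killing on $(M_1,g_1)$. (ii) $X=X_2$ with $X_2\in\mathfrak{X}(M_2)$, and $X_2$ is Killing on $(M_2,g_2)$. (iii) $X=X_3$ with $X_3\in\mathfrak{X}(M_3)$, and $X_3$ is Killing on $(M_3,g_3)$.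
   Context: Let $(M_i,g_i)$, $1\le i\le 3$, be semi-Riemannian manifolds of dimension $n_i$, and let $f:M_1\to\mathbb{R}^+$, $h:M_1\times M_2\to\mathbb{R}^+$ be smooth functions (the warping functions). The sequential warped product $M=(M_1\times_f M_2)\times_h M_3$ is the manifold $M_1\times M_2\times M_3$ with metric $g=(g_1\oplus f^2g_2)\oplus h^2g_3$. Functions and vector fields on the factors are identified with their lifts to $M$. $\mathfrak{X}(M_i)$ is the set of smooth vector fields on $M_i$. Put $\overline M=M_1\times M_2$ with the metric $g_1\oplus f^2g_2$. $\mathrm{Hess}$ is the Hessian on $(M,g)$ and $\overline{\mathrm{Hess}}$ is the Hessian on $\overline M$. $\mathrm{Hess} f=\sigma g$ is an equality of bilinear forms on $M$; $\overline{\mathrm{Hess}}\,h=\psi g$ is an equality of bilinear forms on vectors tangent to $\overline M$ (where $g$ restricts to $g_1\oplus f^2g_2$). A Ricci-Bourguignon soliton $(M,g,X,\lambda,\rho)$ is a semi-Riemannian manifold $(M,g)$ with a vector field $X$ and real constants $\lambda,\rho$ such that $\mathrm{Ric}+\frac12\mathcal{L}_Xg=\lambda g+\rho Rg$, where $R$ is the scalar curvature of $g$. A vector field $V$ on $(N,g_N)$ is Killing if $\mathcal{L}_Vg_N=0$. $(N,g_N)$ is called Einstein if its Ricci tensor is $\mu g_N$ for some smooth function $\mu$ on $N$ (the factor). *)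

theory Defs
  imports "HOL-Analysis.Analysis"
begin

section \<open>Smooth maps between open subsets of Euclidean spaces\<close>

primrec Ck_on :: "nat \<Rightarrow> 'a::euclidean_space set \<Rightarrow> ('a \<Rightarrow> 'b::real_normed_vector) \<Rightarrow> bool" where
  "Ck_on 0 S F \<longleftrightarrow> continuous_on S F"
| "Ck_on (Suc k) S F \<longleftrightarrow> F differentiable_on S \<and>
     (\<forall>v. Ck_on k S (\<lambda>x. frechet_derivative F (at x) v))"

text \<open>Only used for open \<open>S\<close>.\<close>
definition smooth_on :: "'a::euclidean_space set \<Rightarrow> ('a \<Rightarrow> 'b::real_normed_vector) \<Rightarrow> bool" where
  "smooth_on S F \<longleftrightarrow> (\<forall>k. Ck_on k S F)"

section \<open>Smooth manifolds\<close>

text \<open>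
  The point set of a manifold is a whole type, and its smooth structure is given by an atlas, which
  need not be maximal. The model space \<open>'a\<close> carries the dimension \<open>DIM('a)\<close>.
  The values of \<open>chart_map c\<close> outside \<open>chart_dom c\<close> are irrelevant.
\<close>
datatype ('m, 'a) chart = Chart (chart_dom: "'m set") (chart_map: "'m \<Rightarrow> 'a")

definition chart_inv :: "('m, 'a) chart \<Rightarrow> 'a \<Rightarrow> 'm" where
  "chart_inv c = inv_into (chart_dom c) (chart_map c)"

definition chart_img :: "('m, 'a) chart \<Rightarrow> 'a set" where
  "chart_img c = chart_map c ` chart_dom c"

definition is_chart :: "('m::topological_space, 'a::euclidean_space) chart \<Rightarrow> bool" where
  "is_chart c \<longleftrightarrow> open (chart_dom c) \<and> open (chart_img c) \<and>
     homeomorphism (chart_dom c) (chart_img c) (chart_map c) (chart_inv c)"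

definition smooth_atlas ::
  "('m::{t2_space,second_countable_topology}, 'a::euclidean_space) chart set \<Rightarrow> bool" where
  "smooth_atlas A \<longleftrightarrow>
     (\<forall>c\<in>A. is_chart c) \<and> (\<Union>c\<in>A. chart_dom c) = UNIV \<and>
     (\<forall>c\<in>A. \<forall>d\<in>A. smooth_on (chart_map c ` (chart_dom c \<inter> chart_dom d)) (chart_map d \<circ> chart_inv c))"

definition prod_chart :: "('m, 'a) chart \<Rightarrow> ('n, 'b) chart \<Rightarrow> ('m \<times> 'n, 'a \<times> 'b) chart" where
  "prod_chart c d = Chart (chart_dom c \<times> chart_dom d) (map_prod (chart_map c) (chart_map d))"

definition prod_atlas ::
  "('m, 'a) chart set \<Rightarrow> ('n, 'b) chart set \<Rightarrow> ('m \<times> 'n, 'a \<times> 'b) chart set" where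
  "prod_atlas A B = {prod_chart c d |c d. c \<in> A \<and> d \<in> B}"

definition smooth_fun_on ::
  "('m, 'a::euclidean_space) chart set \<Rightarrow> 'm set \<Rightarrow> ('m \<Rightarrow> real) \<Rightarrow> bool" where
  "smooth_fun_on A U \<phi> \<longleftrightarrow>
     (\<forall>c\<in>A. smooth_on (chart_map c ` (chart_dom c \<inter> U)) (\<phi> \<circ> chart_inv c))"

abbreviation smooth_fun :: "('m, 'a::euclidean_space) chart set \<Rightarrow> ('m \<Rightarrow> real) \<Rightarrow> bool" where
  "smooth_fun A \<equiv> smooth_fun_on A UNIV"

definition smooth_near ::
  "('m::topological_space, 'a::euclidean_space) chart set \<Rightarrow> 'm \<Rightarrow> ('m \<Rightarrow> real) \<Rightarrow> bool" where
  "smooth_near A p \<phi> \<longleftrightarrow> (\<exists>U. open U \<and> p \<in> U \<and> smooth_fun_on A U \<phi>)"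

section \<open>Tangent vectors and vector fields\<close>

text \<open>
  A tangent vector at \<open>p\<close> is a directional derivative operator on the functions that are smooth near
  \<open>p\<close>. Since HOL functions are total, it is given the value 0 on all other functions.
\<close>
type_synonym 'm tvec = "('m \<Rightarrow> real) \<Rightarrow> real"

text \<open>The tangent vector at \<open>p\<close> whose components in the chart \<open>c\<close> are those of \<open>v\<close>.\<close>
definition coord_vec ::
  "('m::topological_space, 'a::euclidean_space) chart set \<Rightarrow> ('m, 'a) chart \<Rightarrow> 'm \<Rightarrow> 'a \<Rightarrow> 'm tvec" where
  "coord_vec A c p v = (\<lambda>\<phi>. if smooth_near A p \<phi>
     then frechet_derivative (\<phi> \<circ> chart_inv c) (at (chart_map c p)) v else 0)"

definition tangent_space ::
  "('m::topological_space, 'a::euclidean_space) chart set \<Rightarrow> 'm \<Rightarrow> 'm tvec set" where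
  "tangent_space A p = {coord_vec A c p v |c v. c \<in> A \<and> p \<in> chart_dom c}"

text \<open>The differential of the chart \<open>c\<close>, applied to a tangent vector.\<close>
definition coords :: "('m, 'a::euclidean_space) chart \<Rightarrow> 'm tvec \<Rightarrow> 'a" where
  "coords c u = (\<Sum>b\<in>Basis. u (\<lambda>q. chart_map c q \<bullet> b) *\<^sub>R b)"

text \<open>The differential of a smooth map \<open>\<pi>\<close>, applied to a tangent vector.\<close>
definition push :: "('m \<Rightarrow> 'n) \<Rightarrow> 'm tvec \<Rightarrow> 'n tvec" where
  "push \<pi> u = (\<lambda>\<phi>. u (\<phi> \<circ> \<pi>))"

definition zero_tvec :: "'m tvec" where
  "zero_tvec = (\<lambda>\<phi>. 0)"

definition local_field :: "('m, 'a::euclidean_space) chart \<Rightarrow> ('m \<Rightarrow> 'm tvec) \<Rightarrow> 'a \<Rightarrow> 'a" where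
  "local_field c X x = coords c (X (chart_inv c x))"

definition smooth_vector_field ::
  "('m::topological_space, 'a::euclidean_space) chart set \<Rightarrow> ('m \<Rightarrow> 'm tvec) \<Rightarrow> bool" where
  "smooth_vector_field A X \<longleftrightarrow> (\<forall>p. X p \<in> tangent_space A p) \<and>
     (\<forall>c\<in>A. smooth_on (chart_img c) (local_field c X))"

section \<open>Semi-Riemannian metrics\<close>

type_synonym 'm tensor2 = "'m \<Rightarrow> 'm tvec \<Rightarrow> 'm tvec \<Rightarrow> real"

definition local_form ::
  "('m::topological_space, 'a::euclidean_space) chart set \<Rightarrow> ('m, 'a) chart \<Rightarrow> 'm tensor2
     \<Rightarrow> 'a \<Rightarrow> 'a \<Rightarrow> 'a \<Rightarrow> real" where
  "local_form A c g x v w =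
     g (chart_inv c x) (coord_vec A c (chart_inv c x) v) (coord_vec A c (chart_inv c x) w)"

text \<open>The index is not required to be constant; on a connected manifold it is so automatically.\<close>
definition semi_riemannian ::
  "('m::{t2_space,second_countable_topology}, 'a::euclidean_space) chart set \<Rightarrow> 'm tensor2 \<Rightarrow> bool" where
  "semi_riemannian A g \<longleftrightarrow> smooth_atlas A \<and>
     (\<forall>c\<in>A. \<forall>v w. smooth_on (chart_img c) (\<lambda>x. local_form A c g x v w)) \<and>
     (\<forall>c\<in>A. \<forall>x\<in>chart_img c. bilinear (local_form A c g x)) \<and>
     (\<forall>p. \<forall>u\<in>tangent_space A p. \<forall>v\<in>tangent_space A p. g p u v = g p v u) \<and>
     (\<forall>p. \<forall>u\<in>tangent_space A p. (\<forall>v\<in>tangent_space A p. g p u v = 0) \<longrightarrow> u = zero_tvec)"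

text \<open>The metric of \<open>M\<^sub>1 \<times>\<^sub>f M\<^sub>2\<close>, that is, the direct sum of \<open>g1\<close> and \<open>f\<^sup>2 g2\<close>.\<close>
definition warped_metric ::
  "'m tensor2 \<Rightarrow> ('m \<Rightarrow> real) \<Rightarrow> 'n tensor2 \<Rightarrow> ('m \<times> 'n) tensor2" where
  "warped_metric g1 f g2 = (\<lambda>p u v.
     g1 (fst p) (push fst u) (push fst v) + (f (fst p))\<^sup>2 * g2 (snd p) (push snd u) (push snd v))"

section \<open>Calculus of a metric in a chart\<close>

text \<open>
  In this section \<open>G\<close> is the coordinate expression of a metric, and vector fields on (an open subset
  of) the model space \<open>'a\<close> are functions \<open>'a \<Rightarrow> 'a\<close>. Constant functions are the coordinate fields and
  their linear combinations with constant coefficients.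
\<close>

definition deriv_along :: "('a \<Rightarrow> 'a) \<Rightarrow> ('a::euclidean_space \<Rightarrow> 'b::real_normed_vector) \<Rightarrow> 'a \<Rightarrow> 'b" where
  "deriv_along V F x = frechet_derivative F (at x) (V x)"

definition lie_bracket :: "('a \<Rightarrow> 'a) \<Rightarrow> ('a \<Rightarrow> 'a) \<Rightarrow> 'a::euclidean_space \<Rightarrow> 'a" where
  "lie_bracket V W x = deriv_along V W x - deriv_along W V x"

text \<open>The vector that is \<open>G\<close>-dual to the linear form \<open>\<alpha>\<close>.\<close>
definition raise :: "('a \<Rightarrow> 'a \<Rightarrow> real) \<Rightarrow> ('a \<Rightarrow> real) \<Rightarrow> 'a" where
  "raise B \<alpha> = (THE z. \<forall>u. B z u = \<alpha> u)"

text \<open>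
  The Levi-Civita derivative of \<open>w\<close> along \<open>v\<close>, by the Koszul formula for coordinate fields, whose
  brackets vanish.
\<close>
definition christoffel :: "('a \<Rightarrow> 'a \<Rightarrow> 'a \<Rightarrow> real) \<Rightarrow> 'a::euclidean_space \<Rightarrow> 'a \<Rightarrow> 'a \<Rightarrow> 'a" where
  "christoffel G x v w = raise (G x) (\<lambda>u.
     (deriv_along (\<lambda>_. v) (\<lambda>y. G y w u) x + deriv_along (\<lambda>_. w) (\<lambda>y. G y v u) x
       - deriv_along (\<lambda>_. u) (\<lambda>y. G y v w) x) / 2)"

definition cov_deriv ::
  "('a \<Rightarrow> 'a \<Rightarrow> 'a \<Rightarrow> real) \<Rightarrow> ('a \<Rightarrow> 'a) \<Rightarrow> ('a \<Rightarrow> 'a) \<Rightarrow> 'a::euclidean_space \<Rightarrow> 'a" where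
  "cov_deriv G V W x = deriv_along V W x + christoffel G x (V x) (W x)"

definition riemann_curvature ::
  "('a \<Rightarrow> 'a \<Rightarrow> 'a \<Rightarrow> real) \<Rightarrow> ('a \<Rightarrow> 'a) \<Rightarrow> ('a \<Rightarrow> 'a) \<Rightarrow> ('a \<Rightarrow> 'a) \<Rightarrow> 'a::euclidean_space \<Rightarrow> 'a" where
  "riemann_curvature G U V W x =
     cov_deriv G U (cov_deriv G V W) x - cov_deriv G V (cov_deriv G U W) x
       - cov_deriv G (lie_bracket U V) W x"

text \<open>
  The curvature, the Hessian and the Lie derivative are tensorial, so that their values at vectors
  \<open>v\<close>, \<open>w\<close> may be computed from the constant fields \<open>v\<close>, \<open>w\<close>.
  The Ricci tensor is the trace of the map that sends \<open>u\<close> to \<open>R(u, v)w\<close>.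
\<close>
definition local_ricci :: "('a \<Rightarrow> 'a \<Rightarrow> 'a \<Rightarrow> real) \<Rightarrow> 'a::euclidean_space \<Rightarrow> 'a \<Rightarrow> 'a \<Rightarrow> real" where
  "local_ricci G x v w =
     (\<Sum>b\<in>Basis. riemann_curvature G (\<lambda>_. b) (\<lambda>_. v) (\<lambda>_. w) x \<bullet> b)"

text \<open>The trace of the Ricci tensor with respect to \<open>G\<close>.\<close>
definition local_scalar :: "('a \<Rightarrow> 'a \<Rightarrow> 'a \<Rightarrow> real) \<Rightarrow> 'a::euclidean_space \<Rightarrow> real" where
  "local_scalar G x = (\<Sum>b\<in>Basis. raise (G x) (local_ricci G x b) \<bullet> b)"

definition local_hessian ::
  "('a \<Rightarrow> 'a \<Rightarrow> 'a \<Rightarrow> real) \<Rightarrow> ('a \<Rightarrow> real) \<Rightarrow> 'a::euclidean_space \<Rightarrow> 'a \<Rightarrow> 'a \<Rightarrow> real" where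
  "local_hessian G F x v w =
     deriv_along (\<lambda>_. v) (deriv_along (\<lambda>_. w) F) x
       - deriv_along (cov_deriv G (\<lambda>_. v) (\<lambda>_. w)) F x"

definition local_lie ::
  "('a \<Rightarrow> 'a \<Rightarrow> 'a \<Rightarrow> real) \<Rightarrow> ('a \<Rightarrow> 'a) \<Rightarrow> 'a::euclidean_space \<Rightarrow> 'a \<Rightarrow> 'a \<Rightarrow> real" where
  "local_lie G X x v w =
     deriv_along X (\<lambda>y. G y v w) x
       - G x (lie_bracket X (\<lambda>_. v) x) w - G x v (lie_bracket X (\<lambda>_. w) x)"

section \<open>The global tensors\<close>

text \<open>
  The tensors below are evaluated at \<open>p\<close> in some chart around \<open>p\<close>; by their invariance under changes
  of coordinates the choice does not matter.
\<close>
definition chart_at :: "('m, 'a) chart set \<Rightarrow> 'm \<Rightarrow> ('m, 'a) chart" where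
  "chart_at A p = (SOME c. c \<in> A \<and> p \<in> chart_dom c)"

definition ricci ::
  "('m::topological_space, 'a::euclidean_space) chart set \<Rightarrow> 'm tensor2 \<Rightarrow> 'm tensor2" where
  "ricci A g p u v = (let c = chart_at A p in
     local_ricci (local_form A c g) (chart_map c p) (coords c u) (coords c v))"

definition scalar_curvature ::
  "('m::topological_space, 'a::euclidean_space) chart set \<Rightarrow> 'm tensor2 \<Rightarrow> 'm \<Rightarrow> real" where
  "scalar_curvature A g p = (let c = chart_at A p in
     local_scalar (local_form A c g) (chart_map c p))"

definition hessian ::
  "('m::topological_space, 'a::euclidean_space) chart set \<Rightarrow> 'm tensor2 \<Rightarrow> ('m \<Rightarrow> real) \<Rightarrow> 'm tensor2" where
  "hessian A g \<phi> p u v = (let c = chart_at A p in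
     local_hessian (local_form A c g) (\<phi> \<circ> chart_inv c) (chart_map c p) (coords c u) (coords c v))"

definition lie_deriv_metric ::
  "('m::topological_space, 'a::euclidean_space) chart set \<Rightarrow> ('m \<Rightarrow> 'm tvec) \<Rightarrow> 'm tensor2 \<Rightarrow> 'm tensor2" where
  "lie_deriv_metric A X g p u v = (let c = chart_at A p in
     local_lie (local_form A c g) (local_field c X) (chart_map c p) (coords c u) (coords c v))"

definition tensor2_eq ::
  "('m::topological_space, 'a::euclidean_space) chart set \<Rightarrow> 'm tensor2 \<Rightarrow> 'm tensor2 \<Rightarrow> bool" where
  "tensor2_eq A S T \<longleftrightarrow>
     (\<forall>p. \<forall>u\<in>tangent_space A p. \<forall>v\<in>tangent_space A p. S p u v = T p u v)"

definition killing ::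
  "('m::topological_space, 'a::euclidean_space) chart set \<Rightarrow> 'm tensor2 \<Rightarrow> ('m \<Rightarrow> 'm tvec) \<Rightarrow> bool" where
  "killing A g V \<longleftrightarrow> smooth_vector_field A V \<and>
     tensor2_eq A (lie_deriv_metric A V g) (\<lambda>p u v. 0)"

definition einstein ::
  "('m::{t2_space,second_countable_topology}, 'a::euclidean_space) chart set \<Rightarrow> 'm tensor2 \<Rightarrow> bool" where
  "einstein A g \<longleftrightarrow> semi_riemannian A g \<and>
     (\<exists>\<mu>. smooth_fun A \<mu> \<and> tensor2_eq A (ricci A g) (\<lambda>p u v. \<mu> p * g p u v))"

definition ricci_bourguignon_soliton ::
  "('m::{t2_space,second_countable_topology}, 'a::euclidean_space) chart set \<Rightarrow> 'm tensor2
     \<Rightarrow> ('m \<Rightarrow> 'm tvec) \<Rightarrow> real \<Rightarrow> real \<Rightarrow> bool" where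
  "ricci_bourguignon_soliton A g X lam rho \<longleftrightarrow>
     semi_riemannian A g \<and> smooth_vector_field A X \<and>
     tensor2_eq A
       (\<lambda>p u v. ricci A g p u v + 1/2 * lie_deriv_metric A X g p u v)
       (\<lambda>p u v. lam * g p u v + rho * scalar_curvature A g p * g p u v)"

section \<open>Lifts to a triple product\<close>

text \<open>
  \<open>X\<close> is the lift of a vector field on one factor: it projects to that field, and to zero on the
  other two factors.
\<close>

definition is_lift1 :: "('m1 \<Rightarrow> 'm1 tvec) \<Rightarrow> (('m1 \<times> 'm2) \<times> 'm3 \<Rightarrow> (('m1 \<times> 'm2) \<times> 'm3) tvec) \<Rightarrow> bool" where
  "is_lift1 X1 X \<longleftrightarrow> (\<forall>p. push (fst \<circ> fst) (X p) = X1 (fst (fst p)) \<and>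
     push (snd \<circ> fst) (X p) = zero_tvec \<and> push snd (X p) = zero_tvec)"

definition is_lift2 :: "('m2 \<Rightarrow> 'm2 tvec) \<Rightarrow> (('m1 \<times> 'm2) \<times> 'm3 \<Rightarrow> (('m1 \<times> 'm2) \<times> 'm3) tvec) \<Rightarrow> bool" where
  "is_lift2 X2 X \<longleftrightarrow> (\<forall>p. push (fst \<circ> fst) (X p) = zero_tvec \<and>
     push (snd \<circ> fst) (X p) = X2 (snd (fst p)) \<and> push snd (X p) = zero_tvec)"

definition is_lift3 :: "('m3 \<Rightarrow> 'm3 tvec) \<Rightarrow> (('m1 \<times> 'm2) \<times> 'm3 \<Rightarrow> (('m1 \<times> 'm2) \<times> 'm3) tvec) \<Rightarrow> bool" where
  "is_lift3 X3 X \<longleftrightarrow> (\<forall>p. push (fst \<circ> fst) (X p) = zero_tvec \<and>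
     push (snd \<circ> fst) (X p) = zero_tvec \<and> push snd (X p) = X3 (snd p))"

end

theory Submission
  imports Defs
begin

text \<open>
  Each component of the soliton equation lives on one factor. On vectors tangent to a factor the
  Ricci tensor of a warped product is the Ricci tensor of that factor, minus a multiple of the
  Hessian of the warping function (base), or plus a multiple of the metric (fibre); the Hessian
  hypotheses turn the base correction into a multiple of the metric too. The Lie derivative of the
  metric along the lift of a Killing field is likewise a multiple of the metric on each factor, the
  only surviving terms coming from the derivatives of \<open>f\<^sup>2\<close> and \<open>h\<^sup>2\<close>. Hence
  \<open>Ric\<^sub>i = \<mu> g\<^sub>i\<close> at every point, whatever the value of the scalar curvature, and \<open>\<mu>\<close> is smooth
  because locally \<open>\<mu> = Ric\<^sub>i(v, w) / g\<^sub>i(v, w)\<close> for suitable coordinate fields.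
  The charts chosen by \<^const>\<open>chart_at\<close> on a product and on its factors are unrelated, so the
  coordinate invariance of the tensors is needed.
\<close>

section \<open>Calculus of smooth maps\<close>

text \<open>Two obstacles shape the development. First, \<open>raise\<close> is a definite
  description for a form that may be indefinite, so neither an explicit inverse matrix nor
  positivity gives the smoothness of the Christoffel symbols. It comes from implicit
  differentiation: a local lower bound makes the dual vector continuous, continuity already makes it
  differentiable, and its derivative is again a dual vector, so that induction on the order of
  differentiability closes. Second, coordinate expressions are controlled only over chart images.
  Comparisons between two charts, and between a product chart and the explicit warped form, are
  therefore both phrased as local isometries, and each tensor is shown once to be invariant under
  these. The three conditions on X are handled as one: X splits into one field on each factor, and
  each of these is Killing or zero.\<close>

abbreviation dd :: "('a::real_normed_vector \<Rightarrow> 'b::real_normed_vector) \<Rightarrow> 'a \<Rightarrow> 'a \<Rightarrow> 'b" where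
  "dd F x \<equiv> frechet_derivative F (at x)"

lemma dd_eqI: "(F has_derivative F') (at x) \<Longrightarrow> dd F x = F'"
  by (metis frechet_derivative_at)

lemma dd_cong:
  assumes "open S" "x \<in> S" "\<And>y. y \<in> S \<Longrightarrow> F y = G y"
  shows "dd F x = dd G x"
proof -
  have "(F has_derivative D) (at x) \<longleftrightarrow> (G has_derivative D) (at x)" for D
    using assms has_derivative_transform_within_open[of F D x UNIV S G]
      has_derivative_transform_within_open[of G D x UNIV S F] by auto
  then show ?thesis unfolding frechet_derivative_def by simp
qed

text \<open>The congruence rule of order k is a premise because \<open>Ck_on_cong\<close> is proved
  by induction through this very lemma. It is what allows F', which agrees with the
  \<open>frechet_derivative\<close> only on S, to stand in for it.\<close>

lemma Ck_on_SucI_cong: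
  fixes F :: "'a::euclidean_space \<Rightarrow> 'b::real_normed_vector"
  assumes "open S" "\<And>x. x \<in> S \<Longrightarrow> (F has_derivative F' x) (at x)" "\<And>v. Ck_on k S (\<lambda>x. F' x v)"
    and cong: "\<And>G H :: 'a \<Rightarrow> 'b. (\<And>x. x \<in> S \<Longrightarrow> G x = H x) \<Longrightarrow> Ck_on k S G \<Longrightarrow> Ck_on k S H"
  shows "Ck_on (Suc k) S F"
proof -
  have "F differentiable_on S"
    unfolding differentiable_on_def
    using assms(2) differentiable_def has_derivative_at_withinI by blast
  moreover have "Ck_on k S (\<lambda>x. dd F x v)" for v
    using cong[of "\<lambda>x. F' x v" "\<lambda>x. dd F x v"] assms(3) dd_eqI[OF assms(2)] by simp
  ultimately show ?thesis by simp
qed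

lemma Ck_on_has_derivative:
  assumes "Ck_on (Suc k) S F" "open S" "x \<in> S"
  shows "(F has_derivative dd F x) (at x)"
  using assms by (metis Ck_on.simps(2) at_within_open differentiable_on_def frechet_derivative_works)

lemma Ck_on_cong:
  assumes "open S" "\<And>x. x \<in> S \<Longrightarrow> G x = H x" "Ck_on k S G"
  shows "Ck_on k S H"
  using assms(2,3)
proof (induction k arbitrary: G H)
  case 0
  then show ?case using continuous_on_cong[of S S G H] by simp
next
  case (Suc k)
  have "(H has_derivative dd G x) (at x)" if "x \<in> S" for x
    using Ck_on_has_derivative[OF Suc.prems(2) assms(1) that] that Suc.prems(1) assms(1)
    by (metis has_derivative_transform_within_open)
  moreover have "Ck_on k S (\<lambda>x. dd G x v)" for v
    using Suc.prems(2) by simp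
  ultimately show ?case
    by (intro Ck_on_SucI_cong[OF assms(1)]) (assumption | rule Suc.IH)+
qed

lemma Ck_on_SucI:
  assumes "open S" "\<And>x. x \<in> S \<Longrightarrow> (F has_derivative F' x) (at x)" "\<And>v. Ck_on k S (\<lambda>x. F' x v)"
  shows "Ck_on (Suc k) S F"
  using Ck_on_SucI_cong[OF assms] Ck_on_cong[OF assms(1)] by blast

lemma Ck_on_Suc_imp: "Ck_on (Suc k) S F \<Longrightarrow> Ck_on k S F"
  by (induction k arbitrary: F) (auto intro: differentiable_imp_continuous_on)

lemma Ck_on_subset: "Ck_on k S F \<Longrightarrow> T \<subseteq> S \<Longrightarrow> Ck_on k T F"
  by (induction k arbitrary: F) (auto intro: continuous_on_subset differentiable_on_subset)

lemma Ck_on_const: "Ck_on k S (\<lambda>x. c)"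
  by (induction k arbitrary: c) auto

lemma Ck_on_linear:
  assumes "bounded_linear L" "open S" "Ck_on k S F"
  shows "Ck_on k S (\<lambda>x. L (F x))"
  using assms(3)
proof (induction k arbitrary: F)
  case 0
  then show ?case using assms(1) by (simp add: linear_continuous_on_compose bounded_linear.linear bounded_linear.continuous_on)
next
  case (Suc k)
  show ?case
    using Suc Ck_on_has_derivative[OF Suc.prems assms(2)] assms(1,2)
    by (intro Ck_on_SucI[of S _ "\<lambda>x v. L (dd F x v)"]) (auto intro: bounded_linear.has_derivative)
qed

lemma Ck_on_add:
  assumes "open S" "Ck_on k S F" "Ck_on k S G"
  shows "Ck_on k S (\<lambda>x. F x + G x)"
  using assms(2,3)
proof (induction k arbitrary: F G)
  case 0
  then show ?case by (simp add: continuous_on_add)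
next
  case (Suc k)
  show ?case
    using Suc Ck_on_has_derivative[OF Suc.prems(1) assms(1)] Ck_on_has_derivative[OF Suc.prems(2) assms(1)] assms(1)
    by (intro Ck_on_SucI[of S _ "\<lambda>x v. dd F x v + dd G x v"]) (auto intro: has_derivative_add)
qed

lemma Ck_on_sum:
  "finite I \<Longrightarrow> open S \<Longrightarrow> (\<And>i. i \<in> I \<Longrightarrow> Ck_on k S (F i)) \<Longrightarrow> Ck_on k S (\<lambda>x. \<Sum>i\<in>I. F i x)"
proof (induction rule: finite_induct)
  case empty
  then show ?case by (simp only: sum.empty Ck_on_const)
next
  case (insert i I)
  then have "Ck_on k S (\<lambda>x. F i x + (\<Sum>i\<in>I. F i x))" by (intro Ck_on_add) blast+
  then show ?case by (simp only: sum.insert[OF insert.hyps(1,2)])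
qed

lemma Ck_on_bilinear:
  assumes "bounded_bilinear B" "open S" "Ck_on k S F" "Ck_on k S G"
  shows "Ck_on k S (\<lambda>x. B (F x) (G x))"
  using assms(3,4)
proof (induction k arbitrary: F G)
  case 0
  then show ?case using bounded_bilinear.continuous_on[OF assms(1)] by simp
next
  case (Suc k)
  show ?case
  proof (rule Ck_on_SucI[OF assms(2)])
    show "((\<lambda>x. B (F x) (G x)) has_derivative (\<lambda>v. B (F x) (dd G x v) + B (dd F x v) (G x))) (at x)"
      if "x \<in> S" for x
      using bounded_bilinear.FDERIV[OF assms(1)] Ck_on_has_derivative[OF Suc.prems(1) assms(2) that]
        Ck_on_has_derivative[OF Suc.prems(2) assms(2) that] by blast
    show "Ck_on k S (\<lambda>x. B (F x) (dd G x v) + B (dd F x v) (G x))" for v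
      using Suc.prems Ck_on_Suc_imp[OF Suc.prems(1)] Ck_on_Suc_imp[OF Suc.prems(2)]
      by (intro Ck_on_add[OF assms(2)] Suc.IH) auto
  qed
qed

lemma Ck_on_inverse:
  fixes F :: "'a::euclidean_space \<Rightarrow> real"
  assumes "open S" "\<And>x. x \<in> S \<Longrightarrow> F x \<noteq> 0" "Ck_on k S F"
  shows "Ck_on k S (\<lambda>x. inverse (F x))"
  using assms(3)
proof (induction k)
  case 0
  then show ?case using assms(2) by (simp add: continuous_on_inverse)
next
  case (Suc k)
  show ?case
  proof (rule Ck_on_SucI[OF assms(1)])
    show "((\<lambda>x. inverse (F x)) has_derivative (\<lambda>v. - 1 * (inverse (F x) * dd F x v * inverse (F x)))) (at x)"
      if "x \<in> S" for x
      using Deriv.has_derivative_inverse[OF assms(2)[OF that] Ck_on_has_derivative[OF Suc.prems(1) assms(1) that]]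
      by simp
    have "Ck_on k S (\<lambda>x. inverse (F x))" "Ck_on k S (\<lambda>x. dd F x v)" for v
      using Suc.IH Suc.prems Ck_on_Suc_imp[OF Suc.prems(1)] by auto
    then show "Ck_on k S (\<lambda>x. - 1 * (inverse (F x) * dd F x v * inverse (F x)))" for v
      by (intro Ck_on_bilinear[OF bounded_bilinear_mult assms(1)] Ck_on_const)
  qed
qed

text \<open>The derivative of an affine map is constant, so the derivative of the composite is a
  composite with the same affine map and the induction closes. Projections of a product and
  inclusions of slices are of this kind.\<close>

lemma Ck_on_compose_affine:
  assumes "bounded_linear L" "open S" "open T" "\<And>x. x \<in> S \<Longrightarrow> L x + c \<in> T" "Ck_on k T F"
  shows "Ck_on k S (\<lambda>x. F (L x + c))"
  using assms(5)
proof (induction k arbitrary: F)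
  case 0
  have "continuous_on S (\<lambda>x. L x + c)"
    using linear_continuous_on[OF assms(1)] by (intro continuous_on_add continuous_on_const)
  then show ?case using 0 assms(4) continuous_on_compose2[of T F S "\<lambda>x. L x + c"]
    by (simp add: image_subset_iff)
next
  case (Suc k)
  show ?case
  proof (rule Ck_on_SucI[OF assms(2)])
    fix x assume x: "x \<in> S"
    have "((\<lambda>x. L x + c) has_derivative L) (at x)"
      using assms(1) by (auto intro!: derivative_eq_intros bounded_linear_imp_has_derivative)
    from has_derivative_compose[OF this Ck_on_has_derivative[OF Suc.prems assms(3) assms(4)[OF x]]]
    show "((\<lambda>x. F (L x + c)) has_derivative (\<lambda>v. dd F (L x + c) (L v))) (at x)" .
  next
    show "Ck_on k S (\<lambda>x. dd F (L x + c) (L v))" for v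
      using Suc.IH[of "\<lambda>x. dd F x (L v)"] Suc.prems by simp
  qed
qed

section \<open>Closure properties of smooth maps\<close>

lemma smooth_on_has_derivative:
  "smooth_on S F \<Longrightarrow> open S \<Longrightarrow> x \<in> S \<Longrightarrow> (F has_derivative dd F x) (at x)"
  unfolding smooth_on_def using Ck_on_has_derivative by blast

lemma smooth_on_linear_dd: "smooth_on S F \<Longrightarrow> open S \<Longrightarrow> x \<in> S \<Longrightarrow> linear (dd F x)"
  using smooth_on_has_derivative has_derivative_linear by blast

lemma smooth_on_dd: "smooth_on S F \<Longrightarrow> smooth_on S (\<lambda>x. dd F x v)"
  unfolding smooth_on_def by (metis Ck_on.simps(2))

lemma smooth_on_imp_continuous_on: "smooth_on S F \<Longrightarrow> continuous_on S F"
  unfolding smooth_on_def by (metis Ck_on.simps(1))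

lemma smooth_on_subset: "smooth_on S F \<Longrightarrow> T \<subseteq> S \<Longrightarrow> smooth_on T F"
  unfolding smooth_on_def using Ck_on_subset by blast

lemma smooth_on_cong:
  "open S \<Longrightarrow> (\<And>x. x \<in> S \<Longrightarrow> G x = H x) \<Longrightarrow> smooth_on S G \<Longrightarrow> smooth_on S H"
  unfolding smooth_on_def using Ck_on_cong by blast

lemma smooth_on_const: "smooth_on S (\<lambda>x. c)"
  by (simp add: smooth_on_def Ck_on_const)

lemma smooth_on_linear: "bounded_linear L \<Longrightarrow> open S \<Longrightarrow> smooth_on S F \<Longrightarrow> smooth_on S (\<lambda>x. L (F x))"
  unfolding smooth_on_def using Ck_on_linear by blast

lemma smooth_on_add: "open S \<Longrightarrow> smooth_on S F \<Longrightarrow> smooth_on S G \<Longrightarrow> smooth_on S (\<lambda>x. F x + G x)"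
  unfolding smooth_on_def using Ck_on_add by blast

lemma smooth_on_bilinear:
  "bounded_bilinear B \<Longrightarrow> open S \<Longrightarrow> smooth_on S F \<Longrightarrow> smooth_on S G \<Longrightarrow> smooth_on S (\<lambda>x. B (F x) (G x))"
  unfolding smooth_on_def using Ck_on_bilinear by blast

lemmas smooth_on_mult = smooth_on_bilinear[OF bounded_bilinear_mult]
lemmas smooth_on_scaleR = smooth_on_bilinear[OF bounded_bilinear_scaleR]

lemma smooth_on_inverse:
  fixes F :: "'a::euclidean_space \<Rightarrow> real"
  shows "open S \<Longrightarrow> (\<And>x. x \<in> S \<Longrightarrow> F x \<noteq> 0) \<Longrightarrow> smooth_on S F \<Longrightarrow> smooth_on S (\<lambda>x. inverse (F x))"
  unfolding smooth_on_def using Ck_on_inverse by blast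

lemma smooth_on_minus: "open S \<Longrightarrow> smooth_on S F \<Longrightarrow> smooth_on S (\<lambda>x. - F x)"
  using smooth_on_linear[of uminus] bounded_linear_minus[OF bounded_linear_ident] by blast

lemma smooth_on_diff: "open S \<Longrightarrow> smooth_on S F \<Longrightarrow> smooth_on S G \<Longrightarrow> smooth_on S (\<lambda>x. F x - G x)"
  using smooth_on_add[of S F "\<lambda>x. - G x"] smooth_on_minus[of S G] by simp

lemma smooth_on_sum:
  "finite I \<Longrightarrow> open S \<Longrightarrow> (\<And>i. i \<in> I \<Longrightarrow> smooth_on S (F i)) \<Longrightarrow> smooth_on S (\<lambda>x. \<Sum>i\<in>I. F i x)"
  unfolding smooth_on_def using Ck_on_sum by blast

lemma smooth_on_compose_affine:
  assumes "bounded_linear L" "open S" "open T" "\<And>x. x \<in> S \<Longrightarrow> L x + c \<in> T" "smooth_on T F"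
  shows "smooth_on S (\<lambda>x. F (L x + c))"
  using assms Ck_on_compose_affine unfolding smooth_on_def by blast

lemma smooth_on_ident: "open S \<Longrightarrow> smooth_on S (\<lambda>x. x)"
  unfolding smooth_on_def
proof
  fix k assume "open S" then show "Ck_on k S (\<lambda>x. x)"
    using Ck_on_const by (cases k) (auto simp: differentiable_on_ident)
qed

lemma smooth_on_compose_fst:
  assumes "open S" "open T" "smooth_on S F" shows "smooth_on (S \<times> T) (\<lambda>x. F (fst x))"
  using smooth_on_compose_affine[of fst "S \<times> T" S 0 F] assms
  by (auto simp: bounded_linear_fst open_Times)

lemma smooth_on_compose_snd:
  assumes "open S" "open T" "smooth_on T F" shows "smooth_on (S \<times> T) (\<lambda>x. F (snd x))"
  using smooth_on_compose_affine[of snd "S \<times> T" T 0 F] assms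
  by (auto simp: bounded_linear_snd open_Times)

lemma smooth_on_Pair:
  assumes "open S" "smooth_on S F" "smooth_on S G" shows "smooth_on S (\<lambda>x. (F x, G x))"
proof -
  have "bounded_linear (\<lambda>a::'b. (a, 0::'c))" "bounded_linear (\<lambda>b::'c. (0::'b, b))"
    by (intro bounded_linear_Pair bounded_linear_ident bounded_linear_zero)+
  from smooth_on_add[OF assms(1) smooth_on_linear[OF this(1) assms(1,2)] smooth_on_linear[OF this(2) assms(1,3)]]
  show ?thesis by simp
qed

section \<open>Symmetry of second derivatives\<close>

lemma mvt_along:
  fixes F :: "'a::real_normed_vector \<Rightarrow> real"
  assumes "t > 0" "\<And>s. 0 \<le> s \<Longrightarrow> s \<le> t \<Longrightarrow> (F has_derivative dd F (x + s *\<^sub>R u)) (at (x + s *\<^sub>R u))"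
  shows "\<exists>s. 0 < s \<and> s < t \<and> F (x + t *\<^sub>R u) - F x = t * dd F (x + s *\<^sub>R u) u"
proof -
  have d: "((\<lambda>s. F (x + s *\<^sub>R u)) has_derivative (\<lambda>h. dd F (x + s *\<^sub>R u) (h *\<^sub>R u))) (at s)"
    if "0 \<le> s" "s \<le> t" for s
    by (rule has_derivative_compose[of "\<lambda>s. x + s *\<^sub>R u", OF _ assms(2)[OF that]])
      (auto intro!: derivative_eq_intros)
  have "DERIV (\<lambda>s. F (x + s *\<^sub>R u)) s :> dd F (x + s *\<^sub>R u) u" if "0 \<le> s" "s \<le> t" for s
    unfolding has_field_derivative_def
    using d[OF that] linear_scale[OF has_derivative_linear[OF assms(2)[OF that]]]
    by (simp add: mult_commute_abs)
  from MVT2[OF assms(1) this] show ?thesis by auto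
qed

lemma second_derivative_symmetric_real:
  fixes F :: "'a::euclidean_space \<Rightarrow> real"
  assumes F: "smooth_on S F" and S: "open S" and x: "x \<in> S"
  shows "dd (\<lambda>y. dd F y u) x v = dd (\<lambda>y. dd F y v) x u"
proof -
  define Q where "Q u v y = dd (\<lambda>y. dd F y u) y v" for u v y
  have sm: "smooth_on S (\<lambda>y. dd F y w)" for w using smooth_on_dd[OF F] .
  \<comment> \<open>both mixed derivatives approximate the same second difference quotient\<close>
  have key: "\<exists>y. dist y x < d \<and> F (x + t *\<^sub>R u + t *\<^sub>R v) - F (x + t *\<^sub>R u) - F (x + t *\<^sub>R v) + F x = t * t * Q u v y"
    if t: "t > 0" and d: "t * (norm u + norm v) < d" and B: "ball x d \<subseteq> S" for t d u v
  proof -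
    have inB: "x + a *\<^sub>R u + b *\<^sub>R v \<in> ball x d" if "0 \<le> a" "a \<le> t" "0 \<le> b" "b \<le> t" for a b
    proof -
      have "norm (a *\<^sub>R u + b *\<^sub>R v) \<le> a * norm u + b * norm v"
        using norm_triangle_ineq[of "a *\<^sub>R u" "b *\<^sub>R v"] that by simp
      also have "\<dots> \<le> t * norm u + t * norm v" using that by (intro add_mono mult_right_mono) auto
      finally have "norm (a *\<^sub>R u + b *\<^sub>R v) < d" using d by (simp add: algebra_simps)
      moreover have "dist x (x + a *\<^sub>R u + b *\<^sub>R v) = norm (a *\<^sub>R u + b *\<^sub>R v)"
        by (metis add.assoc dist_add_cancel dist_commute dist_0_norm add_0_right dist_norm norm_minus_commute diff_0_right)
      ultimately show ?thesis by simp
    qed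
    \<comment> \<open>K is the increment of F over the side t v, and the second difference is the
      increment of K over t u. One mean value theorem for K along u and one for the derivative in
      direction u along v produce the intermediate point.\<close>
    define K where "K y = F (y + t *\<^sub>R v) - F y" for y
    have dK: "(K has_derivative (\<lambda>h. dd F (x + s *\<^sub>R u + t *\<^sub>R v) h - dd F (x + s *\<^sub>R u) h)) (at (x + s *\<^sub>R u))"
      if "0 \<le> s" "s \<le> t" for s
    proof -
      have 1: "x + s *\<^sub>R u + t *\<^sub>R v \<in> S" "x + s *\<^sub>R u \<in> S"
        using inB[of s t] inB[of s 0] that t B by auto
      have "((\<lambda>y. F (y + t *\<^sub>R v)) has_derivative dd F (x + s *\<^sub>R u + t *\<^sub>R v)) (at (x + s *\<^sub>R u))"
        by (rule has_derivative_compose[of "\<lambda>y. y + t *\<^sub>R v" "\<lambda>h. h", OF _ smooth_on_has_derivative[OF F S 1(1)]])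
          (auto intro!: derivative_eq_intros)
      then show ?thesis unfolding K_def
        using smooth_on_has_derivative[OF F S 1(2)] by (rule has_derivative_diff)
    qed
    have "(K has_derivative dd K (x + s *\<^sub>R u)) (at (x + s *\<^sub>R u))" if "0 \<le> s" "s \<le> t" for s
      using dK[OF that] dd_eqI[OF dK[OF that]] by simp
    from mvt_along[OF t this] obtain s where s: "0 < s" "s < t"
      and e1: "K (x + t *\<^sub>R u) - K x = t * dd K (x + s *\<^sub>R u) u" by blast
    have "((\<lambda>y. dd F y u) has_derivative dd (\<lambda>y. dd F y u) (x + s *\<^sub>R u + r *\<^sub>R v)) (at (x + s *\<^sub>R u + r *\<^sub>R v))"
      if "0 \<le> r" "r \<le> t" for r
      using smooth_on_has_derivative[OF sm S] inB[of s r] that s B by auto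
    from mvt_along[OF t this] obtain r where r: "0 < r" "r < t"
      and e2: "dd F (x + s *\<^sub>R u + t *\<^sub>R v) u - dd F (x + s *\<^sub>R u) u = t * Q u v (x + s *\<^sub>R u + r *\<^sub>R v)"
      unfolding Q_def by blast
    have "F (x + t *\<^sub>R u + t *\<^sub>R v) - F (x + t *\<^sub>R u) - F (x + t *\<^sub>R v) + F x = K (x + t *\<^sub>R u) - K x"
      by (simp add: K_def)
    also have "\<dots> = t * t * Q u v (x + s *\<^sub>R u + r *\<^sub>R v)"
      using e1 e2 dd_eqI[OF dK[of s]] s by simp
    finally show ?thesis using inB[of s r] s r by (intro exI[of _ "x + s *\<^sub>R u + r *\<^sub>R v"]) (auto simp: dist_commute)
  qed
  have cont: "continuous_on S (Q a b)" for a b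
    unfolding Q_def by (intro smooth_on_imp_continuous_on smooth_on_dd sm)
  have "\<bar>Q u v x - Q v u x\<bar> < 2 * e" if e: "e > 0" for e
  proof -
    obtain d0 where d0: "d0 > 0" "ball x d0 \<subseteq> S" using S x by (meson openE)
    obtain d1 where d1: "d1 > 0" "\<And>y. y \<in> S \<Longrightarrow> dist y x < d1 \<Longrightarrow> dist (Q u v y) (Q u v x) < e"
      using cont[of u v] x e unfolding continuous_on_iff by blast
    obtain d2 where d2: "d2 > 0" "\<And>y. y \<in> S \<Longrightarrow> dist y x < d2 \<Longrightarrow> dist (Q v u y) (Q v u x) < e"
      using cont[of v u] x e unfolding continuous_on_iff by blast
    define d where "d = min d0 (min d1 d2)"
    have d: "d > 0" "ball x d \<subseteq> S" "d \<le> d1" "d \<le> d2" using d0 d1 d2 by (auto simp: d_def)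
    \<comment> \<open>The parallelogram with sides t u and t v has to stay in the ball of radius d.
      The summand 1 keeps the denominator positive when u and v both vanish.\<close>
    define t where "t = d / (norm u + norm v + 1)"
    have np: "norm u + norm v + 1 > 0" by (simp add: add_nonneg_pos)
    have t: "t > 0" using d np by (simp add: t_def)
    have "t * (norm u + norm v) < t * (norm u + norm v + 1)" using t by simp
    also have "\<dots> = d" using np by (simp add: t_def)
    finally have td: "t * (norm u + norm v) < d" .
    obtain y where y: "dist y x < d" "F (x + t *\<^sub>R u + t *\<^sub>R v) - F (x + t *\<^sub>R u) - F (x + t *\<^sub>R v) + F x = t * t * Q u v y"
      using key[OF t td d(2)] by blast
    have td': "t * (norm v + norm u) < d" using td by (simp add: add.commute)
    obtain z where z: "dist z x < d" "F (x + t *\<^sub>R v + t *\<^sub>R u) - F (x + t *\<^sub>R v) - F (x + t *\<^sub>R u) + F x = t * t * Q v u z"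
      using key[OF t td' d(2)] by blast
    have "x + t *\<^sub>R v + t *\<^sub>R u = x + t *\<^sub>R u + t *\<^sub>R v" by simp
    then have "t * t * Q u v y = t * t * Q v u z" using y(2) z(2)  by (simp only:)
    then have eq: "Q u v y = Q v u z" using t by simp
    have "y \<in> S" "z \<in> S" using y(1) z(1) d(2) by (auto simp: dist_commute)
    then have "dist (Q u v y) (Q u v x) < e" "dist (Q v u z) (Q v u x) < e"
      using d1(2)[of y] d2(2)[of z] y(1) z(1) d(3,4) by auto
    then show ?thesis using eq unfolding dist_real_def by linarith
  qed
  \<comment> \<open>For e equal to half of a positive gap the bound would say that the gap is
    smaller than itself.\<close>
  from this[of "\<bar>Q u v x - Q v u x\<bar> / 2"] have "Q u v x = Q v u x" by fastforce
  then show ?thesis by (simp add: Q_def)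
qed

lemma dd_linear_compose:
  assumes "bounded_linear L" "(F has_derivative dd F x) (at x)"
  shows "dd (\<lambda>y. L (F y)) x = (\<lambda>v. L (dd F x v))"
  using bounded_linear.has_derivative[OF assms] by (rule dd_eqI)

lemma second_derivative_symmetric:
  fixes F :: "'a::euclidean_space \<Rightarrow> 'b::euclidean_space"
  assumes F: "smooth_on S F" and S: "open S" and x: "x \<in> S"
  shows "dd (\<lambda>y. dd F y u) x v = dd (\<lambda>y. dd F y v) x u"
proof (rule euclidean_eqI)
  fix b :: 'b
  have L: "bounded_linear (\<lambda>z::'b. z \<bullet> b)" by (rule bounded_linear_inner_left)
  have 1: "dd (\<lambda>y. F y \<bullet> b) y w = dd F y w \<bullet> b" if "y \<in> S" for y w
    using dd_linear_compose[OF L smooth_on_has_derivative[OF F S that]] by simp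
  have 2: "dd (\<lambda>y. dd (\<lambda>y. F y \<bullet> b) y w) x z = dd (\<lambda>y. dd F y w) x z \<bullet> b" for w z
    using dd_linear_compose[OF L smooth_on_has_derivative[OF smooth_on_dd[OF F] S x], of w]
      dd_cong[OF S x 1] by simp
  show "dd (\<lambda>y. dd F y u) x v \<bullet> b = dd (\<lambda>y. dd F y v) x u \<bullet> b"
    using second_derivative_symmetric_real[OF smooth_on_linear[OF L S F] S x, of u v] 2 by simp
qed

section \<open>Derivatives of families of linear and bilinear maps\<close>

lemma linear_family_expand:
  fixes A :: "'a::euclidean_space \<Rightarrow> 'b::real_vector"
  assumes "linear A" shows "A v = (\<Sum>b\<in>Basis. (v \<bullet> b) *\<^sub>R A b)"
proof -
  have "A v = A (\<Sum>b\<in>Basis. (v \<bullet> b) *\<^sub>R b)" by (simp add: euclidean_representation)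
  also have "\<dots> = (\<Sum>b\<in>Basis. (v \<bullet> b) *\<^sub>R A b)"
    by (simp add: linear_sum[OF assms] linear_scale[OF assms])
  finally show ?thesis .
qed

text \<open>Uniqueness of derivatives transfers additivity and homogeneity in v from the family to
  its derivative.\<close>

lemma linear_derivative_of_family:
  fixes A :: "'x::real_normed_vector \<Rightarrow> 'a::euclidean_space \<Rightarrow> 'b::real_normed_vector"
  assumes "open T" "x0 \<in> T" "\<And>x. x \<in> T \<Longrightarrow> linear (A x)"
    and A': "\<And>v. ((\<lambda>x. A x v) has_derivative A' v) (at x0)"
  shows "linear (\<lambda>v. A' v h)"
proof
  fix v w and r :: real
  have "((\<lambda>x. A x (v + w)) has_derivative (\<lambda>h. A' v h + A' w h)) (at x0)"
    by (rule has_derivative_transform_within_open[OF has_derivative_add[OF A' A'] assms(1,2)])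
      (simp add: linear_add assms(3))
  then show "A' (v + w) h = A' v h + A' w h" using has_derivative_unique[OF A'] by metis
  have "((\<lambda>x. A x (r *\<^sub>R v)) has_derivative (\<lambda>h. r *\<^sub>R A' v h)) (at x0)"
    by (rule has_derivative_transform_within_open[OF has_derivative_scaleR_right[OF A'] assms(1,2)])
      (simp add: linear_scale assms(3))
  then show "A' (r *\<^sub>R v) h = r *\<^sub>R A' v h" using has_derivative_unique[OF A'] by metis
qed

text \<open>A product rule for a family that is differentiable only at each fixed vector. Expanding
  the argument in \<open>Basis\<close> leaves a finite sum of products of differentiable
  functions.\<close>

lemma has_derivative_linear_family:
  fixes A :: "'x::real_normed_vector \<Rightarrow> 'a::euclidean_space \<Rightarrow> 'b::real_normed_vector"
  assumes T: "open T" "x0 \<in> T" "\<And>x. x \<in> T \<Longrightarrow> linear (A x)"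
    and A': "\<And>v. ((\<lambda>x. A x v) has_derivative A' v) (at x0)" and a: "(a has_derivative a') (at x0)"
  shows "((\<lambda>x. A x (a x)) has_derivative (\<lambda>h. A' (a x0) h + A x0 (a' h))) (at x0)"
proof -
  have "((\<lambda>x. \<Sum>b\<in>Basis. (a x \<bullet> b) *\<^sub>R A x b) has_derivative
      (\<lambda>h. \<Sum>b\<in>Basis. (a x0 \<bullet> b) *\<^sub>R A' b h + (a' h \<bullet> b) *\<^sub>R A x0 b)) (at x0)"
    by (intro has_derivative_sum has_derivative_scaleR A' has_derivative_inner_left a)
  then have "((\<lambda>x. A x (a x)) has_derivative
      (\<lambda>h. \<Sum>b\<in>Basis. (a x0 \<bullet> b) *\<^sub>R A' b h + (a' h \<bullet> b) *\<^sub>R A x0 b)) (at x0)"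
    by (rule has_derivative_transform_within_open[OF _ T(1,2)]) (metis T(3) linear_family_expand)
  moreover have "(\<Sum>b\<in>Basis. (a x0 \<bullet> b) *\<^sub>R A' b h + (a' h \<bullet> b) *\<^sub>R A x0 b) = A' (a x0) h + A x0 (a' h)" for h
    using linear_family_expand[OF linear_derivative_of_family[OF T A'], of "a x0" h]
      linear_family_expand[OF T(3)[OF T(2)], of "a' h"] by (simp add: sum.distrib)
  ultimately show ?thesis by simp
qed

lemma has_derivative_bilinear_family:
  fixes B :: "'y::euclidean_space \<Rightarrow> 'a::euclidean_space \<Rightarrow> 'c::euclidean_space \<Rightarrow> 'b::real_normed_vector"
  assumes T: "open T" "\<phi> x0 \<in> T" "\<And>y. y \<in> T \<Longrightarrow> bilinear (B y)"
    and B: "\<And>v w. smooth_on T (\<lambda>y. B y v w)"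
    and \<phi>: "(\<phi> has_derivative \<phi>') (at x0)"
    and a: "(a has_derivative a') (at x0)" and b: "(b has_derivative b') (at x0)"
  shows "((\<lambda>x. B (\<phi> x) (a x) (b x)) has_derivative (\<lambda>h. dd (\<lambda>y. B y (a x0) (b x0)) (\<phi> x0) (\<phi>' h)
     + B (\<phi> x0) (a x0) (b' h) + B (\<phi> x0) (a' h) (b x0))) (at x0)"
proof -
  \<comment> \<open>\<phi> is assumed differentiable at x0 alone; its continuity there supplies a
    neighbourhood S on which the forms B (\<phi> x) are bilinear.\<close>
  have "(\<phi> \<longlongrightarrow> \<phi> x0) (at x0)" using has_derivative_continuous[OF \<phi>] continuous_within by blast
  then have "\<forall>\<^sub>F x in at x0. \<phi> x \<in> T" using T(1,2) topological_tendstoD by blast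
  then obtain S where S: "open S" "x0 \<in> S" and S': "\<forall>x\<in>S. x \<noteq> x0 \<longrightarrow> \<phi> x \<in> T"
    by (auto simp: eventually_at_topological)
  have S3: "\<phi> x \<in> T" if "x \<in> S" for x
    using S' T(2) that by (cases "x = x0") auto
  have 1: "((\<lambda>x. B (\<phi> x) v w) has_derivative (\<lambda>h. dd (\<lambda>y. B y v w) (\<phi> x0) (\<phi>' h))) (at x0)" for v w
    by (rule has_derivative_compose[OF \<phi> smooth_on_has_derivative[OF B T(1,2)]])
  have 2: "((\<lambda>x. B (\<phi> x) v (b x)) has_derivative (\<lambda>h. dd (\<lambda>y. B y v (b x0)) (\<phi> x0) (\<phi>' h) + B (\<phi> x0) v (b' h))) (at x0)" for v
    by (rule has_derivative_linear_family[where A="\<lambda>x w. B (\<phi> x) v w" and A'="\<lambda>w h. dd (\<lambda>y. B y v w) (\<phi> x0) (\<phi>' h)", OF S(1,2) _ 1 b])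
      (use T(3)[OF S3] in \<open>simp add: bilinear_def\<close>)
  show ?thesis
    by (rule has_derivative_linear_family[where A="\<lambda>x v. B (\<phi> x) v (b x)" and A'="\<lambda>v h. dd (\<lambda>y. B y v (b x0)) (\<phi> x0) (\<phi>' h) + B (\<phi> x0) v (b' h)", OF S(1,2) _ 2 a])
      (use T(3)[OF S3] in \<open>simp add: bilinear_def\<close>)
qed

lemma bilinear_dd_family:
  fixes B :: "'y::euclidean_space \<Rightarrow> 'a::euclidean_space \<Rightarrow> 'c::euclidean_space \<Rightarrow> 'b::real_normed_vector"
  assumes T: "open T" "x \<in> T" "\<And>y. y \<in> T \<Longrightarrow> bilinear (B y)" and B: "\<And>v w. smooth_on T (\<lambda>y. B y v w)"
  shows "bilinear (\<lambda>v w. dd (\<lambda>y. B y v w) x h)"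
  unfolding bilinear_def
proof (intro conjI allI)
  show "linear (\<lambda>w. dd (\<lambda>y. B y v w) x h)" for v
    by (rule linear_derivative_of_family[OF T(1,2) _ smooth_on_has_derivative[OF B T(1,2)]])
      (use T(3) in \<open>simp add: bilinear_def\<close>)
  show "linear (\<lambda>v. dd (\<lambda>y. B y v w) x h)" for w
    by (rule linear_derivative_of_family[OF T(1,2) _ smooth_on_has_derivative[OF B T(1,2)]])
      (use T(3) in \<open>simp add: bilinear_def\<close>)
qed

section \<open>Metrics on open sets\<close>

lemma deriv_along_const: "deriv_along (\<lambda>_. v) F = (\<lambda>x. dd F x v)"
  by (simp add: deriv_along_def fun_eq_iff)

lemma lie_bracket_const: "lie_bracket (\<lambda>_. v) (\<lambda>_. w) = (\<lambda>_. 0)"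
  by (simp add: lie_bracket_def deriv_along_def fun_eq_iff)

text \<open>A product rule that asks only continuity of g: because f vanishes at x, the error f y (g
  y - g x) is a bounded multiple of norm (y - x) times a null function. It is what differentiates
  \<open>raise\<close> before anything beyond its continuity is known.\<close>

lemma has_derivative_mult_vanishing:
  fixes f :: "'a::real_normed_vector \<Rightarrow> real" and g :: "'a \<Rightarrow> 'b::real_normed_vector"
  assumes f: "(f has_derivative f') (at x)" and "f x = 0" and g: "isCont g x"
  shows "((\<lambda>y. f y *\<^sub>R g y) has_derivative (\<lambda>h. f' h *\<^sub>R g x)) (at x)"
proof -
  obtain K where K: "\<And>h. norm (f' h) \<le> norm h * K"
    using has_derivative_bounded_linear[OF f] bounded_linear.bounded by blast
  define e where "e y = (f y - f x - f' (y - x)) / norm (y - x)" for y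
  have e: "(\<lambda>y. e y) \<midarrow>x\<rightarrow> 0"
    using f unfolding has_derivative_at_within e_def
    by (simp add: divide_inverse mult.commute algebra_simps)
  have gx: "(\<lambda>y. g y - g x) \<midarrow>x\<rightarrow> 0" using g by (simp add: isCont_def LIM_zero)
  have fe: "f y = f' (y - x) + norm (y - x) * e y" for y
    using linear_0[OF has_derivative_linear[OF f]] assms(2) by (cases "y = x") (auto simp: e_def)
  have "(\<lambda>y. e y *\<^sub>R g y + (f' (y - x) / norm (y - x)) *\<^sub>R (g y - g x)) \<midarrow>x\<rightarrow> 0 *\<^sub>R g x + 0"
  proof (intro tendsto_add tendsto_scaleR e)
    show "(g \<longlongrightarrow> g x) (at x)" using g by (simp add: isCont_def)
    show "((\<lambda>y. (f' (y - x) / norm (y - x)) *\<^sub>R (g y - g x)) \<longlongrightarrow> 0) (at x)"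
    proof (rule tendsto_0_le[OF gx, of _ "\<bar>K\<bar>"], rule eventuallyI)
      fix y
      \<comment> \<open>At y = x the quotient is 0 by the convention for division by zero, so the
        bound holds there as well.\<close>
      have "\<bar>f' (y - x) / norm (y - x)\<bar> \<le> \<bar>K\<bar>"
      proof (cases "y = x")
        case False
        have "\<bar>f' (y - x)\<bar> \<le> norm (y - x) * \<bar>K\<bar>"
          using K[of "y - x"] mult_left_mono[OF abs_ge_self[of K] norm_ge_zero[of "y - x"]] by simp
        then show ?thesis using False by (simp add: abs_divide divide_le_eq mult.commute)
      qed simp
      then show "norm ((f' (y - x) / norm (y - x)) *\<^sub>R (g y - g x)) \<le> norm (g y - g x) * \<bar>K\<bar>"
        by (simp only: norm_scaleR real_norm_def) (metis mult.commute mult_right_mono norm_ge_zero)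
    qed
  qed
  moreover have "\<forall>\<^sub>F y in at x. e y *\<^sub>R g y + (f' (y - x) / norm (y - x)) *\<^sub>R (g y - g x)
       = (1 / norm (y - x)) *\<^sub>R (f y *\<^sub>R g y - f x *\<^sub>R g x - f' (y - x) *\<^sub>R g x)"
    unfolding eventually_at_filter
  proof (intro always_eventually allI impI)
    fix y assume "y \<noteq> x"
    then show "e y *\<^sub>R g y + (f' (y - x) / norm (y - x)) *\<^sub>R (g y - g x)
       = (1 / norm (y - x)) *\<^sub>R (f y *\<^sub>R g y - f x *\<^sub>R g x - f' (y - x) *\<^sub>R g x)"
      using assms(2) by (simp add: fe[of y] scaleR_right_diff_distrib scaleR_right_distrib scaleR_left_distrib)
  qed
  ultimately have "(\<lambda>y. (1 / norm (y - x)) *\<^sub>R (f y *\<^sub>R g y - f x *\<^sub>R g x - f' (y - x) *\<^sub>R g x)) \<midarrow>x\<rightarrow> 0"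
    using Lim_transform_eventually by fastforce
  moreover have "bounded_linear (\<lambda>h. f' h *\<^sub>R g x)"
    using has_derivative_bounded_linear[OF f] by (rule bounded_linear_compose[OF bounded_linear_scaleR_left])
  ultimately show ?thesis
    by (simp add: has_derivative_at_within inverse_eq_divide)
qed

text \<open>The coordinate expression of a metric over an open set, of any signature. Nondegeneracy
  takes the place of positivity throughout.\<close>

locale local_metric =
  fixes S :: "'a::euclidean_space set" and G :: "'a \<Rightarrow> 'a \<Rightarrow> 'a \<Rightarrow> real"
  assumes open_S: "open S"
    and bil: "x \<in> S \<Longrightarrow> bilinear (G x)"
    and sym: "x \<in> S \<Longrightarrow> G x v w = G x w v"
    and nondeg: "x \<in> S \<Longrightarrow> (\<And>w. G x v w = 0) \<Longrightarrow> v = 0"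
    and smooth: "smooth_on S (\<lambda>x. G x v w)"
begin

lemmas G_simps = bilinear_ladd[OF bil] bilinear_radd[OF bil] bilinear_lmul[OF bil] bilinear_rmul[OF bil]
  bilinear_lsub[OF bil] bilinear_rsub[OF bil] bilinear_lzero[OF bil] bilinear_rzero[OF bil]
  bilinear_lneg[OF bil] bilinear_rneg[OF bil]

lemma linear_left: "x \<in> S \<Longrightarrow> linear (\<lambda>v. G x v w)" and linear_right: "x \<in> S \<Longrightarrow> linear (G x v)"
  using bil by (auto simp: bilinear_def)

lemma G_eqI: "x \<in> S \<Longrightarrow> (\<And>u. G x v u = G x w u) \<Longrightarrow> v = w"
  using nondeg[of x "v - w"] by (simp add: G_simps)

lemma raise_eqI: "x \<in> S \<Longrightarrow> (\<And>u. G x z u = \<alpha> u) \<Longrightarrow> raise (G x) \<alpha> = z"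
  unfolding raise_def by (rule the_equality) (auto intro: G_eqI)

text \<open>Pairing with the basis is an injective linear map by nondegeneracy, hence surjective in
  finite dimension, so the vector described by \<open>raise\<close> exists.\<close>

lemma raise_works:
  assumes x: "x \<in> S" and \<alpha>: "linear \<alpha>"
  shows "G x (raise (G x) \<alpha>) u = \<alpha> u"
proof -
  define L where "L z = (\<Sum>b\<in>Basis. G x z b *\<^sub>R b)" for z
  have "linear L"
    unfolding L_def using linear_left[OF x]
    by (intro linear_compose_sum ballI linear_compose[of "\<lambda>z. G x z _" "\<lambda>r. r *\<^sub>R _", unfolded o_def] linear_scaleR_left) auto
  have Lb: "L z \<bullet> b = G x z b" if "b \<in> Basis" for z b
    using that by (simp add: L_def)
  have ext: "G x z u = \<beta> u" if "linear \<beta>" "\<And>b. b \<in> Basis \<Longrightarrow> G x z b = \<beta> b" for z u \<beta>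
    using linear_eq_stdbasis[OF linear_right[OF x] that(1)] that(2) by metis
  have "inj L"
    unfolding linear_injective_0[OF \<open>linear L\<close>]
  proof (intro allI impI)
    fix z assume "L z = 0"
    then have "G x z b = 0" if "b \<in> Basis" for b using Lb[OF that, of z] by simp
    then show "z = 0" using nondeg[OF x] ext[of "\<lambda>_. 0" z] by (simp add: linear_zero module_hom_zero)
  qed
  then have "surj L" using linear_injective_imp_surjective \<open>linear L\<close> by blast
  then obtain z where z: "L z = (\<Sum>b\<in>Basis. \<alpha> b *\<^sub>R b)" by (metis surjD)
  have "G x z b = \<alpha> b" if "b \<in> Basis" for b using Lb[OF that, of z] that by (simp add: z)
  then have "G x z u = \<alpha> u" for u using ext[OF \<alpha>] by blast
  then show ?thesis using raise_eqI[OF x] by metis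
qed

text \<open>Nondegeneracy made uniform near x0, in place of the coercivity that an indefinite form
  lacks. The dual basis gives the estimate at x0, and a small change of the matrix entries of G
  preserves it with a doubled constant.\<close>

lemma raise_lower_bound:
  assumes x0: "x0 \<in> S"
  obtains T c where "open T" "x0 \<in> T" "T \<subseteq> S" "c > 0"
    "\<And>x z. x \<in> T \<Longrightarrow> norm z \<le> c * (\<Sum>b\<in>Basis. \<bar>G x z b\<bar>)"
proof -
  define L where "L x z = (\<Sum>b\<in>Basis. \<bar>G x z b\<bar>)" for x z
  define R where "R b = raise (G x0) (\<lambda>u. u \<bullet> b)" for b
  \<comment> \<open>\<open>z\<close> is recovered from its pairings with the dual basis\<close>
  define K where "K = (\<Sum>b\<in>Basis. norm (R b)) + 1"
  have K: "K > 0" by (simp add: K_def sum_nonneg add_nonneg_pos)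
  have lower0: "norm z \<le> K * L x0 z" for z
  proof -
    have zz: "z \<bullet> b = (\<Sum>c\<in>Basis. (R b \<bullet> c) * G x0 z c)" if "b \<in> Basis" for b
    proof -
      have "z \<bullet> b = G x0 z (R b)"
        using raise_works[OF x0, of "\<lambda>u. u \<bullet> b" z] sym[OF x0]
        by (simp add: R_def bounded_linear.linear bounded_linear_inner_left)
      also have "\<dots> = (\<Sum>c\<in>Basis. (R b \<bullet> c) * G x0 z c)"
        using linear_family_expand[OF linear_right[OF x0], of z "R b"] by simp
      finally show ?thesis .
    qed
    have "\<bar>z \<bullet> b\<bar> \<le> norm (R b) * L x0 z" if "b \<in> Basis" for b
    proof -
      have "\<bar>z \<bullet> b\<bar> \<le> (\<Sum>c\<in>Basis. \<bar>(R b \<bullet> c) * G x0 z c\<bar>)" unfolding zz[OF that] by (rule sum_abs)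
      also have "\<dots> \<le> (\<Sum>c\<in>Basis. norm (R b) * \<bar>G x0 z c\<bar>)"
        by (intro sum_mono) (auto simp: abs_mult intro!: mult_right_mono Basis_le_norm)
      finally show ?thesis by (simp add: L_def sum_distrib_left)
    qed
    then have "(\<Sum>b\<in>Basis. \<bar>z \<bullet> b\<bar>) \<le> (\<Sum>b\<in>Basis. norm (R b)) * L x0 z"
      by (simp add: sum_distrib_right sum_mono)
    also have "\<dots> \<le> K * L x0 z" by (intro mult_right_mono) (auto simp: K_def L_def sum_nonneg)
    finally show ?thesis using norm_le_l1[of z] by linarith
  qed
  \<comment> \<open>Changing all matrix entries by less than e changes the sum of the pairings by at
    most DIM('a) squared times e times norm z. This choice makes K times that error equal to norm z
    / 2, which is absorbed on the left.\<close>
  define e where "e = 1 / (2 * K * (real DIM('a) * real DIM('a)))"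
  have N: "real DIM('a) > 0" by simp
  have e: "e > 0" using K N by (simp add: e_def)
  have "\<forall>\<^sub>F x in nhds x0. \<forall>i\<in>Basis. \<forall>j\<in>Basis. \<bar>G x i j - G x0 i j\<bar> < e"
  proof (intro eventually_ball_finite ballI finite_Basis)
    fix i j :: 'a
    have "isCont (\<lambda>x. G x i j) x0"
      using smooth_on_imp_continuous_on[OF smooth] x0 open_S by (auto simp: continuous_on_eq_continuous_at)
    then have "((\<lambda>x. G x i j) \<longlongrightarrow> G x0 i j) (nhds x0)" by (simp add: tendsto_nhds_iff isCont_def)
    from tendstoD[OF this e] show "\<forall>\<^sub>F x in nhds x0. \<bar>G x i j - G x0 i j\<bar> < e"
      by (simp add: dist_real_def)
  qed
  then obtain T where T: "open T" "x0 \<in> T"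
    and Te: "\<And>x i j. x \<in> T \<Longrightarrow> i \<in> Basis \<Longrightarrow> j \<in> Basis \<Longrightarrow> \<bar>G x i j - G x0 i j\<bar> < e"
    unfolding eventually_nhds by blast
  show ?thesis
  proof (rule that[of "T \<inter> S" "2 * K"])
    show "open (T \<inter> S)" "x0 \<in> T \<inter> S" "T \<inter> S \<subseteq> S" "2 * K > 0" using T open_S x0 K by auto
    fix x z assume x: "x \<in> T \<inter> S"
    have "\<bar>G x0 z b - G x z b\<bar> \<le> real DIM('a) * (norm z * e)" if b: "b \<in> Basis" for b
    proof -
      have "G x0 z b - G x z b = (\<Sum>i\<in>Basis. (z \<bullet> i) * (G x0 i b - G x i b))"
        using linear_family_expand[OF linear_left[OF x0], of z b] linear_family_expand[OF linear_left, of x z b] x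
        by (simp add: sum_subtractf right_diff_distrib)
      also have "\<bar>\<dots>\<bar> \<le> (\<Sum>i\<in>Basis. \<bar>(z \<bullet> i) * (G x0 i b - G x i b)\<bar>)" by (rule sum_abs)
      also have "\<dots> \<le> (\<Sum>i\<in>(Basis::'a set). norm z * e)"
      proof (rule sum_mono)
        fix i :: 'a assume i: "i \<in> Basis"
        have "\<bar>G x0 i b - G x i b\<bar> \<le> e" using Te[of x i b] x i b by (simp add: abs_minus_commute)
        then show "\<bar>(z \<bullet> i) * (G x0 i b - G x i b)\<bar> \<le> norm z * e"
          unfolding abs_mult using Basis_le_norm[OF i, of z] by (intro mult_mono) auto
      qed
      finally show ?thesis by simp
    qed
    then have 1: "\<bar>G x0 z b\<bar> \<le> \<bar>G x z b\<bar> + real DIM('a) * (norm z * e)" if "b \<in> Basis" for b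
      using that by fastforce
    have "L x0 z \<le> (\<Sum>b\<in>Basis. \<bar>G x z b\<bar> + real DIM('a) * (norm z * e))"
      unfolding L_def by (rule sum_mono[OF 1])
    also have "\<dots> = L x z + real DIM('a) * real DIM('a) * e * norm z"
      by (simp add: sum.distrib L_def algebra_simps)
    finally have "K * L x0 z \<le> K * (L x z + real DIM('a) * real DIM('a) * e * norm z)"
      using K by simp
    also have "\<dots> = K * L x z + norm z / 2" using K N by (simp add: e_def field_simps)
    finally show "norm z \<le> 2 * K * (\<Sum>b\<in>Basis. \<bar>G x z b\<bar>)"
      using lower0[of z] unfolding L_def by linarith
  qed
qed

text \<open>The lower bound is applied to z x - z x0, whose pairings under G x are \<alpha> x b - G
  x (z x0) b. These involve z at the fixed point only and tend to 0.\<close>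

lemma raise_isCont:
  assumes \<alpha>: "\<And>x. x \<in> S \<Longrightarrow> linear (\<alpha> x)" and cont\<alpha>: "\<And>u. isCont (\<lambda>x. \<alpha> x u) x0" and x0: "x0 \<in> S"
  shows "isCont (\<lambda>x. raise (G x) (\<alpha> x)) x0"
proof -
  define z where "z x = raise (G x) (\<alpha> x)" for x
  have zG: "G x (z x) u = \<alpha> x u" if "x \<in> S" for x u
    unfolding z_def using raise_works[OF that \<alpha>[OF that]] .
  obtain T c where T: "open T" "x0 \<in> T" "T \<subseteq> S" "c > 0"
    and lower: "\<And>x z. x \<in> T \<Longrightarrow> norm z \<le> c * (\<Sum>b\<in>Basis. \<bar>G x z b\<bar>)"
    using raise_lower_bound[OF x0] by blast
  have contG: "isCont (\<lambda>x. G x v w) x0" for v w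
    using smooth_on_imp_continuous_on[OF smooth] x0 open_S by (auto simp: continuous_on_eq_continuous_at)
  have "(\<lambda>x. \<Sum>b\<in>Basis. \<bar>\<alpha> x b - G x (z x0) b\<bar>) \<midarrow>x0\<rightarrow> (\<Sum>b\<in>Basis. \<bar>\<alpha> x0 b - G x0 (z x0) b\<bar>)"
    using contG cont\<alpha> unfolding isCont_def by (intro tendsto_intros)
  then have lim: "(\<lambda>x. \<Sum>b\<in>Basis. \<bar>\<alpha> x b - G x (z x0) b\<bar>) \<midarrow>x0\<rightarrow> 0"
    using zG[OF x0] by simp
  have "(\<lambda>x. z x - z x0) \<midarrow>x0\<rightarrow> 0"
  proof (rule tendsto_0_le[OF lim, of _ c])
    have "norm (z x - z x0) \<le> norm (\<Sum>b\<in>Basis. \<bar>\<alpha> x b - G x (z x0) b\<bar>) * c" if "x \<in> T" for x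
      using lower[OF that, of "z x - z x0"] that T(3)
      by (auto simp: G_simps zG subset_iff mult.commute sum_nonneg)
    then show "\<forall>\<^sub>F x in at x0. norm (z x - z x0) \<le> norm (\<Sum>b\<in>Basis. \<bar>\<alpha> x b - G x (z x0) b\<bar>) * c"
      using T(1,2) unfolding eventually_at_topological by blast
  qed
  then show ?thesis by (simp add: isCont_def LIM_zero_iff z_def)
qed

text \<open>Implicit differentiation of G x (z x) u = \<alpha> x u. Freezing the form at x0 isolates
  z x, and the correction term is differentiated with the continuity of z alone, so there is no
  circularity.\<close>

lemma raise_has_derivative:
  assumes \<alpha>: "\<And>x. x \<in> S \<Longrightarrow> linear (\<alpha> x)" and d: "\<And>u. ((\<lambda>x. \<alpha> x u) has_derivative \<alpha>' u) (at x0)"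
    and x0: "x0 \<in> S"
  defines "z \<equiv> \<lambda>x. raise (G x) (\<alpha> x)"
  shows "(z has_derivative (\<lambda>h. raise (G x0) (\<lambda>u. \<alpha>' u h - dd (\<lambda>x. G x (z x0) u) x0 h))) (at x0)"
proof -
  have zG: "G x (z x) u = \<alpha> x u" if "x \<in> S" for x u
    unfolding z_def using raise_works[OF that \<alpha>[OF that]] .
  have dG: "((\<lambda>x. G x v w) has_derivative dd (\<lambda>x. G x v w) x0) (at x0)" for v w
    using smooth_on_has_derivative[OF smooth open_S x0] .
  have contz: "isCont z x0"
    unfolding z_def using has_derivative_continuous[OF d] by (intro raise_isCont \<alpha> x0) auto
  define R where "R b = raise (G x0) (\<lambda>u. u \<bullet> b)" for b
  have RG: "v \<bullet> b = G x0 v (R b)" for v b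
    using raise_works[OF x0, of "\<lambda>u. u \<bullet> b" v] sym[OF x0]
    by (simp add: R_def bounded_linear.linear bounded_linear_inner_left)
  have lin\<alpha>': "linear (\<lambda>u. \<alpha>' u h)" for h
    using linear_derivative_of_family[OF open_S x0 \<alpha> d] .
  have lindG: "linear (\<lambda>u. dd (\<lambda>x. G x v u) x0 h)" for v h
    using bilinear_dd_family[OF open_S x0 bil smooth] by (auto simp: bilinear_def)
  have lin: "linear (\<lambda>u. \<alpha>' u h - dd (\<lambda>x. G x (z x0) u) x0 h)" for h
    by (intro linear_compose_sub lin\<alpha>' lindG)
  \<comment> \<open>near \<open>x0\<close>, \<open>G x0 (z x) u = \<alpha> x u - (G x - G x0) (z x) u\<close>, and the last factor vanishes at \<open>x0\<close>\<close>
  have dz: "((\<lambda>x. G x0 (z x) u) has_derivative (\<lambda>h. \<alpha>' u h - dd (\<lambda>x. G x (z x0) u) x0 h)) (at x0)" for u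
  proof -
    have "((\<lambda>x. \<Sum>i\<in>Basis. (G x i u - G x0 i u) *\<^sub>R (z x \<bullet> i)) has_derivative
        (\<lambda>h. \<Sum>i\<in>Basis. dd (\<lambda>x. G x i u) x0 h *\<^sub>R (z x0 \<bullet> i))) (at x0)"
    proof (intro has_derivative_sum has_derivative_mult_vanishing)
      show "((\<lambda>x. G x i u - G x0 i u) has_derivative dd (\<lambda>x. G x i u) x0) (at x0)" for i
        using has_derivative_diff[OF dG has_derivative_const] by simp
      show "isCont (\<lambda>x. z x \<bullet> i) x0" for i using contz by (intro continuous_intros)
    qed simp
    moreover have "(\<Sum>i\<in>Basis. dd (\<lambda>x. G x i u) x0 h *\<^sub>R (z x0 \<bullet> i)) = dd (\<lambda>x. G x (z x0) u) x0 h" for h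
      using linear_family_expand[of "\<lambda>v. dd (\<lambda>x. G x v u) x0 h" "z x0"]
        bilinear_dd_family[OF open_S x0 bil smooth, of h] by (simp add: bilinear_def mult.commute)
    ultimately have "((\<lambda>x. \<alpha> x u - (\<Sum>i\<in>Basis. (G x i u - G x0 i u) *\<^sub>R (z x \<bullet> i))) has_derivative
        (\<lambda>h. \<alpha>' u h - dd (\<lambda>x. G x (z x0) u) x0 h)) (at x0)"
      using has_derivative_diff[OF d] by simp
    then show ?thesis
    proof (rule has_derivative_transform_within_open[OF _ open_S x0])
      fix x assume x: "x \<in> S"
      show "\<alpha> x u - (\<Sum>i\<in>Basis. (G x i u - G x0 i u) *\<^sub>R (z x \<bullet> i)) = G x0 (z x) u"
        using linear_family_expand[OF linear_left[OF x], of "z x" u]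
          linear_family_expand[OF linear_left[OF x0], of "z x" u] zG[OF x, of u]
        by (simp add: left_diff_distrib right_diff_distrib sum_subtractf mult.commute)
    qed
  qed
  show ?thesis
    \<comment> \<open>By symmetry of the form, the component of z x along b is its pairing with the
      dual vector R b, and such pairings are differentiated by \<open>dz\<close>.\<close>
    unfolding has_derivative_componentwise_within[of z]
  proof
    fix b :: 'a assume "b \<in> Basis"
    show "((\<lambda>x. z x \<bullet> b) has_derivative (\<lambda>h. raise (G x0) (\<lambda>u. \<alpha>' u h - dd (\<lambda>x. G x (z x0) u) x0 h) \<bullet> b)) (at x0)"
      unfolding RG raise_works[OF x0 lin] by (rule dz)
  qed
qed

text \<open>A bootstrap: the derivative of the dual vector z is the dual vector of a form \<beta>
  built from derivatives of \<alpha> and G and from z itself. The induction hypothesis is used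
  twice, for z and then for \<beta>, and therefore has to range over all \<alpha>.\<close>

lemma Ck_on_raise:
  assumes "\<And>x. x \<in> S \<Longrightarrow> linear (\<alpha> x)" "\<And>u. Ck_on k S (\<lambda>x. \<alpha> x u)"
  shows "Ck_on k S (\<lambda>x. raise (G x) (\<alpha> x))"
  using assms
proof (induction k arbitrary: \<alpha>)
  case 0
  then show ?case
    using raise_isCont[OF 0(1)] by (simp add: continuous_on_eq_continuous_at open_S)
next
  case (Suc k)
  define z where "z x = raise (G x) (\<alpha> x)" for x
  define \<beta> where "\<beta> h x u = dd (\<lambda>x. \<alpha> x u) x h - dd (\<lambda>y. G y (z x) u) x h" for h x u
  have z: "Ck_on k S z"
    unfolding z_def using Suc.prems(1) Ck_on_Suc_imp[OF Suc.prems(2)] by (rule Suc.IH)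
  have d\<alpha>: "((\<lambda>x. \<alpha> x u) has_derivative dd (\<lambda>x. \<alpha> x u) x) (at x)" if "x \<in> S" for x u
    using Ck_on_has_derivative[OF Suc.prems(2) open_S that] .
  have bilG: "bilinear (\<lambda>v u. dd (\<lambda>y. G y v u) x h)" if "x \<in> S" for x h
    using bilinear_dd_family[OF open_S that bil smooth] .
  show ?case
  proof (rule Ck_on_SucI[OF open_S])
    show "((\<lambda>x. raise (G x) (\<alpha> x)) has_derivative (\<lambda>h. raise (G x) (\<beta> h x))) (at x)" if "x \<in> S" for x
      unfolding \<beta>_def z_def using raise_has_derivative[OF Suc.prems(1) d\<alpha>[OF that] that] .
    fix h
    show "Ck_on k S (\<lambda>x. raise (G x) (\<beta> h x))"
    proof (rule Suc.IH)
      show "linear (\<beta> h x)" if "x \<in> S" for x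
        unfolding \<beta>_def using bilG[OF that]
        by (intro linear_compose_sub linear_derivative_of_family[OF open_S that Suc.prems(1) d\<alpha>[OF that]])
          (auto simp: bilinear_def)
      fix u
      \<comment> \<open>Since \<beta> has z x inside a derivative of G, it is expanded in
        \<open>Basis\<close>, leaving products of functions known to be of class k.\<close>
      have "Ck_on k S (\<lambda>x. dd (\<lambda>x. \<alpha> x u) x h + - 1 *\<^sub>R (\<Sum>i\<in>Basis. (z x \<bullet> i) *\<^sub>R dd (\<lambda>y. G y i u) x h))"
      proof (intro Ck_on_add Ck_on_bilinear[OF bounded_bilinear_scaleR] open_S Ck_on_const Ck_on_sum finite_Basis)
        show "Ck_on k S (\<lambda>x. dd (\<lambda>x. \<alpha> x u) x h)" using Suc.prems(2)[of u] by simp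
        show "Ck_on k S (\<lambda>x. z x \<bullet> i)" for i
          using Ck_on_linear[OF bounded_linear_inner_left open_S z] .
        show "Ck_on k S (\<lambda>x. dd (\<lambda>y. G y i u) x h)" for i
          using smooth_on_dd[OF smooth] by (simp add: smooth_on_def)
      qed
      then show "Ck_on k S (\<lambda>x. \<beta> h x u)"
      proof (rule Ck_on_cong[OF open_S, rotated])
        fix x assume x: "x \<in> S"
        have "dd (\<lambda>y. G y (z x) u) x h = (\<Sum>i\<in>Basis. (z x \<bullet> i) *\<^sub>R dd (\<lambda>y. G y i u) x h)"
          by (rule linear_family_expand) (use bilG[OF x] in \<open>simp add: bilinear_def\<close>)
        then show "dd (\<lambda>x. \<alpha> x u) x h + - 1 *\<^sub>R (\<Sum>i\<in>Basis. (z x \<bullet> i) *\<^sub>R dd (\<lambda>y. G y i u) x h) = \<beta> h x u"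
          by (simp add: \<beta>_def)
      qed
    qed
  qed
qed

lemma smooth_on_raise:
  "(\<And>x. x \<in> S \<Longrightarrow> linear (\<alpha> x)) \<Longrightarrow> (\<And>u. smooth_on S (\<lambda>x. \<alpha> x u)) \<Longrightarrow> smooth_on S (\<lambda>x. raise (G x) (\<alpha> x))"
  unfolding smooth_on_def using Ck_on_raise by blast

section \<open>Christoffel symbols and curvature of a local metric\<close>

abbreviation (input) \<Gamma> where "\<Gamma> \<equiv> christoffel G"

definition koszul :: "'a \<Rightarrow> 'a \<Rightarrow> 'a \<Rightarrow> 'a \<Rightarrow> real" where
  "koszul x v w u = (dd (\<lambda>y. G y w u) x v + dd (\<lambda>y. G y v u) x w - dd (\<lambda>y. G y v w) x u) / 2"

lemma bilinear_dG: "x \<in> S \<Longrightarrow> bilinear (\<lambda>v w. dd (\<lambda>y. G y v w) x h)"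
  using bilinear_dd_family[OF open_S _ bil smooth] .

lemma dG_sym: "x \<in> S \<Longrightarrow> dd (\<lambda>y. G y v w) x = dd (\<lambda>y. G y w v) x"
  by (rule dd_cong[OF open_S _ sym])

lemma linear_dG: "x \<in> S \<Longrightarrow> linear (dd (\<lambda>y. G y v w) x)"
  using smooth_on_linear_dd[OF smooth open_S] .

lemma christoffel_raise: "\<Gamma> x v w = raise (G x) (koszul x v w)"
  by (simp add: christoffel_def deriv_along_const koszul_def[abs_def])

lemma linear_koszul:
  assumes "x \<in> S"
  shows "linear (koszul x v w)" "linear (\<lambda>w. koszul x v w u)" "linear (\<lambda>v. koszul x v w u)"
  using bilinear_dG[OF assms] linear_dG[OF assms]
  by (auto simp: koszul_def bilinear_def linear_iff algebra_simps add_divide_distrib diff_divide_distrib)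

lemma koszul_formula: "x \<in> S \<Longrightarrow> G x (\<Gamma> x v w) u = koszul x v w u"
  using raise_works linear_koszul(1) by (simp add: christoffel_raise)

lemma christoffel_eqI: "x \<in> S \<Longrightarrow> (\<And>u. G x z u = koszul x v w u) \<Longrightarrow> \<Gamma> x v w = z"
  unfolding christoffel_raise by (rule raise_eqI)

lemma christoffel_sym: "x \<in> S \<Longrightarrow> \<Gamma> x v w = \<Gamma> x w v"
  by (rule G_eqI) (auto simp: koszul_formula koszul_def dG_sym[of x v w])

lemma bilinear_christoffel: "x \<in> S \<Longrightarrow> bilinear (\<Gamma> x)"
  unfolding bilinear_def linear_iff
  by (intro conjI allI; rule G_eqI)
    (auto simp: koszul_formula G_simps linear_add[OF linear_koszul(2)] linear_add[OF linear_koszul(3)]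
      linear_scale[OF linear_koszul(2)] linear_scale[OF linear_koszul(3)])

lemma smooth_on_christoffel: "smooth_on S (\<lambda>x. \<Gamma> x v w)"
  unfolding christoffel_raise
proof (rule smooth_on_raise[OF linear_koszul(1)])
  have "smooth_on S (\<lambda>x. (dd (\<lambda>y. G y w u) x v + dd (\<lambda>y. G y v u) x w - dd (\<lambda>y. G y v w) x u) * (1/2))" for u
    by (intro smooth_on_mult smooth_on_add smooth_on_diff smooth_on_dd smooth smooth_on_const open_S)
  then show "smooth_on S (\<lambda>x. koszul x v w u)" for u by (simp add: koszul_def)
qed

lemmas \<Gamma>_simps = bilinear_ladd[OF bilinear_christoffel] bilinear_radd[OF bilinear_christoffel]
  bilinear_lmul[OF bilinear_christoffel] bilinear_rmul[OF bilinear_christoffel]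
  bilinear_lsub[OF bilinear_christoffel] bilinear_rsub[OF bilinear_christoffel]
  bilinear_lzero[OF bilinear_christoffel] bilinear_rzero[OF bilinear_christoffel]
  bilinear_lneg[OF bilinear_christoffel] bilinear_rneg[OF bilinear_christoffel]

definition curv :: "'a \<Rightarrow> 'a \<Rightarrow> 'a \<Rightarrow> 'a \<Rightarrow> 'a" where
  "curv x u v w = dd (\<lambda>y. \<Gamma> y v w) x u + \<Gamma> x u (\<Gamma> x v w) - (dd (\<lambda>y. \<Gamma> y u w) x v + \<Gamma> x v (\<Gamma> x u w))"

lemma cov_deriv_const: "cov_deriv G (\<lambda>_. v) W x = dd W x v + \<Gamma> x v (W x)"
  by (simp add: cov_deriv_def deriv_along_def)

lemma riemann_const:
  assumes "x \<in> S"
  shows "riemann_curvature G (\<lambda>_. u) (\<lambda>_. v) (\<lambda>_. w) x = curv x u v w"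
  unfolding riemann_curvature_def lie_bracket_const cov_deriv_const curv_def
  using assms by (simp add: \<Gamma>_simps cov_deriv_const)

lemma local_ricci_eq: "x \<in> S \<Longrightarrow> local_ricci G x v w = (\<Sum>b\<in>Basis. curv x b v w \<bullet> b)"
  by (simp add: local_ricci_def riemann_const)

lemma linear_curv: "x \<in> S \<Longrightarrow> linear (\<lambda>u. curv x u v w)"
proof -
  assume x: "x \<in> S"
  have "bilinear (\<lambda>u w. dd (\<lambda>y. \<Gamma> y u w) x v)"
    using bilinear_dd_family[OF open_S x bilinear_christoffel smooth_on_christoffel] .
  moreover have "linear (dd (\<lambda>y. \<Gamma> y v w) x)"
    using smooth_on_linear_dd[OF smooth_on_christoffel open_S x] .
  ultimately show ?thesis
    using x by (auto simp: curv_def bilinear_def linear_iff \<Gamma>_simps algebra_simps)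
qed

lemma smooth_on_christoffel_compose:
  assumes "smooth_on S Z"
  shows "smooth_on S (\<lambda>x. \<Gamma> x v (Z x))"
proof -
  have "smooth_on S (\<lambda>x. \<Sum>b\<in>Basis. (Z x \<bullet> b) *\<^sub>R \<Gamma> x v b)"
    by (intro smooth_on_sum smooth_on_scaleR smooth_on_linear[OF bounded_linear_inner_left]
        open_S finite_Basis assms smooth_on_christoffel)
  then show ?thesis
    by (rule smooth_on_cong[OF open_S, rotated])
      (use linear_family_expand[of "\<Gamma> _ v"] bilinear_christoffel in \<open>force simp: bilinear_def\<close>)
qed

lemma smooth_on_ricci: "smooth_on S (\<lambda>x. local_ricci G x v w)"
proof -
  have "smooth_on S (\<lambda>x. \<Sum>b\<in>Basis. curv x b v w \<bullet> b)"
    unfolding curv_def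
    by (intro smooth_on_sum smooth_on_linear[OF bounded_linear_inner_left] smooth_on_diff smooth_on_add
        smooth_on_dd smooth_on_christoffel smooth_on_christoffel_compose open_S finite_Basis)
  then show ?thesis by (rule smooth_on_cong[OF open_S, rotated]) (simp add: local_ricci_eq)
qed

lemma local_hessian_eq:
  "x \<in> S \<Longrightarrow> local_hessian G F x v w = dd (\<lambda>y. dd F y w) x v - dd F x (\<Gamma> x v w)"
  by (simp add: local_hessian_def deriv_along_const) (simp add: deriv_along_def cov_deriv_const)

lemma local_lie_eq:
  assumes "x \<in> S" "linear (dd X x)"
  shows "local_lie G X x v w = dd (\<lambda>y. G y v w) x (X x) + G x (dd X x v) w + G x v (dd X x w)"
  using assms linear_0[OF assms(2)]
  by (simp add: local_lie_def lie_bracket_def deriv_along_def G_simps)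

lemma local_metric_subset: "open S' \<Longrightarrow> S' \<subseteq> S \<Longrightarrow> local_metric S' G"
  using bil sym nondeg smooth smooth_on_subset by unfold_locales (blast+)

end

section \<open>Coordinate invariance\<close>

text \<open>With Q the inverse of P, L is Q L' P, and interchanging the two sums over
  \<open>Basis\<close> is the identity tr(Q (L' P)) = tr((L' P) Q).\<close>

lemma trace_conjugate:
  fixes L L' P :: "'a::euclidean_space \<Rightarrow> 'a"
  assumes L: "linear L" "linear L'" "linear P" "inj P" and PL: "\<And>v. P (L v) = L' (P v)"
  shows "(\<Sum>b\<in>Basis. L b \<bullet> b) = (\<Sum>b\<in>Basis. L' b \<bullet> b)"
proof -
  obtain Q where Q: "linear Q" "\<And>v. Q (P v) = v" "\<And>v. P (Q v) = v"
    using linear_injective_isomorphism[OF L(3,4)] by blast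
  have "(\<Sum>b\<in>Basis. L b \<bullet> b) = (\<Sum>b\<in>Basis. Q (L' (P b)) \<bullet> b)"
    by (metis PL Q(2))
  also have "\<dots> = (\<Sum>b\<in>Basis. \<Sum>c\<in>Basis. (L' (P b) \<bullet> c) * (Q c \<bullet> b))"
    by (subst linear_family_expand[OF Q(1)]) (simp add: inner_sum_left)
  also have "\<dots> = (\<Sum>c\<in>Basis. \<Sum>b\<in>Basis. (L' (P b) \<bullet> c) * (Q c \<bullet> b))"
    by (rule sum.swap)
  also have "\<dots> = (\<Sum>c\<in>Basis. L' (P (Q c)) \<bullet> c)"
  proof (rule sum.cong)
    fix c :: 'a
    have "linear (\<lambda>v. L' (P v))" using linear_compose[OF L(3,2)] by (simp add: o_def)
    from linear_family_expand[OF this, of "Q c"]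
    show "(\<Sum>b\<in>Basis. (L' (P b) \<bullet> c) * (Q c \<bullet> b)) = L' (P (Q c)) \<bullet> c"
      by (simp add: inner_sum_left mult.commute)
  qed simp
  finally show ?thesis by (simp add: Q(3))
qed

text \<open>Chart transitions are one instance, the identity between two expressions of the same
  metric is the other. The derivative of \<phi> is invertible because both forms are
  nondegenerate.\<close>

locale local_isometry = M: local_metric S G + N: local_metric T G'
  for S :: "'a::euclidean_space set" and G and T :: "'a set" and G' +
  fixes \<phi> :: "'a \<Rightarrow> 'a"
  assumes smooth_\<phi>: "smooth_on S \<phi>" and maps: "x \<in> S \<Longrightarrow> \<phi> x \<in> T"
    and pullback: "x \<in> S \<Longrightarrow> G x v w = G' (\<phi> x) (dd \<phi> x v) (dd \<phi> x w)"
begin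

abbreviation P where "P \<equiv> dd \<phi>"
abbreviation P2 where "P2 x u v \<equiv> dd (\<lambda>y. P y u) x v"

lemma linear_P: "x \<in> S \<Longrightarrow> linear (P x)"
  using smooth_on_linear_dd[OF smooth_\<phi> M.open_S] .

lemma inj_P: "x \<in> S \<Longrightarrow> inj (P x)"
  unfolding linear_injective_0[OF linear_P]
  using M.nondeg pullback by (auto simp: N.G_simps maps)

lemma surj_P: "x \<in> S \<Longrightarrow> surj (P x)"
  using linear_injective_imp_surjective[OF linear_P inj_P] by blast

lemma P2_sym: "x \<in> S \<Longrightarrow> P2 x u v = P2 x v u"
  by (rule second_derivative_symmetric[OF smooth_\<phi> M.open_S])

lemma has_derivative_\<phi>: "x \<in> S \<Longrightarrow> (\<phi> has_derivative P x) (at x)"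
  by (rule smooth_on_has_derivative[OF smooth_\<phi> M.open_S])

lemma has_derivative_P: "x \<in> S \<Longrightarrow> ((\<lambda>y. P y v) has_derivative (\<lambda>h. P2 x v h)) (at x)"
  by (rule smooth_on_has_derivative[OF smooth_on_dd[OF smooth_\<phi>] M.open_S])

lemma dd_pullback:
  assumes x: "x \<in> S"
  shows "dd (\<lambda>y. G y v w) x h = dd (\<lambda>y. G' y (P x v) (P x w)) (\<phi> x) (P x h)
    + G' (\<phi> x) (P x v) (P2 x w h) + G' (\<phi> x) (P2 x v h) (P x w)"
proof -
  have "dd (\<lambda>y. G y v w) x = dd (\<lambda>y. G' (\<phi> y) (P y v) (P y w)) x"
    by (rule dd_cong[OF M.open_S x pullback])
  also have "\<dots> = (\<lambda>h. dd (\<lambda>y. G' y (P x v) (P x w)) (\<phi> x) (P x h)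
    + G' (\<phi> x) (P x v) (P2 x w h) + G' (\<phi> x) (P2 x v h) (P x w))"
    by (rule dd_eqI, rule has_derivative_bilinear_family[where B=G', OF N.open_S maps[OF x] N.bil N.smooth
      has_derivative_\<phi>[OF x] has_derivative_P[OF x] has_derivative_P[OF x]])
  finally show ?thesis by simp
qed

text \<open>The classical transformation law. Of the six second-derivative terms that
  \<open>dd_pullback\<close> puts into the Koszul expression, four cancel by the symmetry of
  \<open>P2\<close>, and the two equal ones left over are halved to the single term P2 x v
  w.\<close>

lemma christoffel_pullback:
  assumes x: "x \<in> S"
  shows "P x (christoffel G x v w) = P2 x v w + christoffel G' (\<phi> x) (P x v) (P x w)"
proof (rule N.G_eqI[OF maps[OF x]])
  fix u'
  obtain u where u: "u' = P x u" using surj_P[OF x] by (metis surjD)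
  have "G' (\<phi> x) (P x (christoffel G x v w)) (P x u) = M.koszul x v w u"
    using pullback[OF x] M.koszul_formula[OF x] by metis
  also have "\<dots> = G' (\<phi> x) (P2 x v w) (P x u) + N.koszul (\<phi> x) (P x v) (P x w) (P x u)"
    unfolding M.koszul_def N.koszul_def dd_pullback[OF x]
    using P2_sym[OF x, of v w] P2_sym[OF x, of u w] P2_sym[OF x, of u v] N.sym[OF maps[OF x]]
    by (simp add: add_divide_distrib diff_divide_distrib)
  finally show "G' (\<phi> x) (P x (christoffel G x v w)) u' = G' (\<phi> x) (P2 x v w + christoffel G' (\<phi> x) (P x v) (P x w)) u'"
    by (simp add: u N.G_simps maps x N.koszul_formula)
qed

text \<open>The curvature antisymmetrises this half in u and v. The terms that spoil invariance are
  the third derivative of \<phi> and the final bracket; both are symmetric in u and v, so they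
  disappear in the difference.\<close>

lemma curv_half_pullback:
  assumes x: "x \<in> S"
  defines "\<Gamma> \<equiv> christoffel G" and "\<Gamma>' \<equiv> christoffel G'"
  shows "P x (dd (\<lambda>y. \<Gamma> y v w) x u + \<Gamma> x u (\<Gamma> x v w)) =
     dd (\<lambda>y. P2 y v w) x u + dd (\<lambda>y. \<Gamma>' y (P x v) (P x w)) (\<phi> x) (P x u)
       + \<Gamma>' (\<phi> x) (P x u) (\<Gamma>' (\<phi> x) (P x v) (P x w))
       + (\<Gamma>' (\<phi> x) (P2 x v u) (P x w) + \<Gamma>' (\<phi> x) (P x v) (P2 x w u) + \<Gamma>' (\<phi> x) (P x u) (P2 x w v))"
proof -
  have sm: "smooth_on S (\<lambda>y. P2 y v w)" by (intro smooth_on_dd smooth_\<phi>)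
  have d1: "((\<lambda>y. P y (\<Gamma> y v w)) has_derivative (\<lambda>h. P2 x (\<Gamma> x v w) h + P x (dd (\<lambda>y. \<Gamma> y v w) x h))) (at x)"
    unfolding \<Gamma>_def
    by (rule has_derivative_linear_family[where A=P and A'="\<lambda>v h. P2 x v h", OF M.open_S x linear_P has_derivative_P[OF x]
       smooth_on_has_derivative[OF M.smooth_on_christoffel M.open_S x]])
  have "((\<lambda>y. P2 y v w + \<Gamma>' (\<phi> y) (P y v) (P y w)) has_derivative (\<lambda>h. dd (\<lambda>y. P2 y v w) x h +
     (dd (\<lambda>y. \<Gamma>' y (P x v) (P x w)) (\<phi> x) (P x h)
      + \<Gamma>' (\<phi> x) (P x v) (P2 x w h) + \<Gamma>' (\<phi> x) (P2 x v h) (P x w)))) (at x)"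
    unfolding \<Gamma>'_def
    by (intro has_derivative_add smooth_on_has_derivative[OF sm M.open_S x]
       has_derivative_bilinear_family[where B="christoffel G'", OF N.open_S maps[OF x] N.bilinear_christoffel
         N.smooth_on_christoffel has_derivative_\<phi>[OF x] has_derivative_P[OF x] has_derivative_P[OF x]])
  then have "((\<lambda>y. P y (\<Gamma> y v w)) has_derivative (\<lambda>h. dd (\<lambda>y. P2 y v w) x h +
     (dd (\<lambda>y. \<Gamma>' y (P x v) (P x w)) (\<phi> x) (P x h)
      + \<Gamma>' (\<phi> x) (P x v) (P2 x w h) + \<Gamma>' (\<phi> x) (P2 x v h) (P x w)))) (at x)"
    by (rule has_derivative_transform_within_open[OF _ M.open_S x])
      (simp add: \<Gamma>_def \<Gamma>'_def christoffel_pullback)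
  \<comment> \<open>The two derivatives belong to the two sides of the Christoffel transformation
    law, hence to the same function near x.\<close>
  from fun_cong[OF has_derivative_unique[OF d1 this], of u]
  have "P x (dd (\<lambda>y. \<Gamma> y v w) x u) + P2 x u (\<Gamma> x v w) = dd (\<lambda>y. P2 y v w) x u +
     (dd (\<lambda>y. \<Gamma>' y (P x v) (P x w)) (\<phi> x) (P x u)
      + \<Gamma>' (\<phi> x) (P x v) (P2 x w u) + \<Gamma>' (\<phi> x) (P2 x v u) (P x w))"
    using P2_sym[OF x, of u "\<Gamma> x v w"] by (simp add: add.commute)
  moreover have "P x (\<Gamma> x u (\<Gamma> x v w)) = P2 x u (\<Gamma> x v w) + \<Gamma>' (\<phi> x) (P x u) (P2 x w v)
      + \<Gamma>' (\<phi> x) (P x u) (\<Gamma>' (\<phi> x) (P x v) (P x w))"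
    using christoffel_pullback[OF x, of u "christoffel G x v w"] christoffel_pullback[OF x, of v w]
      P2_sym[OF x, of w v]
    by (simp add: \<Gamma>_def \<Gamma>'_def N.\<Gamma>_simps maps x)
  ultimately show ?thesis
    by (simp add: linear_add[OF linear_P[OF x]] algebra_simps)
qed

lemma curv_pullback:
  assumes x: "x \<in> S"
  shows "P x (M.curv x u v w) = N.curv (\<phi> x) (P x u) (P x v) (P x w)"
proof -
  have sm: "smooth_on S (\<lambda>y. P y w)" by (intro smooth_on_dd smooth_\<phi>)
  \<comment> \<open>Third derivatives of \<phi> are symmetric: \<open>P2_sym\<close> exchanges the
    inner two directions, the second-derivative theorem for y -> P y w the outer two.\<close>
  have 1: "dd (\<lambda>y. P2 y v w) x u = dd (\<lambda>y. P2 y u w) x v"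
  proof -
    have "dd (\<lambda>y. P2 y a w) x b = dd (\<lambda>y. P2 y w a) x b" for a b
      using dd_cong[OF M.open_S x P2_sym[of _ a w]] by simp
    then show ?thesis using second_derivative_symmetric[OF sm M.open_S x, of u v] by simp
  qed
  show ?thesis
    unfolding M.curv_def N.curv_def linear_diff[OF linear_P[OF x]] curv_half_pullback[OF x] 1
      P2_sym[OF x, of u v]
    by simp
qed

text \<open>The endomorphisms u -> R(u, v) w on the two sides are conjugate under P x, so their
  traces agree.\<close>

lemma ricci_pullback:
  assumes x: "x \<in> S"
  shows "local_ricci G x v w = local_ricci G' (\<phi> x) (P x v) (P x w)"
  unfolding M.local_ricci_eq[OF x] N.local_ricci_eq[OF maps[OF x]]
  by (rule trace_conjugate[where L="\<lambda>u. M.curv x u v w" and L'="\<lambda>u. N.curv (\<phi> x) u (P x v) (P x w)" and P="P x",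
      OF M.linear_curv[OF x] N.linear_curv[OF maps[OF x]] linear_P[OF x] inj_P[OF x] curv_pullback[OF x]])

text \<open>The chain rule adds dd F applied to a second derivative of \<phi>; the Christoffel law
  adds the same term to the subtracted part, and the two cancel.\<close>

lemma hessian_pullback:
  assumes x: "x \<in> S" and F: "smooth_on T F" and F': "\<And>y. y \<in> S \<Longrightarrow> F' y = F (\<phi> y)"
  shows "local_hessian G F' x v w = local_hessian G' F (\<phi> x) (P x v) (P x w)"
proof -
  have dF: "dd F' y h = dd F (\<phi> y) (P y h)" if "y \<in> S" for y h
    using dd_cong[OF M.open_S that F'] dd_eqI[OF has_derivative_compose[OF has_derivative_\<phi>[OF that]
      smooth_on_has_derivative[OF F N.open_S maps[OF that]]]] by simp
  have lin: "linear (dd F (\<phi> y))" if "y \<in> S" for y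
    using smooth_on_linear_dd[OF F N.open_S maps[OF that]] .
  have "((\<lambda>y. dd F (\<phi> y) (P y w)) has_derivative (\<lambda>h. dd (\<lambda>z. dd F z (P x w)) (\<phi> x) (P x h) + dd F (\<phi> x) (P2 x w h))) (at x)"
    by (rule has_derivative_linear_family[where A="\<lambda>y. dd F (\<phi> y)" and A'="\<lambda>v h. dd (\<lambda>z. dd F z v) (\<phi> x) (P x h)",
          OF M.open_S x lin _ has_derivative_P[OF x]])
      (auto intro: has_derivative_compose[OF has_derivative_\<phi>[OF x]
          smooth_on_has_derivative[OF smooth_on_dd[OF F] N.open_S maps[OF x]]])
  note dd_eqI[OF this]
  moreover have "dd (\<lambda>y. dd F' y w) x = dd (\<lambda>y. dd F (\<phi> y) (P y w)) x"
    by (rule dd_cong[OF M.open_S x dF])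
  ultimately have "dd (\<lambda>y. dd F' y w) x v = dd (\<lambda>z. dd F z (P x w)) (\<phi> x) (P x v) + dd F (\<phi> x) (P2 x w v)"
    by simp
  moreover have "dd F' x (christoffel G x v w) = dd F (\<phi> x) (P2 x w v) + dd F (\<phi> x) (christoffel G' (\<phi> x) (P x v) (P x w))"
    using P2_sym[OF x, of w v] by (simp add: dF x christoffel_pullback linear_add[OF lin])
  ultimately show ?thesis
    using x by (simp add: M.local_hessian_eq N.local_hessian_eq x maps)
qed

text \<open>Differentiating the relation between X and X' produces second derivatives of \<phi>, and
  these match the ones that \<open>dd_pullback\<close> contributes along X.\<close>

lemma lie_pullback:
  assumes x: "x \<in> S" and X: "smooth_on S X" and X': "smooth_on T X'" and XX': "\<And>y. y \<in> S \<Longrightarrow> X' (\<phi> y) = P y (X y)"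
  shows "local_lie G X x v w = local_lie G' X' (\<phi> x) (P x v) (P x w)"
proof -
  have lin: "linear (dd X x)" "linear (dd X' (\<phi> x))"
    using smooth_on_linear_dd[OF X M.open_S x] smooth_on_linear_dd[OF X' N.open_S maps[OF x]] .
  have "((\<lambda>y. P y (X y)) has_derivative (\<lambda>h. P2 x (X x) h + P x (dd X x h))) (at x)"
    by (rule has_derivative_linear_family[where A=P and A'="\<lambda>v h. P2 x v h", OF M.open_S x linear_P has_derivative_P[OF x]
       smooth_on_has_derivative[OF X M.open_S x]])
  moreover have "((\<lambda>y. P y (X y)) has_derivative (\<lambda>h. dd X' (\<phi> x) (P x h))) (at x)"
    by (rule has_derivative_transform_within_open[OF has_derivative_compose[OF has_derivative_\<phi>[OF x]
      smooth_on_has_derivative[OF X' N.open_S maps[OF x]]] M.open_S x XX'])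
  ultimately have "(\<lambda>h. P2 x (X x) h + P x (dd X x h)) = (\<lambda>h. dd X' (\<phi> x) (P x h))"
    by (rule has_derivative_unique)
  then have e: "dd X' (\<phi> x) (P x h) = P2 x h (X x) + P x (dd X x h)" for h
    using P2_sym[OF x, of h "X x"] fun_cong[of _ _ h] by fastforce
  show ?thesis
    unfolding M.local_lie_eq[OF x lin(1)] N.local_lie_eq[OF maps[OF x] lin(2)] XX'[OF x] e dd_pullback[OF x]
      pullback[OF x]
    by (simp add: N.G_simps maps x)
qed

end

section \<open>Warped products in coordinates\<close>

lemma dd_compose_fst: "(K has_derivative dd K (fst z)) (at (fst z)) \<Longrightarrow> dd (\<lambda>z. K (fst z)) z = (\<lambda>h. dd K (fst z) (fst h))"
  by (intro dd_eqI has_derivative_compose[where g=K, OF has_derivative_fst[OF has_derivative_ident]])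

lemma dd_compose_snd: "(K has_derivative dd K (snd z)) (at (snd z)) \<Longrightarrow> dd (\<lambda>z. K (snd z)) z = (\<lambda>h. dd K (snd z) (snd h))"
  by (intro dd_eqI has_derivative_compose[where g=K, OF has_derivative_snd[OF has_derivative_ident]])

text \<open>The counterpart of \<open>warped_metric\<close> in a product chart. The sequential
  metric is a \<open>warp\<close> whose base form is again a \<open>warp\<close>.\<close>

definition warp :: "('b \<Rightarrow> 'b \<Rightarrow> 'b \<Rightarrow> real) \<Rightarrow> ('b \<Rightarrow> real) \<Rightarrow> ('f \<Rightarrow> 'f \<Rightarrow> 'f \<Rightarrow> real)
    \<Rightarrow> 'b \<times> 'f \<Rightarrow> 'b \<times> 'f \<Rightarrow> 'b \<times> 'f \<Rightarrow> real" where
  "warp GB H GF = (\<lambda>z v w. GB (fst z) (fst v) (fst w) + (H (fst z))\<^sup>2 * GF (snd z) (snd v) (snd w))"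

lemma warp_apply: "warp GB H GF (x, y) v w = GB x (fst v) (fst w) + (H x)\<^sup>2 * GF y (snd v) (snd w)"
  by (simp add: warp_def)

lemma trace_prod:
  "(\<Sum>b\<in>Basis. L b \<bullet> b) = (\<Sum>b\<in>Basis. fst (L (b, 0)) \<bullet> b) + (\<Sum>b\<in>Basis. snd (L (0, b)) \<bullet> b)"
  for L :: "'b::euclidean_space \<times> 'f::euclidean_space \<Rightarrow> 'b \<times> 'f"
  unfolding Basis_prod_def
  by (subst sum.union_disjoint) (auto simp: sum.reindex inj_on_def inner_prod_def)

locale local_warped = B: local_metric SB GB + F: local_metric SF GF
  for SB :: "'b::euclidean_space set" and GB and SF :: "'f::euclidean_space set" and GF +
  fixes H :: "'b \<Rightarrow> real"
  assumes smooth_H: "smooth_on SB H" and pos_H: "x \<in> SB \<Longrightarrow> H x > 0"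
begin

abbreviation "W \<equiv> warp GB H GF"

lemma H_neq_0: "x \<in> SB \<Longrightarrow> H x \<noteq> 0"
  using pos_H by force

sublocale W: local_metric "SB \<times> SF" W
proof
  show op: "open (SB \<times> SF)" by (simp add: open_Times B.open_S F.open_S)
  fix z v w assume z: "z \<in> SB \<times> SF"
  then have xy: "fst z \<in> SB" "snd z \<in> SF" by auto
  show "bilinear (W z)"
    unfolding bilinear_def linear_iff using xy
    by (auto simp: warp_def B.G_simps F.G_simps algebra_simps)
  show "W z v w = W z w v"
    using xy B.sym F.sym by (simp add: warp_def)
  show "v = 0" if W0: "\<And>w. W z v w = 0"
  proof -
    have "fst v = 0"
      using W0[of "(_, 0)"] xy by (intro B.nondeg[OF xy(1)]) (simp add: warp_def F.G_simps)
    moreover have "snd v = 0"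
      using W0[of "(0, _)"] xy H_neq_0 by (intro F.nondeg[OF xy(2)]) (simp add: warp_def B.G_simps)
    ultimately show ?thesis by (simp add: prod_eq_iff)
  qed
next
  fix v w
  show "smooth_on (SB \<times> SF) (\<lambda>z. W z v w)"
    unfolding warp_def power2_eq_square
    by (intro smooth_on_add smooth_on_mult open_Times B.open_S F.open_S
        smooth_on_compose_fst[where F="\<lambda>x. GB x _ _"] smooth_on_compose_snd[where F="\<lambda>x. GF x _ _"]
        smooth_on_compose_fst[where F=H] B.smooth F.smooth smooth_H)
qed

lemma dH: "x \<in> SB \<Longrightarrow> (H has_derivative dd H x) (at x)"
  by (rule smooth_on_has_derivative[OF smooth_H B.open_S])

lemma linear_dH: "x \<in> SB \<Longrightarrow> linear (dd H x)"
  by (rule smooth_on_linear_dd[OF smooth_H B.open_S])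

lemma dd_W:
  assumes "z \<in> SB \<times> SF"
  shows "dd (\<lambda>z. W z v w) z h = dd (\<lambda>x. GB x (fst v) (fst w)) (fst z) (fst h)
    + 2 * H (fst z) * dd H (fst z) (fst h) * GF (snd z) (snd v) (snd w)
    + (H (fst z))\<^sup>2 * dd (\<lambda>y. GF y (snd v) (snd w)) (snd z) (snd h)"
proof -
  have xy: "fst z \<in> SB" "snd z \<in> SF" using assms by auto
  have 1: "((\<lambda>z. GB (fst z) (fst v) (fst w)) has_derivative (\<lambda>h. dd (\<lambda>x. GB x (fst v) (fst w)) (fst z) (fst h))) (at z)"
    by (rule has_derivative_compose[where g="\<lambda>x. GB x (fst v) (fst w)", OF has_derivative_fst[OF has_derivative_ident]
      smooth_on_has_derivative[OF B.smooth B.open_S xy(1)]])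
  have 2: "((\<lambda>z. GF (snd z) (snd v) (snd w)) has_derivative (\<lambda>h. dd (\<lambda>x. GF x (snd v) (snd w)) (snd z) (snd h))) (at z)"
    by (rule has_derivative_compose[where g="\<lambda>x. GF x (snd v) (snd w)", OF has_derivative_snd[OF has_derivative_ident]
      smooth_on_has_derivative[OF F.smooth F.open_S xy(2)]])
  have 3: "((\<lambda>z. H (fst z)) has_derivative (\<lambda>h. dd H (fst z) (fst h))) (at z)"
    by (rule has_derivative_compose[where g=H, OF has_derivative_fst[OF has_derivative_ident] dH[OF xy(1)]])
  show ?thesis
    unfolding warp_def power2_eq_square
    by (subst dd_eqI[OF has_derivative_add[OF 1 has_derivative_mult[OF has_derivative_mult[OF 3 3] 2]]])
      (simp add: algebra_simps)
qed

definition grad :: "'b \<Rightarrow> 'b" where "grad x = raise (GB x) (dd H x)"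

lemma grad: "x \<in> SB \<Longrightarrow> GB x (grad x) u = dd H x u"
  unfolding grad_def by (rule B.raise_works[OF _ linear_dH])

lemma smooth_grad: "smooth_on SB grad"
  unfolding grad_def[abs_def] by (rule B.smooth_on_raise[OF linear_dH smooth_on_dd[OF smooth_H]])

definition dlogH :: "'b \<Rightarrow> 'b \<Rightarrow> real" where "dlogH x v = dd H x v / H x"

lemma dlogH_simps:
  assumes "x \<in> SB"
  shows "dlogH x (v + w) = dlogH x v + dlogH x w" "dlogH x (r *\<^sub>R v) = r * dlogH x v" "dlogH x 0 = 0" "dlogH x (- v) = - dlogH x v"
  using linear_dH[OF assms] by (simp_all add: dlogH_def linear_add linear_scale linear_0 linear_neg add_divide_distrib)

lemma has_derivative_dlogH:
  assumes "x \<in> SB"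
  shows "((\<lambda>x. dlogH x w) has_derivative (\<lambda>v. dd (\<lambda>x. dd H x w) x v / H x - dlogH x v * dlogH x w)) (at x)"
proof -
  have "((\<lambda>x. dd H x w / H x) has_derivative (\<lambda>v. - dd H x w * (inverse (H x) * dd H x v * inverse (H x))
     + dd (\<lambda>x. dd H x w) x v / H x)) (at x)"
    by (rule has_derivative_divide[OF smooth_on_has_derivative[OF smooth_on_dd[OF smooth_H] B.open_S assms]
      dH[OF assms] H_neq_0[OF assms]])
  then show ?thesis by (simp add: dlogH_def divide_inverse mult_ac)
qed

text \<open>The connection of a warped product: the base is totally geodesic, the fibres bend along
  the gradient of H, and mixed terms are scaled by d log H. The candidate is verified by pairing it
  with every u, which determines it by nondegeneracy.\<close>

lemma christoffel_W:
  assumes "z \<in> SB \<times> SF"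
  shows "christoffel W z v w =
    (christoffel GB (fst z) (fst v) (fst w) - (H (fst z) * GF (snd z) (snd v) (snd w)) *\<^sub>R grad (fst z),
     christoffel GF (snd z) (snd v) (snd w) + dlogH (fst z) (fst v) *\<^sub>R snd w + dlogH (fst z) (fst w) *\<^sub>R snd v)"
proof (rule W.christoffel_eqI[OF assms])
  fix u
  have xy: "fst z \<in> SB" "snd z \<in> SF" using assms by auto
  show "W z (christoffel GB (fst z) (fst v) (fst w) - (H (fst z) * GF (snd z) (snd v) (snd w)) *\<^sub>R grad (fst z),
     christoffel GF (snd z) (snd v) (snd w) + dlogH (fst z) (fst v) *\<^sub>R snd w + dlogH (fst z) (fst w) *\<^sub>R snd v) u
    = W.koszul z v w u"
    unfolding W.koszul_def dd_W[OF assms]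
    using xy H_neq_0[OF xy(1)]
    by (simp add: warp_def B.G_simps F.G_simps B.koszul_formula F.koszul_formula grad
      B.koszul_def F.koszul_def dlogH_def field_simps power2_eq_square)
qed

lemma dd_christoffel_eqI:
  assumes z: "z \<in> SB \<times> SF" and D: "((\<lambda>z. (K z, L z)) has_derivative D) (at z)"
    and eq: "\<And>z. z \<in> SB \<times> SF \<Longrightarrow> christoffel W z v w = (K z, L z)"
  shows "dd (\<lambda>z. christoffel W z v w) z = D"
  using dd_cong[OF W.open_S z eq] dd_eqI[OF D] by simp

lemma has_derivative_fst_compose: "(K has_derivative D) (at (fst z)) \<Longrightarrow> ((\<lambda>z. K (fst z)) has_derivative (\<lambda>h. D (fst h))) (at z)"
  by (rule has_derivative_compose[where g=K, OF has_derivative_fst[OF has_derivative_ident]])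

lemma has_derivative_snd_compose: "(K has_derivative D) (at (snd z)) \<Longrightarrow> ((\<lambda>z. K (snd z)) has_derivative (\<lambda>h. D (snd h))) (at z)"
  by (rule has_derivative_compose[where g=K, OF has_derivative_snd[OF has_derivative_ident]])

section \<open>Ricci tensor, Hessian and Lie derivative of a warped product\<close>

context
  fixes z assumes z: "z \<in> SB \<times> SF"
begin

lemma fst_z: "fst z \<in> SB" and snd_z: "snd z \<in> SF" using z by auto

lemma dd_christoffel_BB:
  "dd (\<lambda>z. christoffel W z (v, 0) (w, 0)) z h = (dd (\<lambda>x. christoffel GB x v w) (fst z) (fst h), 0)"
proof -
  have "((\<lambda>z. (christoffel GB (fst z) v w, 0)) has_derivative (\<lambda>h. (dd (\<lambda>x. christoffel GB x v w) (fst z) (fst h), 0))) (at z)"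
    by (intro has_derivative_Pair has_derivative_const
      has_derivative_fst_compose[where K="\<lambda>x. christoffel GB x v w"] smooth_on_has_derivative[OF B.smooth_on_christoffel B.open_S fst_z])
  from dd_christoffel_eqI[OF z this] show ?thesis
    by (auto simp: christoffel_W F.G_simps F.\<Gamma>_simps)
qed

lemma dd_christoffel_BF:
  "dd (\<lambda>z. christoffel W z (v, 0) (0, w)) z h = (0, (dd (\<lambda>x. dd H x v) (fst z) (fst h) / H (fst z) - dlogH (fst z) (fst h) * dlogH (fst z) v) *\<^sub>R w)"
proof -
  have "((\<lambda>z. (0::'b, dlogH (fst z) v *\<^sub>R w)) has_derivative (\<lambda>h. (0, (dd (\<lambda>x. dd H x v) (fst z) (fst h) / H (fst z) - dlogH (fst z) (fst h) * dlogH (fst z) v) *\<^sub>R w))) (at z)"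
    by (intro has_derivative_Pair has_derivative_const has_derivative_scaleR_left
      has_derivative_fst_compose[where K="\<lambda>x. dlogH x v"] has_derivative_dlogH[OF fst_z])
  from dd_christoffel_eqI[OF z this] show ?thesis
    by (auto simp: christoffel_W B.\<Gamma>_simps F.G_simps F.\<Gamma>_simps dlogH_simps)
qed

lemma dd_christoffel_FB:
  "dd (\<lambda>z. christoffel W z (0, w) (v, 0)) z h = (0, (dd (\<lambda>x. dd H x v) (fst z) (fst h) / H (fst z) - dlogH (fst z) (fst h) * dlogH (fst z) v) *\<^sub>R w)"
  using dd_cong[OF W.open_S z W.christoffel_sym[of _ "(0, w)" "(v, 0)"]] dd_christoffel_BF by simp

lemma dd_christoffel_FF:
  "dd (\<lambda>z. christoffel W z (0, v) (0, w)) z h =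
    (- (GF (snd z) v w *\<^sub>R dd (\<lambda>x. H x *\<^sub>R grad x) (fst z) (fst h) + dd (\<lambda>y. GF y v w) (snd z) (snd h) *\<^sub>R (H (fst z) *\<^sub>R grad (fst z))),
     dd (\<lambda>y. christoffel GF y v w) (snd z) (snd h))"
proof -
  have "((\<lambda>z. (- (GF (snd z) v w *\<^sub>R (H (fst z) *\<^sub>R grad (fst z))), christoffel GF (snd z) v w)) has_derivative
    (\<lambda>h. (- (GF (snd z) v w *\<^sub>R dd (\<lambda>x. H x *\<^sub>R grad x) (fst z) (fst h) + dd (\<lambda>y. GF y v w) (snd z) (snd h) *\<^sub>R (H (fst z) *\<^sub>R grad (fst z))),
     dd (\<lambda>y. christoffel GF y v w) (snd z) (snd h)))) (at z)"
    by (intro has_derivative_Pair has_derivative_minus has_derivative_scaleR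
        has_derivative_snd_compose[where K="\<lambda>y. GF y v w"] has_derivative_snd_compose[where K="\<lambda>y. christoffel GF y v w"]
        has_derivative_fst_compose[where K="\<lambda>x. H x *\<^sub>R grad x"]
        smooth_on_has_derivative[OF F.smooth_on_christoffel F.open_S snd_z]
        smooth_on_has_derivative[OF F.smooth F.open_S snd_z]
        smooth_on_has_derivative[OF smooth_on_scaleR[OF B.open_S smooth_H smooth_grad] B.open_S fst_z])
  from dd_christoffel_eqI[OF z this] show ?thesis
    by (auto simp: christoffel_W B.\<Gamma>_simps dlogH_simps mult.commute)
qed

text \<open>The trace splits over base and fibre directions. Base directions give the base Ricci
  tensor, and each of the DIM('f) fibre directions contributes -Hess H (v, w) / H.\<close>

lemma ricci_BB:
  "local_ricci W z (v, 0) (w, 0) = local_ricci GB (fst z) v w - real DIM('f) / H (fst z) * local_hessian GB H (fst z) v w"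
proof -
  note xy = fst_z snd_z
  have 1: "fst (W.curv z (b, 0) (v, 0) (w, 0)) = B.curv (fst z) b v w" for b
    using z xy by (simp add: W.curv_def B.curv_def dd_christoffel_BB christoffel_W F.G_simps)
  have 2: "snd (W.curv z (0, b) (v, 0) (w, 0)) = - (local_hessian GB H (fst z) v w / H (fst z)) *\<^sub>R b" for b
    using z xy linear_0[OF smooth_on_linear_dd[OF B.smooth_on_christoffel B.open_S xy(1)]]
    by (simp add: W.curv_def dd_christoffel_BB dd_christoffel_FB christoffel_W F.G_simps F.\<Gamma>_simps B.\<Gamma>_simps dlogH_simps
      B.local_hessian_eq dlogH_def[of _ "christoffel _ _ _ _"] algebra_simps diff_divide_distrib)
  show ?thesis
    unfolding W.local_ricci_eq[OF z] B.local_ricci_eq[OF xy(1)] trace_prod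
    by (simp add: 1 2)
qed

text \<open>Only the shape matters later, so \<kappa> is hidden under a quantifier. With N the
  squared length of the gradient, the proof finds \<kappa> = (1 - DIM('f)) N - H \<Delta>H, where
  \<Delta>H is the Laplacian of H on the base.\<close>

lemma ricci_FF: "\<exists>\<kappa>. \<forall>v w. local_ricci W z (0, v) (0, w) = local_ricci GF (snd z) v w + \<kappa> * GF (snd z) v w"
proof -
  note xy = fst_z snd_z
  define N where "N = dd H (fst z) (grad (fst z))"
  \<comment> \<open>k b is H times the covariant derivative of the gradient along b: the last term
    removes the part of the product rule that differentiates H. Its trace is H \<Delta>H.\<close>
  define k where "k b = dd (\<lambda>x. H x *\<^sub>R grad x) (fst z) b + christoffel GB (fst z) b (H (fst z) *\<^sub>R grad (fst z))
    - (H (fst z) * dlogH (fst z) b) *\<^sub>R grad (fst z)" for b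
  have qg: "dlogH (fst z) (grad (fst z)) * H (fst z) = N" using H_neq_0[OF xy(1)] by (simp add: dlogH_def N_def)
  have 1: "fst (W.curv z (b, 0) (0, v) (0, w)) = - (GF (snd z) v w *\<^sub>R k b)" for b v w
    using z xy linear_0[OF smooth_on_linear_dd[OF smooth_H B.open_S xy(1)]]
      linear_0[OF smooth_on_linear_dd[OF F.smooth F.open_S xy(2)]]
      linear_0[OF smooth_on_linear_dd[OF F.smooth_on_christoffel F.open_S xy(2)]]
    by (simp add: W.curv_def dd_christoffel_FF dd_christoffel_BF christoffel_W F.G_simps F.\<Gamma>_simps B.\<Gamma>_simps dlogH_simps k_def
      algebra_simps)
  have 2: "snd (W.curv z (0, b) (0, v) (0, w)) = F.curv (snd z) b v w - (N * GF (snd z) v w) *\<^sub>R b + (N * GF (snd z) b w) *\<^sub>R v" for b v w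
    using z xy
    by (simp add: W.curv_def F.curv_def dd_christoffel_FF christoffel_W F.G_simps F.\<Gamma>_simps B.\<Gamma>_simps dlogH_simps qg[symmetric]
      algebra_simps)
  have 3: "(\<Sum>b\<in>Basis. GF (snd z) b w * (v \<bullet> b)) = GF (snd z) v w" for v w
    using linear_family_expand[OF F.linear_left[OF xy(2)], of v w] by (simp add: mult.commute)
  have "local_ricci W z (0, v) (0, w) = local_ricci GF (snd z) v w + (N - N * real DIM('f) - (\<Sum>b\<in>Basis. k b \<bullet> b)) * GF (snd z) v w" for v w
  proof -
    have "local_ricci W z (0, v) (0, w) = (\<Sum>b\<in>Basis. - (GF (snd z) v w * (k b \<bullet> b))) +
       (\<Sum>b\<in>Basis. F.curv (snd z) b v w \<bullet> b - N * GF (snd z) v w + N * (GF (snd z) b w * (v \<bullet> b)))"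
      unfolding W.local_ricci_eq[OF z] trace_prod
      by (simp add: sum_negf 1 2 inner_add_left inner_diff_left mult.assoc)
    also have "\<dots> = - GF (snd z) v w * (\<Sum>b\<in>Basis. k b \<bullet> b) + (local_ricci GF (snd z) v w - real DIM('f) * (N * GF (snd z) v w) + N * GF (snd z) v w)"
      unfolding F.local_ricci_eq[OF xy(2)]
      by (simp only: sum.distrib sum_subtractf sum_distrib_left[symmetric] 3 sum_negf sum_constant) (simp add: sum_distrib_left sum_negf)
    finally show ?thesis by (simp add: algebra_simps)
  qed
  then show ?thesis by blast
qed

text \<open>Christoffel symbols of two base vectors are those of the base, with no fibre component,
  so the Hessian sees nothing of the warping.\<close>

lemma hessian_lift:
  assumes K: "smooth_on SB K"
  shows "local_hessian W (\<lambda>z. K (fst z)) z (v, 0) (w, 0) = local_hessian GB K (fst z) v w"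
proof -
  note xy = fst_z snd_z
  have dK: "dd (\<lambda>z. K (fst z)) y h = dd K (fst y) (fst h)" if "y \<in> SB \<times> SF" for y h
    using that by (subst dd_compose_fst) (auto intro: smooth_on_has_derivative[OF K B.open_S])
  have "dd (\<lambda>y. dd (\<lambda>z. K (fst z)) y (w, 0)) z = dd (\<lambda>y. dd K (fst y) w) z"
    by (rule dd_cong[OF W.open_S z]) (simp add: dK)
  also have "\<dots> = (\<lambda>h. dd (\<lambda>x. dd K x w) (fst z) (fst h))"
    by (rule dd_compose_fst[OF smooth_on_has_derivative[OF smooth_on_dd[OF K] B.open_S xy(1)]])
  finally show ?thesis
    using z xy by (simp add: W.local_hessian_eq B.local_hessian_eq dK christoffel_W F.G_simps)
qed

context
  fixes X :: "'b \<times> 'f \<Rightarrow> 'b \<times> 'f" and XB XF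
  assumes XB: "smooth_on SB XB" and XF: "smooth_on SF XF"
    and X: "\<And>z. z \<in> SB \<times> SF \<Longrightarrow> X z = (XB (fst z), XF (snd z))"
begin

lemma dd_split_field: "dd X z = (\<lambda>h. (dd XB (fst z) (fst h), dd XF (snd z) (snd h)))"
proof -
  have "((\<lambda>z. (XB (fst z), XF (snd z))) has_derivative (\<lambda>h. (dd XB (fst z) (fst h), dd XF (snd z) (snd h)))) (at z)"
    by (intro has_derivative_Pair has_derivative_fst_compose has_derivative_snd_compose
        smooth_on_has_derivative[OF XB B.open_S fst_z] smooth_on_has_derivative[OF XF F.open_S snd_z])
  from dd_eqI[OF this] show ?thesis using dd_cong[OF W.open_S z X] by simp
qed

text \<open>A field that splits into factor fields differentiates each summand of the metric
  separately. The middle term is XB applied to the square of H.\<close>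

lemma local_lie_split:
  "local_lie W X z v w = local_lie GB XB (fst z) (fst v) (fst w)
     + 2 * H (fst z) * dd H (fst z) (XB (fst z)) * GF (snd z) (snd v) (snd w)
     + (H (fst z))\<^sup>2 * local_lie GF XF (snd z) (snd v) (snd w)"
proof -
  note lB = smooth_on_linear_dd[OF XB B.open_S fst_z] and lF = smooth_on_linear_dd[OF XF F.open_S snd_z]
  have "linear (dd X z)"
    unfolding dd_split_field linear_iff by (simp add: linear_add[OF lB] linear_add[OF lF] linear_scale[OF lB] linear_scale[OF lF])
  then show ?thesis
    unfolding W.local_lie_eq[OF z \<open>linear (dd X z)\<close>] B.local_lie_eq[OF fst_z lB] F.local_lie_eq[OF snd_z lF]
      dd_W[OF z] dd_split_field X[OF z]
    by (simp add: warp_def algebra_simps)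
qed

end
end
end

text \<open>All equations are taken at one point, so the conformal factors and the right side of the
  soliton equation are plain numbers s, t and m. Each factor is isolated by testing on vectors
  tangent to it. Zero fields satisfy the conditions on Y1, Y2 and Y3, so every case of the theorem
  fits.\<close>

lemma sequential_warped_soliton_local:
  fixes S1 :: "'a1::euclidean_space set" and S2 :: "'a2::euclidean_space set" and S3 :: "'a3::euclidean_space set"
  assumes w12: "local_warped S1 G1 S2 G2 F" and w123: "local_warped (S1 \<times> S2) (warp G1 F G2) S3 G3 H"
    and x: "x1 \<in> S1" "x2 \<in> S2" "x3 \<in> S3"
    and hess_F: "\<And>v w. local_hessian (warp (warp G1 F G2) H G3) (\<lambda>z. F (fst (fst z))) ((x1, x2), x3) v w
        = s * warp (warp G1 F G2) H G3 ((x1, x2), x3) v w"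
    and hess_H: "\<And>v w. local_hessian (warp G1 F G2) H (x1, x2) v w = t * warp G1 F G2 (x1, x2) v w"
    and Y: "smooth_on S1 Y1" "smooth_on S2 Y2" "smooth_on S3 Y3"
    and X: "\<And>z. z \<in> (S1 \<times> S2) \<times> S3 \<Longrightarrow> X z = ((Y1 (fst (fst z)), Y2 (snd (fst z))), Y3 (snd z))"
    and K: "\<And>v w. local_lie G1 Y1 x1 v w = 0" "\<And>v w. local_lie G2 Y2 x2 v w = 0" "\<And>v w. local_lie G3 Y3 x3 v w = 0"
    and soliton: "\<And>v w. local_ricci (warp (warp G1 F G2) H G3) ((x1, x2), x3) v w
        + 1/2 * local_lie (warp (warp G1 F G2) H G3) X ((x1, x2), x3) v w
        = m * warp (warp G1 F G2) H G3 ((x1, x2), x3) v w"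
  shows "\<exists>\<mu>. \<forall>v w. local_ricci G1 x1 v w = \<mu> * G1 x1 v w"
    and "\<exists>\<mu>. \<forall>v w. local_ricci G2 x2 v w = \<mu> * G2 x2 v w"
    and "\<exists>\<mu>. \<forall>v w. local_ricci G3 x3 v w = \<mu> * G3 x3 v w"
proof -
  interpret b: local_warped S1 G1 S2 G2 F by (rule w12)
  interpret m: local_warped "S1 \<times> S2" "warp G1 F G2" S3 G3 H by (rule w123)
  let ?z = "((x1, x2), x3)"
  have zb: "(x1, x2) \<in> S1 \<times> S2" and z: "?z \<in> (S1 \<times> S2) \<times> S3" using x by auto
  have Yb: "smooth_on (S1 \<times> S2) (\<lambda>y. (Y1 (fst y), Y2 (snd y)))"
    by (intro smooth_on_Pair smooth_on_compose_fst smooth_on_compose_snd open_Times b.B.open_S b.F.open_S Y)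
  have "local_lie (warp (warp G1 F G2) H G3) X ?z v w =
      local_lie (warp G1 F G2) (\<lambda>y. (Y1 (fst y), Y2 (snd y))) (x1, x2) (fst v) (fst w)
     + 2 * H (x1, x2) * dd H (x1, x2) (Y1 x1, Y2 x2) * G3 x3 (snd v) (snd w)
     + (H (x1, x2))\<^sup>2 * local_lie G3 Y3 x3 (snd v) (snd w)" for v w
    using m.local_lie_split[OF z Yb Y(3) X] by simp
  moreover have "local_lie (warp G1 F G2) (\<lambda>y. (Y1 (fst y), Y2 (snd y))) (x1, x2) v w =
      2 * F x1 * dd F x1 (Y1 x1) * G2 x2 (snd v) (snd w)" for v w
    using b.local_lie_split[OF zb Y(1,2), of "\<lambda>y. (Y1 (fst y), Y2 (snd y))"] K by simp
  ultimately have lie: "local_lie (warp (warp G1 F G2) H G3) X ?z v w =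
      2 * F x1 * dd F x1 (Y1 x1) * G2 x2 (snd (fst v)) (snd (fst w))
     + 2 * H (x1, x2) * dd H (x1, x2) (Y1 x1, Y2 x2) * G3 x3 (snd v) (snd w)" for v w
    using K by simp
  have F': "smooth_on (S1 \<times> S2) (\<lambda>z. F (fst z))"
    by (intro smooth_on_compose_fst b.B.open_S b.F.open_S b.smooth_H)
  \<comment> \<open>On vectors tangent to the first factor the Hessian descends twice, through the
    outer product and then through the inner one.\<close>
  have hess1: "local_hessian G1 F x1 v w = s * G1 x1 v w" for v w
    using hess_F[of "((v, 0), 0)" "((w, 0), 0)"] m.hessian_lift[OF z F'] b.hessian_lift[OF zb b.smooth_H] x
    by (simp add: warp_apply b.F.G_simps m.F.G_simps)
  obtain k2 where k2: "\<And>v w. local_ricci (warp G1 F G2) (x1, x2) (0, v) (0, w) = local_ricci G2 x2 v w + k2 * G2 x2 v w"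
    using b.ricci_FF[OF zb] by auto
  obtain k3 where k3: "\<And>v w. local_ricci (warp (warp G1 F G2) H G3) ?z (0, v) (0, w) = local_ricci G3 x3 v w + k3 * G3 x3 v w"
    using m.ricci_FF[OF z] by auto
  define c3 where "c3 = real DIM('a3) / H (x1, x2)"
  define c2 where "c2 = real DIM('a2) / F x1"
  \<comment> \<open>The base formula is used for the outer and then for the inner product; c3 t and
    c2 s are the two Hessian corrections. Both remaining Lie terms vanish on these vectors.\<close>
  have "local_ricci G1 x1 v w = (m + c2 * s + c3 * t) * G1 x1 v w" for v w
    using soliton[of "((v, 0), 0)" "((w, 0), 0)"] m.ricci_BB[OF z, of "(v, 0)" "(w, 0)"] b.ricci_BB[OF zb, of v w] x
    unfolding lie
    by (simp add: hess_H hess1 c2_def[symmetric] c3_def[symmetric] warp_apply b.F.G_simps m.F.G_simps algebra_simps)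
  then show "\<exists>\<mu>. \<forall>v w. local_ricci G1 x1 v w = \<mu> * G1 x1 v w" by blast
  \<comment> \<open>The second factor is base of the outer product and fibre of the inner one. The
    last summand is half of the Lie term that comes from the derivative of the square of F.\<close>
  have "local_ricci G2 x2 v w = (m * (F x1)\<^sup>2 + c3 * t * (F x1)\<^sup>2 - k2 - F x1 * dd F x1 (Y1 x1)) * G2 x2 v w" for v w
    using soliton[of "((0, v), 0)" "((0, w), 0)"] m.ricci_BB[OF z, of "(0, v)" "(0, w)"] k2[of v w] x
    unfolding lie
    by (simp add: hess_H c3_def[symmetric] warp_apply b.B.G_simps m.F.G_simps algebra_simps)
  then show "\<exists>\<mu>. \<forall>v w. local_ricci G2 x2 v w = \<mu> * G2 x2 v w" by blast
  \<comment> \<open>The third factor is a fibre of the outer product only, and just the derivative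
    of the square of H survives from the Lie term.\<close>
  have "local_ricci G3 x3 v w = (m * (H (x1, x2))\<^sup>2 - k3 - H (x1, x2) * dd H (x1, x2) (Y1 x1, Y2 x2)) * G3 x3 v w" for v w
    using soliton[of "(0, v)" "(0, w)"] k3[of v w] x
    unfolding lie
    by (simp add: warp_apply b.B.G_simps b.F.G_simps algebra_simps)
  then show "\<exists>\<mu>. \<forall>v w. local_ricci G3 x3 v w = \<mu> * G3 x3 v w" by blast
qed

section \<open>Tensors in charts\<close>

lemma smooth_on_local:
  assumes "open S" "\<And>x. x \<in> S \<Longrightarrow> \<exists>U. open U \<and> x \<in> U \<and> smooth_on U F"
  shows "smooth_on S F"
proof -
  have "Ck_on k S F" if "\<And>x. x \<in> S \<Longrightarrow> \<exists>U. open U \<and> x \<in> U \<and> Ck_on k U F" for k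
    using that
  proof (induction k arbitrary: F)
    case 0
    have "isCont F x" if "x \<in> S" for x
      using 0[OF that] by (auto simp: continuous_on_eq_continuous_at)
    then show ?case by (simp add: continuous_at_imp_continuous_on)
  next
    case (Suc k)
    show ?case
    proof (rule Ck_on_SucI[OF assms(1)])
      show "(F has_derivative dd F x) (at x)" if "x \<in> S" for x
        using Suc.prems[OF that] Ck_on_has_derivative by blast
      show "Ck_on k S (\<lambda>x. dd F x v)" for v
      proof (rule Suc.IH)
        fix x assume "x \<in> S"
        from Suc.prems[OF this] obtain U where "open U" "x \<in> U" "Ck_on (Suc k) U F" by blast
        then show "\<exists>U. open U \<and> x \<in> U \<and> Ck_on k U (\<lambda>x. dd F x v)" by (intro exI[of _ U]) simp
      qed
    qed
  qed
  then show ?thesis using assms(2) unfolding smooth_on_def by blast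
qed

text \<open>The form of a product chart and the explicit \<open>warp\<close> agree only over the
  chart image. Regarding the identity as an isometry transfers the Ricci tensor, the Hessian and the
  Lie derivative at once.\<close>

lemma local_isometry_ident:
  assumes "local_metric S G" "local_metric S G'" "\<And>x v w. x \<in> S \<Longrightarrow> G x v w = G' x v w"
  shows "local_isometry S G S G' (\<lambda>x. x)"
proof -
  interpret M: local_metric S G by fact
  interpret N: local_metric S G' by fact
  show ?thesis
    using smooth_on_ident[OF M.open_S] assms(3) by unfold_locales auto
qed

lemma is_chartD:
  assumes "is_chart c"
  shows "open (chart_dom c)" "open (chart_img c)"
    and "p \<in> chart_dom c \<Longrightarrow> chart_map c p \<in> chart_img c"
    and "p \<in> chart_dom c \<Longrightarrow> chart_inv c (chart_map c p) = p"
    and "x \<in> chart_img c \<Longrightarrow> chart_inv c x \<in> chart_dom c"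
    and "x \<in> chart_img c \<Longrightarrow> chart_map c (chart_inv c x) = x"
    and "continuous_on (chart_dom c) (chart_map c)" "continuous_on (chart_img c) (chart_inv c)"
proof -
  have h: "homeomorphism (chart_dom c) (chart_img c) (chart_map c) (chart_inv c)"
    and o: "open (chart_dom c)" "open (chart_img c)"
    using assms by (auto simp: is_chart_def)
  show "open (chart_dom c)" "open (chart_img c)" by (fact o)+
  show "p \<in> chart_dom c \<Longrightarrow> chart_map c p \<in> chart_img c" by (simp add: chart_img_def)
  show "p \<in> chart_dom c \<Longrightarrow> chart_inv c (chart_map c p) = p" using homeomorphism_apply1[OF h] .
  show "x \<in> chart_img c \<Longrightarrow> chart_inv c x \<in> chart_dom c" using homeomorphism_image2[OF h] by blast
  show "x \<in> chart_img c \<Longrightarrow> chart_map c (chart_inv c x) = x" using homeomorphism_apply2[OF h] .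
  show "continuous_on (chart_dom c) (chart_map c)" "continuous_on (chart_img c) (chart_inv c)"
    using homeomorphism_cont1[OF h] homeomorphism_cont2[OF h] .
qed

lemma chart_image_Int:
  assumes "is_chart c"
  shows "chart_map c ` (chart_dom c \<inter> U) = {x \<in> chart_img c. chart_inv c x \<in> U}"
proof -
  have "x \<in> chart_map c ` (chart_dom c \<inter> U)" if "x \<in> chart_img c" "chart_inv c x \<in> U" for x
    using is_chartD(5,6)[OF assms that(1)] that(2) by (intro image_eqI[of _ _ "chart_inv c x"]) auto
  then show ?thesis using is_chartD(3,4)[OF assms] by auto
qed

lemma open_chart_image_Int:
  assumes "is_chart c" "open U" shows "open (chart_map c ` (chart_dom c \<inter> U))"
proof -
  have "chart_map c ` (chart_dom c \<inter> U) = chart_inv c -` U \<inter> chart_img c"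
    using chart_image_Int[OF assms(1)] by auto
  then show ?thesis
    using continuous_on_open_vimage[OF is_chartD(2)[OF assms(1)]] is_chartD(8)[OF assms(1)] assms(2) by metis
qed

lemma chart_image_UNIV: "chart_map c ` (chart_dom c \<inter> UNIV) = chart_img c"
  by (simp add: chart_img_def)

text \<open>Serves for the projections of a product and for the slice inclusions p -> (p, r), all of
  which are affine in product charts.\<close>

lemma smooth_near_pullback:
  fixes A :: "('m::topological_space, 'a::euclidean_space) chart set"
    and B :: "('n::topological_space, 'b::euclidean_space) chart set"
  assumes A: "\<And>c. c \<in> A \<Longrightarrow> is_chart c" and B: "\<And>c. c \<in> B \<Longrightarrow> is_chart c" and \<pi>: "continuous_on UNIV \<pi>"
    and affine: "\<And>c. c \<in> A \<Longrightarrow> \<exists>d\<in>B. \<exists>L k. bounded_linear L \<and>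
        (\<forall>x\<in>chart_img c. L x + k \<in> chart_img d \<and> \<pi> (chart_inv c x) = chart_inv d (L x + k))"
    and \<phi>: "smooth_near B (\<pi> p) \<phi>"
  shows "smooth_near A p (\<phi> \<circ> \<pi>)"
proof -
  obtain U where U: "open U" "\<pi> p \<in> U" and sm: "\<And>d. d \<in> B \<Longrightarrow> smooth_on (chart_map d ` (chart_dom d \<inter> U)) (\<phi> \<circ> chart_inv d)"
    using \<phi> unfolding smooth_near_def smooth_fun_on_def by blast
  have V: "open (\<pi> -` U)" using open_vimage[OF U(1) \<pi>] .
  show ?thesis
    unfolding smooth_near_def smooth_fun_on_def
  proof (intro exI conjI ballI)
    show "open (\<pi> -` U)" "p \<in> \<pi> -` U" using V U(2) by auto
    fix c assume c: "c \<in> A"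
    obtain d L k where d: "d \<in> B" "bounded_linear L"
      and L: "\<And>x. x \<in> chart_img c \<Longrightarrow> L x + k \<in> chart_img d \<and> \<pi> (chart_inv c x) = chart_inv d (L x + k)"
      using affine[OF c] by blast
    let ?S = "chart_map c ` (chart_dom c \<inter> \<pi> -` U)" and ?T = "chart_map d ` (chart_dom d \<inter> U)"
    have S: "open ?S" "open ?T" using open_chart_image_Int[OF A[OF c] V] open_chart_image_Int[OF B[OF d(1)] U(1)] .
    have "smooth_on ?S (\<lambda>x. (\<phi> \<circ> chart_inv d) (L x + k))"
      by (rule smooth_on_compose_affine[OF d(2) S _ sm[OF d(1)]])
        (use L in \<open>auto simp: chart_image_Int[OF A[OF c]] chart_image_Int[OF B[OF d(1)]]\<close>)
    then show "smooth_on ?S (\<phi> \<circ> \<pi> \<circ> chart_inv c)"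
      by (rule smooth_on_cong[OF S(1), rotated]) (use L in \<open>auto simp: chart_image_Int[OF A[OF c]]\<close>)
  qed
qed

lemma coords_zero: "coords c zero_tvec = 0"
  by (simp add: coords_def zero_tvec_def)

section \<open>Tangent vectors and their components in charts\<close>

locale atlas =
  fixes A :: "('m::{t2_space,second_countable_topology}, 'a::euclidean_space) chart set"
  assumes smooth_atlas: "smooth_atlas A"
begin

lemma is_chart: "c \<in> A \<Longrightarrow> is_chart c"
  using smooth_atlas by (simp add: smooth_atlas_def)

lemmas chartD = is_chartD[OF is_chart]

lemma cover: "\<exists>c\<in>A. p \<in> chart_dom c"
  using smooth_atlas unfolding smooth_atlas_def by blast

lemma smooth_transition:
  "c \<in> A \<Longrightarrow> d \<in> A \<Longrightarrow> smooth_on (chart_map c ` (chart_dom c \<inter> chart_dom d)) (chart_map d \<circ> chart_inv c)"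
  using smooth_atlas by (simp add: smooth_atlas_def)

lemma chart_at: "chart_at A p \<in> A" "p \<in> chart_dom (chart_at A p)"
  using someI_ex[of "\<lambda>c. c \<in> A \<and> p \<in> chart_dom c"] cover[of p] unfolding chart_at_def by blast+

lemma smooth_near_coordinate:
  assumes "c \<in> A" "p \<in> chart_dom c" shows "smooth_near A p (\<lambda>q. chart_map c q \<bullet> b)"
  unfolding smooth_near_def smooth_fun_on_def
proof (intro exI conjI ballI)
  show "open (chart_dom c)" "p \<in> chart_dom c" using chartD(1) assms by auto
  fix d assume d: "d \<in> A"
  show "smooth_on (chart_map d ` (chart_dom d \<inter> chart_dom c)) ((\<lambda>q. chart_map c q \<bullet> b) \<circ> chart_inv d)"
    using smooth_on_linear[OF bounded_linear_inner_left open_chart_image_Int[OF is_chart[OF d] chartD(1)[OF assms(1)]]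
      smooth_transition[OF d assms(1)]] by (simp add: o_def)
qed

lemma coords_coord_vec:
  assumes "c \<in> A" "p \<in> chart_dom c" shows "coords c (coord_vec A c p v) = v"
proof -
  have "dd ((\<lambda>q. chart_map c q \<bullet> b) \<circ> chart_inv c) (chart_map c p) = dd (\<lambda>x. x \<bullet> b) (chart_map c p)" for b
    by (rule dd_cong[OF chartD(2)[OF assms(1)] chartD(3)[OF assms]]) (simp add: chartD assms)
  moreover have "dd (\<lambda>x. x \<bullet> b) x = (\<lambda>v. v \<bullet> b)" for b x :: 'a
    by (rule dd_eqI) (intro has_derivative_inner_left has_derivative_ident)
  ultimately have "coord_vec A c p v (\<lambda>q. chart_map c q \<bullet> b) = v \<bullet> b" for b
    using smooth_near_coordinate[OF assms] by (simp add: coord_vec_def)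
  then show ?thesis by (simp add: coords_def euclidean_representation)
qed

lemma has_derivative_smooth_near:
  assumes "smooth_near A p \<phi>" "c \<in> A" "p \<in> chart_dom c"
  shows "(\<phi> \<circ> chart_inv c has_derivative dd (\<phi> \<circ> chart_inv c) (chart_map c p)) (at (chart_map c p))"
proof -
  obtain U where U: "open U" "p \<in> U" "smooth_on (chart_map c ` (chart_dom c \<inter> U)) (\<phi> \<circ> chart_inv c)"
    using assms unfolding smooth_near_def smooth_fun_on_def by blast
  show ?thesis
    by (rule smooth_on_has_derivative[OF U(3) open_chart_image_Int[OF is_chart[OF assms(2)] U(1)]])
      (use U(2) assms(3) in auto)
qed

lemma coord_vec_change:
  assumes c: "c \<in> A" "p \<in> chart_dom c" and d: "d \<in> A" "p \<in> chart_dom d"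
  shows "coord_vec A c p v = coord_vec A d p (dd (chart_map d \<circ> chart_inv c) (chart_map c p) v)"
proof
  fix \<phi>
  let ?S = "chart_map c ` (chart_dom c \<inter> chart_dom d)"
  have S: "open ?S" "chart_map c p \<in> ?S"
    using open_chart_image_Int[OF is_chart chartD(1)] c d by auto
  have t: "(chart_map d \<circ> chart_inv c has_derivative dd (chart_map d \<circ> chart_inv c) (chart_map c p)) (at (chart_map c p))"
    by (rule smooth_on_has_derivative[OF smooth_transition[OF c(1) d(1)] S])
  show "coord_vec A c p v \<phi> = coord_vec A d p (dd (chart_map d \<circ> chart_inv c) (chart_map c p) v) \<phi>"
  proof (cases "smooth_near A p \<phi>")
    case True
    have e: "(chart_map d \<circ> chart_inv c) (chart_map c p) = chart_map d p" using chartD(4)[OF c] by simp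
    have "dd (\<phi> \<circ> chart_inv c) (chart_map c p) = dd (\<lambda>x. (\<phi> \<circ> chart_inv d) ((chart_map d \<circ> chart_inv c) x)) (chart_map c p)"
      by (rule dd_cong[OF S]) (use chartD(4)[OF c(1)] chartD(4)[OF d(1)] in auto)
    also have "\<dots> = (\<lambda>v. dd (\<phi> \<circ> chart_inv d) (chart_map d p) (dd (chart_map d \<circ> chart_inv c) (chart_map c p) v))"
      using has_derivative_compose[OF t, of "\<phi> \<circ> chart_inv d"] has_derivative_smooth_near[OF True d] unfolding e
      by (intro dd_eqI) blast
    finally show ?thesis by (simp add: coord_vec_def)
  qed (simp add: coord_vec_def)
qed

lemma coord_vec_in_tangent_space: "c \<in> A \<Longrightarrow> p \<in> chart_dom c \<Longrightarrow> coord_vec A c p v \<in> tangent_space A p"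
  unfolding tangent_space_def by blast

lemma coord_vec_coords:
  assumes "u \<in> tangent_space A p" "c \<in> A" "p \<in> chart_dom c"
  shows "coord_vec A c p (coords c u) = u"
proof -
  obtain d v where "d \<in> A" "p \<in> chart_dom d" "u = coord_vec A d p v"
    using assms(1) unfolding tangent_space_def by blast
  then show ?thesis using coord_vec_change[of d p c v] coords_coord_vec[OF assms(2,3)] assms(2,3) by simp
qed

lemma coords_change:
  assumes "u \<in> tangent_space A p" "c \<in> A" "p \<in> chart_dom c" "d \<in> A" "p \<in> chart_dom d"
  shows "coords d u = dd (chart_map d \<circ> chart_inv c) (chart_map c p) (coords c u)"
  using coord_vec_coords[OF assms(1-3)] coord_vec_change[OF assms(2-5)] coords_coord_vec[OF assms(4,5)] by metis

lemma coord_vec_0: "c \<in> A \<Longrightarrow> p \<in> chart_dom c \<Longrightarrow> coord_vec A c p 0 = zero_tvec"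
  unfolding coord_vec_def zero_tvec_def
  using linear_0[OF has_derivative_linear[OF has_derivative_smooth_near]] by (auto simp: fun_eq_iff)

end

section \<open>Semi-Riemannian manifolds in charts\<close>

locale semi_riemannian_manifold =
  fixes A :: "('m::{t2_space,second_countable_topology}, 'a::euclidean_space) chart set" and g
  assumes semi_riemannian: "semi_riemannian A g"

sublocale semi_riemannian_manifold \<subseteq> atlas
  using semi_riemannian by unfold_locales (simp add: semi_riemannian_def)

context semi_riemannian_manifold
begin

lemma local_form_coords:
  assumes "c \<in> A" "p \<in> chart_dom c" "u \<in> tangent_space A p" "v \<in> tangent_space A p"
  shows "local_form A c g (chart_map c p) (coords c u) (coords c v) = g p u v"
  using coord_vec_coords assms by (simp add: local_form_def chartD)

lemma local_metric:
  assumes c: "c \<in> A" shows "local_metric (chart_img c) (local_form A c g)"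
proof
  show "open (chart_img c)" using chartD(2)[OF c] .
  fix v w
  show "smooth_on (chart_img c) (\<lambda>x. local_form A c g x v w)"
    using c semi_riemannian by (simp add: semi_riemannian_def)
  fix x assume x: "x \<in> chart_img c"
  define p where "p = chart_inv c x"
  have p: "p \<in> chart_dom c" and xp: "x = chart_map c p" using chartD[OF c] x by (auto simp: p_def)
  show "bilinear (local_form A c g x)"
    using c x semi_riemannian by (simp add: semi_riemannian_def)
  show "local_form A c g x v w = local_form A c g x w v"
    using semi_riemannian coord_vec_in_tangent_space[OF c p] by (simp add: semi_riemannian_def local_form_def p_def)
  show "v = 0" if 0: "\<And>w. local_form A c g x v w = 0"
  proof -
    have "g p (coord_vec A c p v) u = 0" if "u \<in> tangent_space A p" for u
      using 0[of "coords c u"] coord_vec_coords[OF that c p] by (simp add: local_form_def p_def)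
    then have "coord_vec A c p v = zero_tvec"
      using semi_riemannian coord_vec_in_tangent_space[OF c p] unfolding semi_riemannian_def by blast
    then show "v = 0" using coords_coord_vec[OF c p, of v] by (simp add: coords_zero)
  qed
qed

text \<open>Since g acts on tangent vectors without reference to a chart, the pullback identity is
  just the change of components of coordinate vectors.\<close>

lemma local_isometry_transition:
  assumes c: "c \<in> A" and d: "d \<in> A"
  shows "local_isometry (chart_map c ` (chart_dom c \<inter> chart_dom d)) (local_form A c g) (chart_img d) (local_form A d g)
    (chart_map d \<circ> chart_inv c)"
proof -
  let ?S = "chart_map c ` (chart_dom c \<inter> chart_dom d)"
  interpret C: local_metric "chart_img c" "local_form A c g" by (rule local_metric[OF c])
  interpret M: local_metric ?S "local_form A c g"
    by (rule C.local_metric_subset[OF open_chart_image_Int[OF is_chart[OF c] chartD(1)[OF d]]]) (auto simp: chart_img_def)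
  interpret N: local_metric "chart_img d" "local_form A d g" by (rule local_metric[OF d])
  show ?thesis
  proof
    show "smooth_on ?S (chart_map d \<circ> chart_inv c)" by (rule smooth_transition[OF c d])
    fix x v w assume "x \<in> ?S"
    then obtain p where p: "x = chart_map c p" "p \<in> chart_dom c" "p \<in> chart_dom d" by blast
    then show "(chart_map d \<circ> chart_inv c) x \<in> chart_img d" using chartD[OF c] chartD[OF d] by simp
    show "local_form A c g x v w = local_form A d g ((chart_map d \<circ> chart_inv c) x)
       (dd (chart_map d \<circ> chart_inv c) x v) (dd (chart_map d \<circ> chart_inv c) x w)"
      using p coord_vec_change[OF c p(2) d p(3)] chartD[OF c] chartD[OF d] by (simp add: local_form_def)
  qed
qed

section \<open>Values of the global tensors in an arbitrary chart around a point\<close>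

context
  fixes c p assumes c: "c \<in> A" and p: "p \<in> chart_dom c"
begin

interpretation I: local_isometry "chart_map c ` (chart_dom c \<inter> chart_dom (chart_at A p))" "local_form A c g"
  "chart_img (chart_at A p)" "local_form A (chart_at A p) g" "chart_map (chart_at A p) \<circ> chart_inv c"
  by (rule local_isometry_transition[OF c chart_at(1)])

lemma chart_point_in_overlap: "chart_map c p \<in> chart_map c ` (chart_dom c \<inter> chart_dom (chart_at A p))"
  using p chart_at(2) by blast

lemma ricci_in_chart:
  assumes "u \<in> tangent_space A p" "v \<in> tangent_space A p"
  shows "ricci A g p u v = local_ricci (local_form A c g) (chart_map c p) (coords c u) (coords c v)"
  using I.ricci_pullback[OF chart_point_in_overlap] chartD(4)[OF c p]
  by (simp add: ricci_def Let_def coords_change[OF _ c p chart_at] assms)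

lemma hessian_in_chart:
  assumes "smooth_fun A \<phi>" "u \<in> tangent_space A p" "v \<in> tangent_space A p"
  shows "hessian A g \<phi> p u v = local_hessian (local_form A c g) (\<phi> \<circ> chart_inv c) (chart_map c p) (coords c u) (coords c v)"
proof -
  have "smooth_on (chart_img (chart_at A p)) (\<phi> \<circ> chart_inv (chart_at A p))"
    using assms(1) chart_at(1)[of p] unfolding smooth_fun_on_def by (metis chart_image_UNIV)
  moreover have "(\<phi> \<circ> chart_inv c) y = (\<phi> \<circ> chart_inv (chart_at A p)) ((chart_map (chart_at A p) \<circ> chart_inv c) y)"
    if "y \<in> chart_map c ` (chart_dom c \<inter> chart_dom (chart_at A p))" for y
    using that chartD(4)[OF c] chartD(4)[OF chart_at(1)] by auto
  ultimately show ?thesis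
    using I.hessian_pullback[OF chart_point_in_overlap, of "\<phi> \<circ> chart_inv (chart_at A p)" "\<phi> \<circ> chart_inv c"] chartD(4)[OF c p]
    by (simp add: hessian_def Let_def coords_change[OF _ c p chart_at] assms)
qed

lemma lie_deriv_in_chart:
  assumes X: "smooth_vector_field A X" and "u \<in> tangent_space A p" "v \<in> tangent_space A p"
  shows "lie_deriv_metric A X g p u v = local_lie (local_form A c g) (local_field c X) (chart_map c p) (coords c u) (coords c v)"
proof -
  let ?d = "chart_at A p" and ?S = "chart_map c ` (chart_dom c \<inter> chart_dom (chart_at A p))"
  have "smooth_on (chart_img ?d) (local_field ?d X)" "smooth_on (chart_img c) (local_field c X)"
    using X chart_at(1) c by (auto simp: smooth_vector_field_def)
  moreover from this(2) have "smooth_on ?S (local_field c X)"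
    by (rule smooth_on_subset) (auto simp: chart_img_def)
  moreover have "local_field ?d X ((chart_map ?d \<circ> chart_inv c) y) = dd (chart_map ?d \<circ> chart_inv c) y (local_field c X y)"
    if "y \<in> ?S" for y
  proof -
    obtain r where r: "y = chart_map c r" "r \<in> chart_dom c" "r \<in> chart_dom ?d" using \<open>y \<in> ?S\<close> by blast
    have "X r \<in> tangent_space A r" using X by (simp add: smooth_vector_field_def)
    from coords_change[OF this c r(2) chart_at(1) r(3)] show ?thesis
      using r chartD(4)[OF c] chartD(4)[OF chart_at(1)] by (simp add: local_field_def)
  qed
  ultimately show ?thesis
    using I.lie_pullback[OF chart_point_in_overlap, of "local_field c X" "local_field ?d X"] chartD(4)[OF c p]
    by (simp add: lie_deriv_metric_def Let_def coords_change[OF _ c p chart_at] assms)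
qed

lemma killing_in_chart:
  assumes "killing A g X"
  shows "local_lie (local_form A c g) (local_field c X) (chart_map c p) v w = 0"
  using assms lie_deriv_in_chart[of X "coord_vec A c p v" "coord_vec A c p w"] coord_vec_in_tangent_space[OF c p]
  by (simp add: killing_def tensor2_eq_def coords_coord_vec c p)

end

text \<open>The chart may vary with the point: proportionality is first moved to the global tensors,
  \<mu> is then a pointwise choice, and its smoothness is recovered afterwards in every
  chart.\<close>

lemma einsteinI:
  assumes "\<And>p. \<exists>c\<in>A. p \<in> chart_dom c \<and> (\<exists>\<mu>. \<forall>v w. local_ricci (local_form A c g) (chart_map c p) v w
      = \<mu> * local_form A c g (chart_map c p) v w)"
  shows "einstein A g"
proof -
  have "\<exists>\<mu>. \<forall>u\<in>tangent_space A p. \<forall>v\<in>tangent_space A p. ricci A g p u v = \<mu> * g p u v" for p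
  proof -
    obtain c \<mu> where c: "c \<in> A" "p \<in> chart_dom c" and "\<And>v w. local_ricci (local_form A c g) (chart_map c p) v w
      = \<mu> * local_form A c g (chart_map c p) v w" using assms by metis
    then show ?thesis by (intro exI[of _ \<mu>]) (simp add: ricci_in_chart[OF c] local_form_coords)
  qed
  then obtain \<mu> where \<mu>: "\<And>p u v. u \<in> tangent_space A p \<Longrightarrow> v \<in> tangent_space A p \<Longrightarrow> ricci A g p u v = \<mu> p * g p u v"
    by metis
  have "smooth_on (chart_img c) (\<mu> \<circ> chart_inv c)" if c: "c \<in> A" for c
  proof -
    interpret C: local_metric "chart_img c" "local_form A c g" by (rule local_metric[OF c])
    have Ric: "local_ricci (local_form A c g) x v w = \<mu> (chart_inv c x) * local_form A c g x v w" if x: "x \<in> chart_img c" for x v w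
      using \<mu> ricci_in_chart[OF c chartD(5)[OF c x], of "coord_vec A c (chart_inv c x) v" "coord_vec A c (chart_inv c x) w"]
        coord_vec_in_tangent_space[OF c chartD(5)[OF c x]]
      by (simp add: coords_coord_vec c chartD x local_form_def)
    show ?thesis
    proof (rule smooth_on_local[OF C.open_S])
      fix x0 assume x0: "x0 \<in> chart_img c"
      \<comment> \<open>The model space has positive dimension, so v exists. A second vector w is
        taken from nondegeneracy because v may be null for an indefinite metric.\<close>
      obtain v :: 'a where "v \<noteq> 0" using nonempty_Basis nonzero_Basis by blast
      then obtain w where w: "local_form A c g x0 v w \<noteq> 0" using C.nondeg[OF x0] by blast
      define U where "U = {x \<in> chart_img c. local_form A c g x v w \<noteq> 0}"
      have "open U"
      proof -
        have "U = (\<lambda>x. local_form A c g x v w) -` (- {0}) \<inter> chart_img c" by (auto simp: U_def)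
        then show ?thesis using continuous_on_open_vimage[OF C.open_S]
          smooth_on_imp_continuous_on[OF C.smooth[of v w]] by (metis open_Compl closed_singleton)
      qed
      moreover have "x0 \<in> U" using x0 w by (simp add: U_def)
      moreover have "smooth_on U (\<mu> \<circ> chart_inv c)"
      proof (rule smooth_on_cong[OF \<open>open U\<close>])
        show "smooth_on U (\<lambda>x. local_ricci (local_form A c g) x v w * inverse (local_form A c g x v w))"
          by (intro smooth_on_mult smooth_on_inverse \<open>open U\<close> smooth_on_subset[OF C.smooth] smooth_on_subset[OF C.smooth_on_ricci])
            (auto simp: U_def)
        show "local_ricci (local_form A c g) x v w * inverse (local_form A c g x v w) = (\<mu> \<circ> chart_inv c) x" if "x \<in> U" for x
          using that Ric[of x v w] by (simp add: U_def)
      qed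
      ultimately show "\<exists>U. open U \<and> x0 \<in> U \<and> smooth_on U (\<mu> \<circ> chart_inv c)" by blast
    qed
  qed
  then show ?thesis
    unfolding einstein_def smooth_fun_on_def chart_image_UNIV tensor2_eq_def
    using semi_riemannian \<mu> by blast
qed

end

section \<open>Products of manifolds\<close>

lemma prod_chart_simps:
  "chart_dom (prod_chart c d) = chart_dom c \<times> chart_dom d"
  "chart_map (prod_chart c d) p = (chart_map c (fst p), chart_map d (snd p))"
  "chart_img (prod_chart c d) = chart_img c \<times> chart_img d"
  by (auto simp: prod_chart_def chart_img_def map_prod_def split_beta image_iff)

text \<open>\<open>chart_inv\<close> is an \<open>inv_into\<close>, hence arbitrary off the image,
  so the product formula is confined to the product of the chart images.\<close>

lemma chart_inv_prod:
  assumes "is_chart c" "is_chart d" "z \<in> chart_img c \<times> chart_img d"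
  shows "chart_inv (prod_chart c d) z = (chart_inv c (fst z), chart_inv d (snd z))"
  unfolding chart_inv_def[of "prod_chart c d"]
proof (rule inv_into_f_eq)
  show "inj_on (chart_map (prod_chart c d)) (chart_dom (prod_chart c d))"
    using is_chartD(4)[OF assms(1)] is_chartD(4)[OF assms(2)]
    by (intro inj_on_inverseI[of _ "\<lambda>z. (chart_inv c (fst z), chart_inv d (snd z))"]) (auto simp: prod_chart_simps)
qed (use is_chartD[OF assms(1)] is_chartD[OF assms(2)] assms(3) in \<open>auto simp: prod_chart_simps\<close>)

lemma is_chart_prod:
  assumes "is_chart c" "is_chart d" shows "is_chart (prod_chart c d)"
proof -
  note C = is_chartD[OF assms(1)] and D = is_chartD[OF assms(2)]
  have "homeomorphism (chart_dom c \<times> chart_dom d) (chart_img c \<times> chart_img d) (chart_map (prod_chart c d)) (chart_inv (prod_chart c d))"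
  proof (rule homeomorphismI)
    have "continuous_on (chart_dom c \<times> chart_dom d) (\<lambda>p. (chart_map c (fst p), chart_map d (snd p)))"
      by (intro continuous_on_Pair continuous_on_compose2[OF C(7)] continuous_on_compose2[OF D(7)] continuous_on_fst continuous_on_snd continuous_on_id) auto
    then show "continuous_on (chart_dom c \<times> chart_dom d) (chart_map (prod_chart c d))"
      by (simp add: prod_chart_simps[abs_def])
    have "continuous_on (chart_img c \<times> chart_img d) (\<lambda>p. (chart_inv c (fst p), chart_inv d (snd p)))"
      by (intro continuous_on_Pair continuous_on_compose2[OF C(8)] continuous_on_compose2[OF D(8)] continuous_on_fst continuous_on_snd continuous_on_id) auto
    then show "continuous_on (chart_img c \<times> chart_img d) (chart_inv (prod_chart c d))"
      by (rule continuous_on_eq) (simp add: chart_inv_prod[OF assms])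
  qed (use C D in \<open>auto simp: prod_chart_simps chart_inv_prod[OF assms]\<close>)
  then show ?thesis
    unfolding is_chart_def prod_chart_simps using C(1,2) D(1,2) by (simp add: open_Times)
qed

locale atlas_pair = A1: atlas A1 + A2: atlas A2
  for A1 :: "('m1::{t2_space,second_countable_topology}, 'a1::euclidean_space) chart set"
  and A2 :: "('m2::{t2_space,second_countable_topology}, 'a2::euclidean_space) chart set"
begin

abbreviation "A12 \<equiv> prod_atlas A1 A2"

lemma prod_atlas_cases:
  assumes "c \<in> A12" obtains c1 c2 where "c1 \<in> A1" "c2 \<in> A2" "c = prod_chart c1 c2"
  using assms unfolding prod_atlas_def by blast

lemma prod_atlasI: "c1 \<in> A1 \<Longrightarrow> c2 \<in> A2 \<Longrightarrow> prod_chart c1 c2 \<in> A12"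
  unfolding prod_atlas_def by blast

lemma inv_prod: "c1 \<in> A1 \<Longrightarrow> c2 \<in> A2 \<Longrightarrow> z \<in> chart_img c1 \<times> chart_img c2 \<Longrightarrow>
   chart_inv (prod_chart c1 c2) z = (chart_inv c1 (fst z), chart_inv c2 (snd z))"
  by (rule chart_inv_prod[OF A1.is_chart A2.is_chart])

lemma prod_chart_image_Times:
  "chart_map (prod_chart c1 c2) ` (chart_dom (prod_chart c1 c2) \<inter> (U \<times> V))
   = (chart_map c1 ` (chart_dom c1 \<inter> U)) \<times> (chart_map c2 ` (chart_dom c2 \<inter> V))"
proof -
  have "chart_dom (prod_chart c1 c2) \<inter> (U \<times> V) = (chart_dom c1 \<inter> U) \<times> (chart_dom c2 \<inter> V)"
    by (auto simp: prod_chart_simps)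
  then show ?thesis by (simp add: prod_chart_def map_prod_surj_on)
qed

sublocale atlas A12
proof
  show "smooth_atlas A12"
    unfolding smooth_atlas_def
  proof (intro conjI ballI)
    show "is_chart c" if "c \<in> A12" for c
      using that is_chart_prod A1.is_chart A2.is_chart by (auto elim!: prod_atlas_cases)
    have "\<exists>c\<in>A12. p \<in> chart_dom c" for p
    proof -
      obtain c1 c2 where "c1 \<in> A1" "fst p \<in> chart_dom c1" "c2 \<in> A2" "snd p \<in> chart_dom c2"
        using A1.cover A2.cover by blast
      then show ?thesis by (intro bexI[OF _ prod_atlasI]) (auto simp: prod_chart_simps mem_Times_iff)
    qed
    then show "(\<Union>c\<in>A12. chart_dom c) = UNIV" by blast
    fix c d assume "c \<in> A12" "d \<in> A12"
    then obtain c1 c2 d1 d2 where c: "c1 \<in> A1" "c2 \<in> A2" "c = prod_chart c1 c2"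
      and d: "d1 \<in> A1" "d2 \<in> A2" "d = prod_chart d1 d2" by (metis prod_atlas_cases)
    let ?S1 = "chart_map c1 ` (chart_dom c1 \<inter> chart_dom d1)" and ?S2 = "chart_map c2 ` (chart_dom c2 \<inter> chart_dom d2)"
    have S: "open ?S1" "open ?S2"
      using open_chart_image_Int[OF A1.is_chart A1.chartD(1)] open_chart_image_Int[OF A2.is_chart A2.chartD(1)] c d by auto
    have im: "chart_map c ` (chart_dom c \<inter> chart_dom d) = ?S1 \<times> ?S2"
      unfolding c(3) using prod_chart_image_Times[of c1 c2 "chart_dom d1" "chart_dom d2"] by (simp add: d(3) prod_chart_simps(1))
    have "smooth_on (?S1 \<times> ?S2) (\<lambda>z. ((chart_map d1 \<circ> chart_inv c1) (fst z), (chart_map d2 \<circ> chart_inv c2) (snd z)))"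
      by (intro smooth_on_Pair smooth_on_compose_fst smooth_on_compose_snd open_Times S A1.smooth_transition A2.smooth_transition c d)
    then show "smooth_on (chart_map c ` (chart_dom c \<inter> chart_dom d)) (chart_map d \<circ> chart_inv c)"
      unfolding im
    proof (rule smooth_on_cong[OF open_Times[OF S], rotated])
      fix z assume z: "z \<in> ?S1 \<times> ?S2"
      then have "z \<in> chart_img c1 \<times> chart_img c2" by (auto simp: chart_img_def)
      then show "((chart_map d1 \<circ> chart_inv c1) (fst z), (chart_map d2 \<circ> chart_inv c2) (snd z)) = (chart_map d \<circ> chart_inv c) z"
        using c d by (simp add: inv_prod prod_chart_simps)
    qed
  qed
qed

text \<open>Both directions matter, because \<open>coord_vec\<close> is 0 on functions that are not
  smooth near the point: without the equivalence the push-forward of a coordinate vector could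
  differ from a coordinate vector on such functions. The converse restricts to the slice through
  r.\<close>

lemma smooth_near_fst: "smooth_near A12 (p, r) (\<phi> \<circ> fst) \<longleftrightarrow> smooth_near A1 p \<phi>"
proof
  assume "smooth_near A1 p \<phi>"
  show "smooth_near A12 (p, r) (\<phi> \<circ> fst)"
  proof (rule smooth_near_pullback[OF is_chart A1.is_chart])
    fix c assume "c \<in> A12"
    then obtain c1 c2 where c: "c1 \<in> A1" "c2 \<in> A2" "c = prod_chart c1 c2" by (rule prod_atlas_cases)
    then show "\<exists>d\<in>A1. \<exists>L k. bounded_linear L \<and> (\<forall>x\<in>chart_img c. L x + k \<in> chart_img d \<and> fst (chart_inv c x) = chart_inv d (L x + k))"
      by (intro bexI[of _ c1] exI[of _ fst] exI[of _ 0]) (auto simp: prod_chart_simps inv_prod bounded_linear_fst)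
  qed (use \<open>smooth_near A1 p \<phi>\<close> in \<open>auto intro: continuous_on_fst continuous_on_id\<close>)
next
  assume *: "smooth_near A12 (p, r) (\<phi> \<circ> fst)"
  obtain c2 where c2: "c2 \<in> A2" "r \<in> chart_dom c2" using A2.cover by blast
  have "smooth_near A1 p ((\<phi> \<circ> fst) \<circ> (\<lambda>p. (p, r)))"
  proof (rule smooth_near_pullback[OF A1.is_chart is_chart])
    fix c assume "c \<in> A1"
    moreover have "bounded_linear (\<lambda>x::'a1. (x, 0::'a2))"
      by (intro bounded_linear_Pair bounded_linear_ident bounded_linear_zero)
    ultimately show "\<exists>d\<in>A12. \<exists>L k. bounded_linear L \<and> (\<forall>x\<in>chart_img c. L x + k \<in> chart_img d \<and> (chart_inv c x, r) = chart_inv d (L x + k))"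
      by (intro bexI[of _ "prod_chart c c2"] exI[of _ "\<lambda>x. (x, 0)"] exI[of _ "(0, chart_map c2 r)"])
        (auto simp: prod_chart_simps inv_prod A2.chartD c2 prod_atlasI)
  qed (use * in \<open>auto intro: continuous_on_Pair continuous_on_const continuous_on_id\<close>)
  then show "smooth_near A1 p \<phi>" by (simp add: o_def)
qed

lemma smooth_near_snd: "smooth_near A12 (p, r) (\<phi> \<circ> snd) \<longleftrightarrow> smooth_near A2 r \<phi>"
proof
  assume "smooth_near A2 r \<phi>"
  show "smooth_near A12 (p, r) (\<phi> \<circ> snd)"
  proof (rule smooth_near_pullback[OF is_chart A2.is_chart])
    fix c assume "c \<in> A12"
    then obtain c1 c2 where c: "c1 \<in> A1" "c2 \<in> A2" "c = prod_chart c1 c2" by (rule prod_atlas_cases)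
    then show "\<exists>d\<in>A2. \<exists>L k. bounded_linear L \<and> (\<forall>x\<in>chart_img c. L x + k \<in> chart_img d \<and> snd (chart_inv c x) = chart_inv d (L x + k))"
      by (intro bexI[of _ c2] exI[of _ snd] exI[of _ 0]) (auto simp: prod_chart_simps inv_prod bounded_linear_snd)
  qed (use \<open>smooth_near A2 r \<phi>\<close> in \<open>auto intro: continuous_on_snd continuous_on_id\<close>)
next
  assume *: "smooth_near A12 (p, r) (\<phi> \<circ> snd)"
  obtain c1 where c1: "c1 \<in> A1" "p \<in> chart_dom c1" using A1.cover by blast
  have "smooth_near A2 r ((\<phi> \<circ> snd) \<circ> (\<lambda>r. (p, r)))"
  proof (rule smooth_near_pullback[OF A2.is_chart is_chart])
    fix c assume "c \<in> A2"
    moreover have "bounded_linear (\<lambda>x::'a2. (0::'a1, x))"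
      by (intro bounded_linear_Pair bounded_linear_ident bounded_linear_zero)
    ultimately show "\<exists>d\<in>A12. \<exists>L k. bounded_linear L \<and> (\<forall>x\<in>chart_img c. L x + k \<in> chart_img d \<and> (p, chart_inv c x) = chart_inv d (L x + k))"
      by (intro bexI[of _ "prod_chart c1 c"] exI[of _ "\<lambda>x. (0, x)"] exI[of _ "(chart_map c1 p, 0)"])
        (auto simp: prod_chart_simps inv_prod A1.chartD c1 prod_atlasI)
  qed (use * in \<open>auto intro: continuous_on_Pair continuous_on_const continuous_on_id\<close>)
  then show "smooth_near A2 r \<phi>" by (simp add: o_def)
qed

lemma push_fst_coord_vec:
  assumes c: "c1 \<in> A1" "c2 \<in> A2" and p: "p \<in> chart_dom c1" "r \<in> chart_dom c2"
  shows "push fst (coord_vec A12 (prod_chart c1 c2) (p, r) v) = coord_vec A1 c1 p (fst v)"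
proof
  fix \<phi>
  let ?z = "(chart_map c1 p, chart_map c2 r)"
  have z: "?z \<in> chart_img c1 \<times> chart_img c2" using A1.chartD(3) A2.chartD(3) c p by auto
  have S: "open (chart_img c1 \<times> chart_img c2)" using A1.chartD(2) A2.chartD(2) c by (simp add: open_Times)
  have "dd ((\<phi> \<circ> fst) \<circ> chart_inv (prod_chart c1 c2)) ?z v = dd (\<phi> \<circ> chart_inv c1) (chart_map c1 p) (fst v)"
    if "smooth_near A1 p \<phi>"
  proof -
    have "dd ((\<phi> \<circ> fst) \<circ> chart_inv (prod_chart c1 c2)) ?z = dd (\<lambda>z. (\<phi> \<circ> chart_inv c1) (fst z)) ?z"
      by (rule dd_cong[OF S z]) (simp add: inv_prod c mem_Times_iff)
    then show ?thesis
      using dd_compose_fst[of "\<phi> \<circ> chart_inv c1" ?z] A1.has_derivative_smooth_near[OF that c(1) p(1)] by simp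
  qed
  then show "push fst (coord_vec A12 (prod_chart c1 c2) (p, r) v) \<phi> = coord_vec A1 c1 p (fst v) \<phi>"
    by (simp add: push_def coord_vec_def smooth_near_fst prod_chart_simps)
qed

lemma push_snd_coord_vec:
  assumes c: "c1 \<in> A1" "c2 \<in> A2" and p: "p \<in> chart_dom c1" "r \<in> chart_dom c2"
  shows "push snd (coord_vec A12 (prod_chart c1 c2) (p, r) v) = coord_vec A2 c2 r (snd v)"
proof
  fix \<phi>
  let ?z = "(chart_map c1 p, chart_map c2 r)"
  have z: "?z \<in> chart_img c1 \<times> chart_img c2" using A1.chartD(3) A2.chartD(3) c p by auto
  have S: "open (chart_img c1 \<times> chart_img c2)" using A1.chartD(2) A2.chartD(2) c by (simp add: open_Times)
  have "dd ((\<phi> \<circ> snd) \<circ> chart_inv (prod_chart c1 c2)) ?z v = dd (\<phi> \<circ> chart_inv c2) (chart_map c2 r) (snd v)"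
    if "smooth_near A2 r \<phi>"
  proof -
    have "dd ((\<phi> \<circ> snd) \<circ> chart_inv (prod_chart c1 c2)) ?z = dd (\<lambda>z. (\<phi> \<circ> chart_inv c2) (snd z)) ?z"
      by (rule dd_cong[OF S z]) (simp add: inv_prod c mem_Times_iff)
    then show ?thesis
      using dd_compose_snd[of "\<phi> \<circ> chart_inv c2" ?z] A2.has_derivative_smooth_near[OF that c(2) p(2)] by simp
  qed
  then show "push snd (coord_vec A12 (prod_chart c1 c2) (p, r) v) \<phi> = coord_vec A2 c2 r (snd v) \<phi>"
    by (simp add: push_def coord_vec_def smooth_near_snd prod_chart_simps)
qed

lemma coords_prod:
  assumes c: "c1 \<in> A1" "c2 \<in> A2" and p: "fst p \<in> chart_dom c1" "snd p \<in> chart_dom c2" and u: "u \<in> tangent_space A12 p"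
  shows "coords (prod_chart c1 c2) u = (coords c1 (push fst u), coords c2 (push snd u))"
proof -
  define v where "v = coords (prod_chart c1 c2) u"
  have "coord_vec A12 (prod_chart c1 c2) (fst p, snd p) v = u"
    using coord_vec_coords[OF u prod_atlasI[OF c]] p by (simp add: v_def prod_chart_simps mem_Times_iff)
  then have "push fst u = coord_vec A1 c1 (fst p) (fst v)" "push snd u = coord_vec A2 c2 (snd p) (snd v)"
    using push_fst_coord_vec[OF c p] push_snd_coord_vec[OF c p] by metis+
  then show ?thesis
    using A1.coords_coord_vec[OF c(1) p(1)] A2.coords_coord_vec[OF c(2) p(2)] by (simp add: v_def)
qed

lemma push_fst_tangent:
  assumes u: "u \<in> tangent_space A12 p"
  shows "push fst u \<in> tangent_space A1 (fst p)"
proof -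
  obtain c v where c: "c \<in> A12" "p \<in> chart_dom c" "u = coord_vec A12 c p v" using u unfolding tangent_space_def by blast
  then obtain c1 c2 where "c1 \<in> A1" "c2 \<in> A2" "c = prod_chart c1 c2" by (metis prod_atlas_cases)
  then show ?thesis
    using c push_fst_coord_vec[of c1 c2 "fst p" "snd p" v] A1.coord_vec_in_tangent_space[of c1 "fst p"]
    by (auto simp: prod_chart_simps)
qed

lemma local_form_prod:
  assumes c: "c1 \<in> A1" "c2 \<in> A2" and z: "z \<in> chart_img c1 \<times> chart_img c2"
  shows "local_form A12 (prod_chart c1 c2) (warped_metric g1 f g2) z
    = warp (local_form A1 c1 g1) (f \<circ> chart_inv c1) (local_form A2 c2 g2) z"
proof -
  have "chart_inv c1 (fst z) \<in> chart_dom c1" "chart_inv c2 (snd z) \<in> chart_dom c2"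
    using z A1.chartD(5) A2.chartD(5) c by auto
  then show ?thesis
    using c z by (simp add: fun_eq_iff local_form_def warped_metric_def warp_def inv_prod push_fst_coord_vec push_snd_coord_vec)
qed

lemma local_field_prod:
  assumes c: "c1 \<in> A1" "c2 \<in> A2" and z: "z \<in> chart_img c1 \<times> chart_img c2"
    and X: "\<And>p. X p \<in> tangent_space A12 p"
  defines "p \<equiv> (chart_inv c1 (fst z), chart_inv c2 (snd z))"
  shows "local_field (prod_chart c1 c2) X z = (coords c1 (push fst (X p)), coords c2 (push snd (X p)))"
proof -
  have "fst p \<in> chart_dom c1" "snd p \<in> chart_dom c2"
    using z A1.chartD(5) A2.chartD(5) c by (auto simp: p_def)
  from coords_prod[OF c this X] show ?thesis
    using c z by (simp add: local_field_def inv_prod p_def)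
qed

end

section \<open>Warped products of semi-Riemannian manifolds\<close>

locale warped_product =
  M1: semi_riemannian_manifold A1 g1 + M2: semi_riemannian_manifold A2 g2
  for A1 :: "('m1::{t2_space,second_countable_topology}, 'a1::euclidean_space) chart set" and g1
  and A2 :: "('m2::{t2_space,second_countable_topology}, 'a2::euclidean_space) chart set" and g2 +
  fixes f :: "'m1 \<Rightarrow> real"
  assumes smooth_f: "smooth_fun A1 f" and pos_f: "f p > 0"
begin

sublocale atlas_pair A1 A2 ..

abbreviation "gw \<equiv> warped_metric g1 f g2"

lemma local_warped:
  assumes c: "c1 \<in> A1" "c2 \<in> A2"
  shows "local_warped (chart_img c1) (local_form A1 c1 g1) (chart_img c2) (local_form A2 c2 g2) (f \<circ> chart_inv c1)"
  using M1.local_metric[OF c(1)] M2.local_metric[OF c(2)] smooth_f pos_f c(1)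
  unfolding local_warped_def local_warped_axioms_def smooth_fun_on_def chart_image_UNIV by simp

lemma local_metric_prod:
  assumes c: "c1 \<in> A1" "c2 \<in> A2"
  shows "local_metric (chart_img c1 \<times> chart_img c2) (local_form A12 (prod_chart c1 c2) gw)"
proof -
  interpret w: local_warped "chart_img c1" "local_form A1 c1 g1" "chart_img c2" "local_form A2 c2 g2" "f \<circ> chart_inv c1"
    by (rule local_warped[OF c])
  note eq = local_form_prod[OF c]
  show ?thesis
  proof
    show "smooth_on (chart_img c1 \<times> chart_img c2) (\<lambda>z. local_form A12 (prod_chart c1 c2) gw z v w)" for v w
      by (rule smooth_on_cong[OF w.W.open_S _ w.W.smooth]) (simp add: eq)
    fix z v assume z: "z \<in> chart_img c1 \<times> chart_img c2"
    show "v = 0" if "\<And>w. local_form A12 (prod_chart c1 c2) gw z v w = 0"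
      using w.W.nondeg[OF z] that by (simp add: eq z)
  qed (simp_all add: eq w.W.open_S w.W.bil w.W.sym)
qed

text \<open>This makes the construction iterable, the inner product becoming the base of the outer
  one. The metric axioms are read off from the coordinate form in a product chart.\<close>

sublocale M: semi_riemannian_manifold A12 gw
proof
  have rep: "\<exists>c1 c2. c1 \<in> A1 \<and> c2 \<in> A2 \<and> p \<in> chart_dom (prod_chart c1 c2)" for p
    using cover[of p] by (metis prod_atlas_cases)
  have val: "gw p u v = local_form A12 c gw (chart_map c p) (coords c u) (coords c v)"
    if "c \<in> A12" "p \<in> chart_dom c" "u \<in> tangent_space A12 p" "v \<in> tangent_space A12 p" for c p u v
    using that coord_vec_coords[of _ p c] by (simp add: local_form_def chartD)
  show "semi_riemannian A12 gw"
    unfolding semi_riemannian_def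
  proof (intro conjI ballI allI impI)
    show "smooth_atlas A12" by (rule smooth_atlas)
    fix c assume "c \<in> A12"
    then obtain c1 c2 where c: "c1 \<in> A1" "c2 \<in> A2" "c = prod_chart c1 c2" by (rule prod_atlas_cases)
    interpret local_metric "chart_img c" "local_form A12 c gw"
      using local_metric_prod[OF c(1,2)] by (simp add: c(3) prod_chart_simps)
    show "smooth_on (chart_img c) (\<lambda>x. local_form A12 c gw x v w)" for v w by (rule smooth)
    show "bilinear (local_form A12 c gw x)" if "x \<in> chart_img c" for x using bil[OF that] .
  next
    fix p u
    obtain c1 c2 where c: "c1 \<in> A1" "c2 \<in> A2" and p: "p \<in> chart_dom (prod_chart c1 c2)"
      using rep by blast
    let ?c = "prod_chart c1 c2"
    have cA: "?c \<in> A12" by (rule prod_atlasI[OF c])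
    interpret local_metric "chart_img ?c" "local_form A12 ?c gw"
      using local_metric_prod[OF c] by (simp add: prod_chart_simps)
    note x = chartD(3)[OF cA p]
    assume u: "u \<in> tangent_space A12 p"
    show "gw p u v = gw p v u" if "v \<in> tangent_space A12 p" for v
      unfolding val[OF cA p u that] val[OF cA p that u] by (rule sym[OF x])
    show "u = zero_tvec" if 0: "\<forall>v\<in>tangent_space A12 p. gw p u v = 0"
    proof -
      have "local_form A12 ?c gw (chart_map ?c p) (coords ?c u) w = 0" for w
        using 0 val[OF cA p u coord_vec_in_tangent_space[OF cA p]] coord_vec_in_tangent_space[OF cA p]
        by (simp add: coords_coord_vec cA p)
      then have "coords ?c u = 0" by (rule nondeg[OF x])
      then show ?thesis using coord_vec_coords[OF u cA p] coord_vec_0[OF cA p] by simp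
    qed
  qed
qed

end

text \<open>The lift of a field on one factor projects to zero on the other two. The disjunction
  lets all three factors be treated alike, whichever of them carries the Killing field.\<close>

lemma (in semi_riemannian_manifold) killing_or_zero_in_chart:
  assumes c: "c \<in> A" "p \<in> chart_dom c" and X: "killing A g X \<or> X = (\<lambda>_. zero_tvec)"
  shows "smooth_on (chart_img c) (local_field c X)"
    and "local_lie (local_form A c g) (local_field c X) (chart_map c p) v w = 0"
proof -
  interpret C: local_metric "chart_img c" "local_form A c g" by (rule local_metric[OF c(1)])
  have "smooth_on (chart_img c) (local_field c X)
    \<and> local_lie (local_form A c g) (local_field c X) (chart_map c p) v w = 0"
  proof (cases "killing A g X")
    case True
    then show ?thesis using c killing_in_chart[OF c] by (simp add: killing_def smooth_vector_field_def)
  next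
    case False
    then have "local_field c X = (\<lambda>_. 0)" using X by (intro ext) (simp add: local_field_def coords_zero)
    moreover have "local_lie (local_form A c g) (\<lambda>_. 0) (chart_map c p) v w = 0"
      using C.local_lie_eq[of "chart_map c p" "\<lambda>_. 0"] chartD(3)[OF c] linear_0[OF C.linear_dG]
      by (simp add: C.G_simps linear_zero module_hom_zero)
    ultimately show ?thesis by (simp add: smooth_on_const)
  qed
  then show "smooth_on (chart_img c) (local_field c X)"
    "local_lie (local_form A c g) (local_field c X) (chart_map c p) v w = 0" by auto
qed

theorem theorem3p3:
  fixes A1 :: "('m1::{t2_space,second_countable_topology}, 'a1::euclidean_space) chart set"
    and A2 :: "('m2::{t2_space,second_countable_topology}, 'a2::euclidean_space) chart set"
    and A3 :: "('m3::{t2_space,second_countable_topology}, 'a3::euclidean_space) chart set"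
    and g1 :: "'m1 tensor2" and g2 :: "'m2 tensor2" and g3 :: "'m3 tensor2"
    and f :: "'m1 \<Rightarrow> real" and h :: "'m1 \<times> 'm2 \<Rightarrow> real"
    and Abar :: "('m1 \<times> 'm2, 'a1 \<times> 'a2) chart set"
    and gbar :: "('m1 \<times> 'm2) tensor2"
    and A :: "(('m1 \<times> 'm2) \<times> 'm3, ('a1 \<times> 'a2) \<times> 'a3) chart set"
    and g :: "(('m1 \<times> 'm2) \<times> 'm3) tensor2"
    and X :: "('m1 \<times> 'm2) \<times> 'm3 \<Rightarrow> (('m1 \<times> 'm2) \<times> 'm3) tvec"
    and lam rho :: real
    and \<sigma> :: "('m1 \<times> 'm2) \<times> 'm3 \<Rightarrow> real" and \<psi> :: "'m1 \<times> 'm2 \<Rightarrow> real"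
  defines "Abar \<equiv> prod_atlas A1 A2" and "gbar \<equiv> warped_metric g1 f g2"
    and "A \<equiv> prod_atlas Abar A3" and "g \<equiv> warped_metric gbar h g3"
  assumes "semi_riemannian A1 g1" and "semi_riemannian A2 g2" and "semi_riemannian A3 g3"
    and "smooth_fun A1 f" and "\<And>p. f p > 0"
    and "smooth_fun Abar h" and "\<And>p. h p > 0"
    and soliton: "ricci_bourguignon_soliton A g X lam rho"
    and "smooth_fun A \<sigma>"
    and "tensor2_eq A (hessian A g (\<lambda>p. f (fst (fst p)))) (\<lambda>p u v. \<sigma> p * g p u v)"
    and "smooth_fun Abar \<psi>"
    and "tensor2_eq Abar (hessian Abar gbar h) (\<lambda>p u v. \<psi> p * gbar p u v)"
    and "(\<exists>X1. smooth_vector_field A1 X1 \<and> is_lift1 X1 X \<and> killing A1 g1 X1)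
       \<or> (\<exists>X2. smooth_vector_field A2 X2 \<and> is_lift2 X2 X \<and> killing A2 g2 X2)
       \<or> (\<exists>X3. smooth_vector_field A3 X3 \<and> is_lift3 X3 X \<and> killing A3 g3 X3)"
  shows "einstein A1 g1 \<and> einstein A2 g2 \<and> einstein A3 g3"
proof -
  interpret w12: warped_product A1 g1 A2 g2 f by unfold_locales fact+
  \<comment> \<open>The base is the inner warped product, whose semi-Riemannian structure is
    provided by the sublocale \<open>M\<close> of \<open>w12\<close>.\<close>
  interpret w: warped_product Abar gbar A3 g3 h
    unfolding Abar_def gbar_def
    by unfold_locales (use assms in \<open>auto simp: Abar_def\<close>)
  \<comment> \<open>The three alternatives merge here: one of the fields is the given Killing field
    and the other two are zero.\<close>
  obtain Z1 Z2 Z3 where Z: "killing A1 g1 Z1 \<or> Z1 = (\<lambda>_. zero_tvec)" "killing A2 g2 Z2 \<or> Z2 = (\<lambda>_. zero_tvec)"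
      "killing A3 g3 Z3 \<or> Z3 = (\<lambda>_. zero_tvec)"
    and lift: "\<And>p. push (fst \<circ> fst) (X p) = Z1 (fst (fst p))" "\<And>p. push (snd \<circ> fst) (X p) = Z2 (snd (fst p))"
      "\<And>p. push snd (X p) = Z3 (snd p)"
  proof -
    let ?z = "\<lambda>_. zero_tvec"
    from assms(17) consider
        X1 where "is_lift1 X1 X" "killing A1 g1 X1"
      | X2 where "is_lift2 X2 X" "killing A2 g2 X2"
      | X3 where "is_lift3 X3 X" "killing A3 g3 X3" by blast
    then show ?thesis
    proof cases
      case 1 then show ?thesis by (intro that[of X1 ?z ?z]) (auto simp: is_lift1_def)
    next
      case 2 then show ?thesis by (intro that[of ?z X2 ?z]) (auto simp: is_lift2_def)
    next
      case 3 then show ?thesis by (intro that[of ?z ?z X3]) (auto simp: is_lift3_def)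
    qed
  qed
  have sX: "smooth_vector_field A X" using soliton by (simp add: ricci_bourguignon_soliton_def)
  \<comment> \<open>One chart of M yields charts of all three factors. To treat a point of one
    factor, the points of the other two are chosen arbitrarily.\<close>
  have key: "\<exists>c1\<in>A1. \<exists>c2\<in>A2. \<exists>c3\<in>A3. p1 \<in> chart_dom c1 \<and> p2 \<in> chart_dom c2 \<and> p3 \<in> chart_dom c3
     \<and> (\<exists>\<mu>. \<forall>v w. local_ricci (local_form A1 c1 g1) (chart_map c1 p1) v w = \<mu> * local_form A1 c1 g1 (chart_map c1 p1) v w)
     \<and> (\<exists>\<mu>. \<forall>v w. local_ricci (local_form A2 c2 g2) (chart_map c2 p2) v w = \<mu> * local_form A2 c2 g2 (chart_map c2 p2) v w)
     \<and> (\<exists>\<mu>. \<forall>v w. local_ricci (local_form A3 c3 g3) (chart_map c3 p3) v w = \<mu> * local_form A3 c3 g3 (chart_map c3 p3) v w)"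
    for p1 p2 p3
  proof -
    let ?p = "((p1, p2), p3)"
    \<comment> \<open>With this choice the tensors on M unfold in c directly. The charts of the
      factors and of the base that c is made of need not be the ones \<open>chart_at\<close> picks
      there, and invariance bridges that gap.\<close>
    define c where "c = chart_at A ?p"
    have cA: "c \<in> A" and cp: "?p \<in> chart_dom c" using w.chart_at unfolding c_def A_def by auto
    obtain cb c3 where cb: "cb \<in> Abar" and c3: "c3 \<in> A3" and c_eq: "c = prod_chart cb c3"
      using cA unfolding A_def by (rule w.prod_atlas_cases)
    obtain c1 c2 where c1: "c1 \<in> A1" and c2: "c2 \<in> A2" and cb_eq: "cb = prod_chart c1 c2"
      using cb unfolding Abar_def by (rule w12.prod_atlas_cases)
    have p: "p1 \<in> chart_dom c1" "p2 \<in> chart_dom c2" "p3 \<in> chart_dom c3" and pb: "(p1, p2) \<in> chart_dom cb"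
      using cp by (auto simp: c_eq cb_eq prod_chart_simps)
    let ?G1 = "local_form A1 c1 g1" and ?G2 = "local_form A2 c2 g2" and ?G3 = "local_form A3 c3 g3"
    let ?F = "f \<circ> chart_inv c1" and ?H = "h \<circ> chart_inv cb"
    let ?Gb = "local_form Abar cb gbar" and ?G = "local_form A c g"
    let ?S1 = "chart_img c1" and ?S2 = "chart_img c2" and ?S3 = "chart_img c3"
    let ?Wb = "warp ?G1 ?F ?G2"
    let ?W = "warp ?Wb ?H ?G3"
    let ?x1 = "chart_map c1 p1" and ?x2 = "chart_map c2 p2" and ?x3 = "chart_map c3 p3"
    let ?x = "((?x1, ?x2), ?x3)"
    have img: "chart_img cb = ?S1 \<times> ?S2" "chart_img c = (?S1 \<times> ?S2) \<times> ?S3"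
      and mp: "chart_map cb (p1, p2) = (?x1, ?x2)" "chart_map c ?p = ?x"
      by (simp_all add: c_eq cb_eq prod_chart_simps)
    have x: "?x1 \<in> ?S1" "?x2 \<in> ?S2" "?x3 \<in> ?S3"
      using w12.M1.chartD(3)[OF c1 p(1)] w12.M2.chartD(3)[OF c2 p(2)] w.M2.chartD(3)[OF c3 p(3)] .
    then have xS: "?x \<in> (?S1 \<times> ?S2) \<times> ?S3" and xb: "(?x1, ?x2) \<in> ?S1 \<times> ?S2" by auto
    have Gb: "?Gb z v w = ?Wb z v w" if "z \<in> ?S1 \<times> ?S2" for z v w
      using w12.local_form_prod[OF c1 c2 that] unfolding Abar_def gbar_def cb_eq by simp
    have G: "?G z v w = ?W z v w" if "z \<in> (?S1 \<times> ?S2) \<times> ?S3" for z v w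
    proof -
      have "fst z \<in> ?S1 \<times> ?S2" using that by auto
      moreover have "?G z = warp ?Gb ?H ?G3 z"
        using w.local_form_prod[OF cb c3] that unfolding A_def g_def c_eq img by blast
      ultimately show ?thesis
        unfolding warp_def[of ?Wb] by (simp add: warp_def[of ?Gb] Gb)
    qed
    have lw12: "local_warped ?S1 ?G1 ?S2 ?G2 ?F" by (rule w12.local_warped[OF c1 c2])
    interpret lb: local_warped ?S1 ?G1 ?S2 ?G2 ?F by (rule lw12)
    have lw123: "local_warped (?S1 \<times> ?S2) ?Wb ?S3 ?G3 ?H"
      using w.local_warped[OF cb c3] lb.W.local_metric_axioms unfolding local_warped_def img by blast
    interpret l: local_warped "?S1 \<times> ?S2" ?Wb ?S3 ?G3 ?H by (rule lw123)
    interpret M: semi_riemannian_manifold A g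
      unfolding A_def g_def by (rule w.M.semi_riemannian_manifold_axioms)
    \<comment> \<open>Exchanges the coordinate form of g for the nested \<open>warp\<close>, to
      which the warped product formulas apply.\<close>
    interpret I: local_isometry "(?S1 \<times> ?S2) \<times> ?S3" ?G "(?S1 \<times> ?S2) \<times> ?S3" ?W "\<lambda>x. x"
      using M.local_metric[OF cA] l.W.local_metric_axioms G unfolding img by (intro local_isometry_ident)
    interpret Ib: local_isometry "?S1 \<times> ?S2" ?Gb "?S1 \<times> ?S2" ?Wb "\<lambda>x. x"
      using w.M1.local_metric[OF cb] lb.W.local_metric_axioms Gb unfolding img by (intro local_isometry_ident)
    let ?u = "coord_vec A c ?p" and ?ub = "coord_vec Abar cb (p1, p2)"
    have u: "?u v \<in> tangent_space A ?p" "coords c (?u v) = v" for v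
      using M.coord_vec_in_tangent_space[OF cA cp] M.coords_coord_vec[OF cA cp] by auto
    have ub: "?ub v \<in> tangent_space Abar (p1, p2)" "coords cb (?ub v) = v" for v
      using w.M1.coord_vec_in_tangent_space[OF cb pb] w.M1.coords_coord_vec[OF cb pb] by auto
    have g: "g ?p (?u v) (?u w) = ?W ?x v w" for v w
      using M.local_form_coords[OF cA cp u(1) u(1), of v w] G[OF xS] by (simp add: u mp)
    have gb: "gbar (p1, p2) (?ub v) (?ub w) = ?Wb (?x1, ?x2) v w" for v w
      using w.M1.local_form_coords[OF cb pb ub(1) ub(1), of v w] Gb[OF xb] by (simp add: ub mp)
    have hess_F: "local_hessian ?W (\<lambda>z. ?F (fst (fst z))) ?x v w = \<sigma> ?p * ?W ?x v w" for v w
    proof -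
      have "smooth_on ((?S1 \<times> ?S2) \<times> ?S3) (\<lambda>z. ?F (fst (fst z)))"
        by (intro smooth_on_compose_fst[where F="\<lambda>z. ?F (fst z)"] smooth_on_compose_fst[where F="?F"]
            lb.W.open_S lb.B.open_S lb.F.open_S l.F.open_S lb.smooth_H)
      moreover have "((\<lambda>p. f (fst (fst p))) \<circ> chart_inv c) z = ?F (fst (fst z))" if "z \<in> (?S1 \<times> ?S2) \<times> ?S3" for z
        using that w.inv_prod[OF cb c3, of z] w12.inv_prod[OF c1 c2, of "fst z"]
        unfolding c_eq img by (auto simp: cb_eq)
      ultimately have "local_hessian ?W (\<lambda>z. ?F (fst (fst z))) ?x v w
          = local_hessian ?G ((\<lambda>p. f (fst (fst p))) \<circ> chart_inv c) ?x v w"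
        using I.hessian_pullback[OF xS] by simp
      also have "\<dots> = hessian A g (\<lambda>p. f (fst (fst p))) ?p (?u v) (?u w)"
        unfolding hessian_def Let_def c_def[symmetric] by (simp add: u mp)
      also have "\<dots> = \<sigma> ?p * ?W ?x v w"
        using assms(14) u(1) unfolding tensor2_eq_def by (simp add: g)
      finally show ?thesis .
    qed
    have hess_H: "local_hessian ?Wb ?H (?x1, ?x2) v w = \<psi> (p1, p2) * ?Wb (?x1, ?x2) v w" for v w
    proof -
      have "local_hessian ?Wb ?H (?x1, ?x2) v w = local_hessian ?Gb ?H (?x1, ?x2) v w"
        using Ib.hessian_pullback[OF xb l.smooth_H, of ?H] by simp
      also have "\<dots> = hessian Abar gbar h (p1, p2) (?ub v) (?ub w)"
        using w.M1.hessian_in_chart[OF cb pb assms(10) ub(1) ub(1)] by (simp add: ub mp)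
      also have "\<dots> = \<psi> (p1, p2) * ?Wb (?x1, ?x2) v w"
        using assms(16) ub(1) unfolding tensor2_eq_def by (simp add: gb)
      finally show ?thesis .
    qed
    have X: "local_field c X z = ((local_field c1 Z1 (fst (fst z)), local_field c2 Z2 (snd (fst z))), local_field c3 Z3 (snd z))"
      if z: "z \<in> (?S1 \<times> ?S2) \<times> ?S3" for z
    proof -
      let ?r = "((chart_inv c1 (fst (fst z)), chart_inv c2 (snd (fst z))), chart_inv c3 (snd z))"
      have XT: "X r \<in> tangent_space (prod_atlas Abar A3) r" for r using sX unfolding smooth_vector_field_def A_def by blast
      have b: "chart_inv cb (fst z) = fst ?r"
        using w12.inv_prod[OF c1 c2, of "fst z"] z by (auto simp: cb_eq)
      have "local_field c X z = (coords cb (push fst (X ?r)), coords c3 (push snd (X ?r)))"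
        using w.local_field_prod[OF cb c3 _ XT, of z] z unfolding c_eq img b by simp
      \<comment> \<open>The components split a second time along the base chart, which requires the
        pushed vector to be tangent to the base.\<close>
      moreover have "coords cb (push fst (X ?r)) = (coords c1 (push fst (push fst (X ?r))), coords c2 (push snd (push fst (X ?r))))"
        unfolding cb_eq
      proof (rule w12.coords_prod[OF c1 c2, of "fst ?r"])
        show "push fst (X ?r) \<in> tangent_space (prod_atlas A1 A2) (fst ?r)"
          using w.push_fst_tangent[OF XT] unfolding Abar_def .
      qed (use z w12.M1.chartD(5)[OF c1] w12.M2.chartD(5)[OF c2] in auto)
      moreover have "push fst (push fst (X r)) = push (fst \<circ> fst) (X r)" "push snd (push fst (X r)) = push (snd \<circ> fst) (X r)" for r
        by (simp_all add: push_def comp_assoc)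
      ultimately show ?thesis using lift by (simp add: local_field_def)
    qed
    have smX: "smooth_on ((?S1 \<times> ?S2) \<times> ?S3) (local_field c X)"
      using sX cA unfolding smooth_vector_field_def img(2)[symmetric] by blast
    \<comment> \<open>At the fixed point lam + rho R is a single number and plays the part of m in
      the local lemma.\<close>
    have sol: "local_ricci ?W ?x v w + 1/2 * local_lie ?W (local_field c X) ?x v w
        = (lam + rho * scalar_curvature A g ?p) * ?W ?x v w" for v w
    proof -
      have "local_ricci ?W ?x v w = ricci A g ?p (?u v) (?u w)"
        using I.ricci_pullback[OF xS, of v w] unfolding ricci_def Let_def c_def[symmetric] by (simp add: u mp)
      moreover have "local_lie ?W (local_field c X) ?x v w = lie_deriv_metric A X g ?p (?u v) (?u w)"
        using I.lie_pullback[OF xS smX smX, of v w] unfolding lie_deriv_metric_def Let_def c_def[symmetric] by (simp add: u mp)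
      ultimately show ?thesis
        using soliton u(1) unfolding ricci_bourguignon_soliton_def tensor2_eq_def by (simp add: g distrib_right)
    qed
    note K1 = w12.M1.killing_or_zero_in_chart[OF c1 p(1) Z(1)] and K2 = w12.M2.killing_or_zero_in_chart[OF c2 p(2) Z(2)]
      and K3 = w.M2.killing_or_zero_in_chart[OF c3 p(3) Z(3)]
    note E = sequential_warped_soliton_local[OF lw12 lw123 x hess_F hess_H K1(1) K2(1) K3(1) X K1(2) K2(2) K3(2) sol]
    show ?thesis using c1 c2 c3 p E by blast
  qed
  show ?thesis
  proof (intro conjI)
    show "einstein A1 g1" by (rule w12.M1.einsteinI) (use key in blast)
    show "einstein A2 g2" by (rule w12.M2.einsteinI) (use key in blast)
    show "einstein A3 g3" by (rule w.M2.einsteinI) (use key in blast)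
  qed
qed

end
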